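(* Let $d\ge1$, let $a=(a_n)_{n\in\mathbb{Z}^d}$ be an odd sequence with $\sum_n|a_n|<\infty$ and let $f(x)=\sum_{n\in\mathbb{Z}^d\setminus\{0\}}a_n\{n\cdot x\}$. Assume that $\mathrm{supp}(a)$ is sparse, that $\theta_a\le 1$, and that $0<\gamma_a<\infty$. For $h\ge0$ let $E'_f(h)=\{x\in\mathbb{R}^d\setminus\mathcal{D}(J(a)): h_f(x)\le h\}$. Then for every real $h\in(0,\gamma_a]$, $E'_f(h)$ belongs to the class $\widetilde{\mathcal{G}}^{\,d-1+h/\gamma_a}$, and for every nonempty open set $W\subseteq\mathbb{R}^d$, \[ \dim_{\mathrm H}(E'_f(h)\cap W)=d-1+\frac{h}{\gamma_a}\quad\text{and}\quad \dim_{\mathrm P}(E'_f(h)\cap W)=d. \]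
   Context: $\{x\}=x-\lfloor x\rfloor-\tfrac12$ for $x\notin\mathbb{Z}$, $\{x\}=0$ for $x\in\mathbb{Z}$. Odd: $a_{-n}=-a_n$. $|n|$ is the Euclidean norm; $\mathrm{supp}(a)=\{n:a_n\ne0\}$. Sparse: $\lim_{R\to\infty}\log\#(\mathrm{supp}(a)\cap B(0,R))/\log R=0$. $J(a)=A$ with $A_q=2\sum_{l\ge1}a_{lq}$; $\overline a_q=\sup_{l\ge1}|a_{lq}|$; $\theta_a=\limsup_{q\to\infty,\,q\in\mathrm{supp}(\overline a)}\log|A_q|/\log|\overline a_q|$; $\gamma_a=\liminf_{n\to\infty,\,n\in\mathrm{supp}(a)}(-\log|a_n|)/\log|n|$. For $p\in\mathbb{Z}$ and $q\in\mathbb{Z}^d\setminus\{0\}$, $H_{p,q}=\{x:q\cdot x=p\}$; $\mathbb{Z}^d_+$ = nonzero integer vectors whose first nonzero coordinate is positive; $\mathcal{H}_d=\{(p,q)\in\mathbb{Z}\times\mathbb{Z}^d_+:\gcd(p,q)=1\}$ (gcd of $p$ and the components of $q$); $\mathcal{D}(J(a))=\bigcup_{(p,q)\in\mathcal{H}_d,\,q\in\mathrm{supp}(A)}H_{p,q}$. Hölder exponent $h_f(x_0)=\sup\{\alpha\ge0: \exists C>0,\ \exists P \text{ polynomial of degree}<\alpha,\ |f(x)-P(x)|\le C|x-x_0|^\alpha \text{ near } x_0\}$. For $s\in(0,d]$, Falconer's class $\mathcal{G}^s$ is the collection of $G_\delta$-subsets $E$ of $\mathbb{R}^d$ such that $\dim_{\mathrm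 H}\bigcap_{n\ge1}\varsigma_n(E)\ge s$ for every sequence $(\varsigma_n)$ of similarity transformations of $\mathbb{R}^d$; $\widetilde{\mathcal{G}}^s$ is the class of sets $E\subseteq\mathbb{R}^d$ containing some member of $\mathcal{G}^s$. $\dim_{\mathrm H}$, $\dim_{\mathrm P}$ are Hausdorff and packing dimension. *)

theory Defs
  imports "HOL-Analysis.Analysis"
begin

section \<open>Hausdorff and packing dimension\<close>

text \<open>Real powers of nonnegative reals with \<open>0\<^sup>0 = 1\<close>, in contrast to \<open>0 powr 0 = 0\<close>.\<close>

definition rpow :: "real \<Rightarrow> real \<Rightarrow> real" where
  "rpow t s = (if s = 0 then 1 else t powr s)"

text \<open>The library's \<^const>\<open>diameter\<close> is only meaningful on bounded sets, so covers are
  required to consist of bounded sets; the empty set contributes \<open>0\<close> also for \<open>s = 0\<close>.\<close>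

definition hausdorff_content :: "real \<Rightarrow> real \<Rightarrow> 'a::metric_space set \<Rightarrow> ennreal" where
  "hausdorff_content s \<delta> E =
     (INF U \<in> {U :: nat \<Rightarrow> 'a set. E \<subseteq> (\<Union>i. U i) \<and> (\<forall>i. bounded (U i) \<and> diameter (U i) \<le> \<delta>)}.
        \<Sum>i. if U i = {} then 0 else ennreal (rpow (diameter (U i)) s))"

definition hausdorff_measure :: "real \<Rightarrow> 'a::metric_space set \<Rightarrow> ennreal" where
  "hausdorff_measure s E = (SUP \<delta> \<in> {0<..}. hausdorff_content s \<delta> E)"

definition hausdorff_dim :: "'a::metric_space set \<Rightarrow> ereal" where
  "hausdorff_dim E = Inf {ereal s | s. 0 \<le> s \<and> hausdorff_measure s E = 0}"

text \<open>A \<open>\<delta>\<close>-packing of \<open>E\<close> is encoded as a set of (centre, radius) pairs.\<close>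

definition packings :: "real \<Rightarrow> 'a::metric_space set \<Rightarrow> ('a \<times> real) set set" where
  "packings \<delta> E = {B. B \<subseteq> E \<times> {0<..\<delta>} \<and>
     pairwise (\<lambda>(x, r) (y, t). cball x r \<inter> cball y t = {}) B}"

definition packing_premeasure :: "real \<Rightarrow> 'a::metric_space set \<Rightarrow> ennreal" where
  "packing_premeasure s E =
     (INF \<delta> \<in> {0<..}. SUP B \<in> packings \<delta> E. \<Sum>\<^sub>\<infinity>(x, r)\<in>B. ennreal ((2 * r) powr s))"

definition packing_measure :: "real \<Rightarrow> 'a::metric_space set \<Rightarrow> ennreal" where
  "packing_measure s E =
     (INF F \<in> {F :: nat \<Rightarrow> 'a set. E \<subseteq> (\<Union>i. F i)}. \<Sum>i. packing_premeasure s (F i))"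

definition packing_dim :: "'a::metric_space set \<Rightarrow> ereal" where
  "packing_dim E = Inf {ereal s | s. 0 \<le> s \<and> packing_measure s E = 0}"

section \<open>Falconer's classes of sets with large intersection\<close>

definition similarity :: "('a::metric_space \<Rightarrow> 'a) \<Rightarrow> bool" where
  "similarity \<phi> \<longleftrightarrow> (\<exists>r>0. \<forall>x y. dist (\<phi> x) (\<phi> y) = r * dist x y)"

definition falconer_class :: "real \<Rightarrow> 'a::euclidean_space set set" where
  "falconer_class s = {E. gdelta_in euclidean E \<and>
     (\<forall>\<phi> :: nat \<Rightarrow> 'a \<Rightarrow> 'a. (\<forall>n. similarity (\<phi> n)) \<longrightarrow>
        ereal s \<le> hausdorff_dim (\<Inter>n. \<phi> n ` E))}"

definition falconer_class_ext :: "real \<Rightarrow> 'a::euclidean_space set set" where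
  "falconer_class_ext s = {E. \<exists>G \<in> falconer_class s. G \<subseteq> E}"

section \<open>Pointwise Hoelder exponent\<close>

text \<open>The zero polynomial (empty \<open>K\<close>) has degree below every \<open>\<alpha>\<close>, including \<open>\<alpha> = 0\<close>.\<close>

definition poly_degree_less :: "real \<Rightarrow> (real ^ 'n \<Rightarrow> real) \<Rightarrow> bool" where
  "poly_degree_less \<alpha> P \<longleftrightarrow>
     (\<exists>(K :: ('n \<Rightarrow> nat) set) c. finite K \<and> (\<forall>k\<in>K. real (\<Sum>i\<in>UNIV. k i) < \<alpha>) \<and>
        P = (\<lambda>x. \<Sum>k\<in>K. c k * (\<Prod>i\<in>UNIV. (x $ i) ^ k i)))"

definition holder_exponent :: "(real ^ 'n \<Rightarrow> real) \<Rightarrow> real ^ 'n \<Rightarrow> ereal" where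
  "holder_exponent f x0 = Sup {ereal \<alpha> | \<alpha>. 0 \<le> \<alpha> \<and>
     (\<exists>C>0. \<exists>P. poly_degree_less \<alpha> P \<and>
        (\<forall>\<^sub>F x in nhds x0. \<bar>f x - P x\<bar> \<le> C * rpow (norm (x - x0)) \<alpha>))}"

section \<open>Davenport series\<close>

definition sawtooth :: "real \<Rightarrow> real" where
  "sawtooth x = (if x \<in> \<int> then 0 else x - of_int \<lfloor>x\<rfloor> - 1 / 2)"

definition real_vec :: "int ^ 'n \<Rightarrow> real ^ 'n" where
  "real_vec n = (\<chi> i. of_int (n $ i))"

definition davenport_series :: "(int ^ 'n \<Rightarrow> real) \<Rightarrow> real ^ 'n \<Rightarrow> real" where
  "davenport_series a x = (\<Sum>\<^sub>\<infinity>n\<in>UNIV - {0}. a n * sawtooth (real_vec n \<bullet> x))"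

definition odd_seq :: "(int ^ 'n \<Rightarrow> real) \<Rightarrow> bool" where
  "odd_seq a \<longleftrightarrow> (\<forall>n. a (- n) = - a n)"

definition supp :: "(int ^ 'n \<Rightarrow> real) \<Rightarrow> (int ^ 'n) set" where
  "supp a = {n. a n \<noteq> 0}"

definition sparse_int_set :: "(int ^ 'n) set \<Rightarrow> bool" where
  "sparse_int_set S \<longleftrightarrow>
     ((\<lambda>R. ln (real (card {n \<in> S. norm (real_vec n) < R})) / ln R) \<longlongrightarrow> 0) at_top"

definition at_infinity_in :: "(int ^ 'n) set \<Rightarrow> (int ^ 'n) filter" where
  "at_infinity_in S = inf (filtercomap (\<lambda>n. norm (real_vec n)) at_top) (principal S)"

text \<open>The jump sequence \<open>J(a)\<close>.\<close>

definition jump_seq :: "(int ^ 'n \<Rightarrow> real) \<Rightarrow> int ^ 'n \<Rightarrow> real" where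
  "jump_seq a q = 2 * (\<Sum>\<^sub>\<infinity>l\<in>{1::nat..}. a (int l *s q))"

definition sup_seq :: "(int ^ 'n \<Rightarrow> real) \<Rightarrow> int ^ 'n \<Rightarrow> real" where
  "sup_seq a q = (SUP l\<in>{1::nat..}. \<bar>a (int l *s q)\<bar>)"

text \<open>Logarithm with \<open>log 0 = -\<infinity>\<close>: a vanishing \<open>A\<^sub>q\<close> with \<open>q \<in> supp (sup_seq a)\<close> and
  \<open>sup_seq a q < 1\<close> must contribute \<open>+\<infinity>\<close> to \<open>\<theta>\<^sub>a\<close>, whereas \<open>ln 0 = 0\<close> in the library.\<close>

definition elog :: "real \<Rightarrow> ereal" where
  "elog t = (if t = 0 then - \<infinity> else ereal (ln t))"

definition theta :: "(int ^ 'n \<Rightarrow> real) \<Rightarrow> ereal" where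
  "theta a = Limsup (at_infinity_in (supp (sup_seq a)))
     (\<lambda>q. elog \<bar>jump_seq a q\<bar> / elog \<bar>sup_seq a q\<bar>)"

definition gamma :: "(int ^ 'n \<Rightarrow> real) \<Rightarrow> ereal" where
  "gamma a = Liminf (at_infinity_in (supp a))
     (\<lambda>n. ereal (- ln \<bar>a n\<bar> / ln (norm (real_vec n))))"

definition hyperplane :: "int \<Rightarrow> int ^ 'n \<Rightarrow> (real ^ 'n) set" where
  "hyperplane p q = {x. real_vec q \<bullet> x = of_int p}"

definition pos_int_vecs :: "(int ^ 'n::{finite,linorder}) set" where
  "pos_int_vecs = {q. \<exists>i. q $ i > 0 \<and> (\<forall>j<i. q $ j = 0)}"

definition hyperplane_indices :: "(int \<times> (int ^ 'n::{finite,linorder})) set" where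
  "hyperplane_indices =
     {(p, q). q \<in> pos_int_vecs \<and> Gcd (insert p (range (\<lambda>i. q $ i))) = 1}"

definition discontinuity_set ::
    "(int ^ 'n::{finite,linorder} \<Rightarrow> real) \<Rightarrow> (real ^ 'n::{finite,linorder}) set" where
  "discontinuity_set A = (\<Union>(p, q) \<in> {(p, q) \<in> hyperplane_indices. q \<in> supp A}. hyperplane p q)"

definition iso_holder_le ::
    "(int ^ 'n::{finite,linorder} \<Rightarrow> real) \<Rightarrow> real \<Rightarrow> (real ^ 'n::{finite,linorder}) set" where
  "iso_holder_le a h = {x. x \<notin> discontinuity_set (jump_seq a) \<and>
     holder_exponent (davenport_series a) x \<le> ereal h}"

end

theory Submission
  imports Defs
begin

text \<open>Write \<open>d\<close> for the dimension and \<open>\<gamma> = \<gamma>\<^sub>a\<close>. Off the rational hyperplanes, the regularity of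
  \<open>f\<close> at \<open>x\<close> is governed by how well \<open>x\<close> is approximated by the hyperplanes \<open>n \<cdot> x = p\<close> with
  \<open>n \<in> supp a\<close>: a jump of size \<open>|a\<^sub>n|\<close> at distance \<open>|a\<^sub>n|\<^bsup>1/h\<^esup>\<close> forces \<open>h\<^sub>f(x) \<le> h\<close>, since \<open>\<theta>\<^sub>a \<le> 1\<close>
  prevents the jumps from cancelling, and conversely \<open>h\<^sub>f(x)\<close> can drop to \<open>h < \<gamma>\<close> only if such
  approximations occur infinitely often. The upper bound covers the corresponding limsup set by
  slabs, and sparseness makes the sums converge. For the lower bound, the limsup set contains a
  limsup of layers of spacing \<open>1/|n|\<close> and thickness about \<open>|n|\<^bsup>-\<gamma>/h\<^esup>\<close>, for
  arbitrarily large \<open>|n|\<close>. Countably many similar copies of it contain a common Cantor set of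
  dimension arbitrarily close to \<open>d - 1 + h/\<gamma>\<close>, obtained by choosing one layer family per step,
  each much finer than the previous ones. As this exceeds \<open>d - 1\<close>, removing the rational
  hyperplanes is harmless. The limsup set is also residual, so its packing dimension is \<open>d\<close>.\<close>

section \<open>Hausdorff content\<close>

text \<open>Dimensions are computed through Hausdorff content, which puts no bound on diameters: it
  is countably subadditive, and for positive exponents it vanishes exactly when the measure does.
  Lower bounds are only tested at exponents above \<open>d - 1\<close>, where hyperplanes have
  content zero.

  The lower bound must survive countable intersections. The Cantor step is therefore a property of
  one set, valid from every cube, with a constant \<open>C\<close> that will depend on
  \<open>d\<close> alone; the tree estimate loses \<open>C\<close> once, not once per generation.
  The exponent comes from counting: layers of frequency \<open>N\<close> whose thickness in distance
  is about \<open>N^(-c/h)\<close>, with \<open>c\<close> slightly above \<gamma>, number about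
  \<open>N\<close> per unit length, and \<open>N\<close> beats \<open>(N^(c/h))^b\<close> exactly
  when \<open>b < h/c\<close>.

  The upper bound on the Hoelder exponent meets another obstacle: \<open>n\<close> and
  \<open>p\<close> may have a common factor. The hyperplane then belongs to a shorter vector
  \<open>q\<close>, its jump collects all multiples of \<open>q\<close>, and \<open>q\<close> may
  stay short while \<open>n\<close> grows. Since \<open>x\<close> lies on no rational hyperplane,
  close approximation rules out short \<open>q\<close>.\<close>

definition hcontent :: "real \<Rightarrow> 'a::metric_space set \<Rightarrow> ennreal" where
  "hcontent t E = (INF U \<in> {U :: nat \<Rightarrow> 'a set. E \<subseteq> (\<Union>i. U i) \<and> (\<forall>i. bounded (U i))}.
     \<Sum>i. ennreal (diameter (U i) powr t))"

lemma hcontent_le: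
  assumes "E \<subseteq> (\<Union>i. U i)" "\<And>i. bounded (U i)"
  shows "hcontent t E \<le> (\<Sum>i. ennreal (diameter (U i) powr t))"
  unfolding hcontent_def by (rule INF_lower) (use assms in auto)

lemma hcontent_coverE:
  assumes "hcontent t E < e"
  obtains U where "E \<subseteq> (\<Union>i. U i)" "\<And>i. bounded (U i)"
    "(\<Sum>i. ennreal (diameter (U i) powr t)) < e"
  using assms unfolding hcontent_def INF_less_iff by blast

lemma hcontent_mono: "E \<subseteq> F \<Longrightarrow> hcontent t E \<le> hcontent t F"
  unfolding hcontent_def by (rule INF_superset_mono) auto

lemma hcontent_UN_le:
  fixes A :: "nat \<Rightarrow> 'a::metric_space set"
  shows "hcontent t (\<Union>n. A n) \<le> (\<Sum>n. hcontent t (A n))"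
proof (cases "\<exists>n. hcontent t (A n) = \<infinity>")
  case True
  then obtain n where n: "hcontent t (A n) = top" by (auto simp: infinity_ennreal_def)
  have "sum (\<lambda>k. hcontent t (A k)) {n} \<le> (\<Sum>n. hcontent t (A n))"
    by (rule sum_le_suminf) auto
  with n show ?thesis by (simp add: top.extremum_unique)
next
  case False
  show ?thesis
  proof (rule ennreal_le_epsilon)
    fix e :: real assume e: "0 < e"
    \<comment> \<open>Finiteness of every content, secured by the case split, makes the inequality
      with the geometric share of \<open>e\<close> strict.\<close>
    have "\<exists>U. A n \<subseteq> (\<Union>i. U i) \<and> (\<forall>i. bounded (U i)) \<and>
       (\<Sum>i. ennreal (diameter (U i) powr t)) < hcontent t (A n) + ennreal (e * (1/2)^Suc n)" for n
    proof -
      have "hcontent t (A n) < hcontent t (A n) + ennreal (e * (1/2)^Suc n)"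
        using False e ennreal_add_left_cancel_less[of "hcontent t (A n)" 0] by simp
      then show ?thesis by (elim hcontent_coverE) blast
    qed
    then obtain U where U: "\<And>n. A n \<subseteq> (\<Union>i. U n i)" "\<And>n i. bounded (U n i)"
       "\<And>n. (\<Sum>i. ennreal (diameter (U n i) powr t)) < hcontent t (A n) + ennreal (e * (1/2)^Suc n)"
      by metis
    define V where "V k = (case prod_decode k of (n, i) \<Rightarrow> U n i)" for k
    have V: "V (prod_encode (n, i)) = U n i" for n i by (simp add: V_def)
    have "(\<Union>n. A n) \<subseteq> (\<Union>k. V k)"
    proof
      fix x assume "x \<in> (\<Union>n. A n)"
      then obtain n i where "x \<in> U n i" using U(1) by blast
      then show "x \<in> (\<Union>k. V k)" using V by blast
    qed
    moreover have "bounded (V k)" for k using U(2) by (simp add: V_def split: prod.split)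
    ultimately have "hcontent t (\<Union>n. A n) \<le> (\<Sum>k. ennreal (diameter (V k) powr t))"
      by (rule hcontent_le)
    also have "\<dots> = (\<Sum>k. (\<lambda>(n, i). ennreal (diameter (U n i) powr t)) (prod_decode k))"
      by (simp only: V_def case_prod_unfold)
    also have "\<dots> = (\<Sum>n. \<Sum>i. ennreal (diameter (U n i) powr t))"
      by (rule suminf_ennreal_2dimen) (simp only: prod.case)
    also have "\<dots> \<le> (\<Sum>n. hcontent t (A n) + ennreal (e * (1/2)^Suc n))"
      by (rule suminf_le[OF less_imp_le[OF U(3)] summableI summableI])
    also have "\<dots> = (\<Sum>n. hcontent t (A n)) + (\<Sum>n. ennreal (e * (1/2)^Suc n))"
      by (rule suminf_add[OF summableI summableI, symmetric])
    also have "(\<Sum>n. ennreal (e * (1/2)^Suc n)) = ennreal e"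
      using sums_mult[OF power_half_series, of e] e by (intro suminf_ennreal_eq) simp_all
    finally show "hcontent t (\<Union>n. A n) \<le> (\<Sum>n. hcontent t (A n)) + ennreal e" .
  qed
qed

lemma hcontent_empty [simp]: "hcontent t {} = 0"
proof -
  have "hcontent t ({}::'a set) \<le> (\<Sum>i. ennreal (diameter ((\<lambda>_. {} :: 'a set) (i::nat)) powr t))"
    by (rule hcontent_le) auto
  then show ?thesis by simp
qed

lemma hcontent_UN_eq_0:
  assumes "countable I" "\<And>i. i \<in> I \<Longrightarrow> hcontent t (A i) = 0"
  shows "hcontent t (\<Union>i\<in>I. A i) = 0"
proof (cases "I = {}")
  case False
  have "(\<Union>i\<in>I. A i) = (\<Union>n. A (from_nat_into I n))"
    using range_from_nat_into[OF False assms(1)] by (metis image_image)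
  moreover have "hcontent t \<dots> \<le> (\<Sum>n. hcontent t (A (from_nat_into I n)))"
    by (rule hcontent_UN_le)
  moreover have "\<dots> = 0" using assms(2) from_nat_into[OF False] by simp
  ultimately show ?thesis by simp
qed simp

lemma hcontent_Un_le: "hcontent t (A \<union> B) \<le> hcontent t A + hcontent t B"
proof -
  define C where "C n = (if n = 0 then A else if n = 1 then B else {})" for n :: nat
  have "A \<union> B = C 0 \<union> C 1" by (simp add: C_def)
  also have "\<dots> \<subseteq> (\<Union>n. C n)" by blast
  finally have "hcontent t (A \<union> B) \<le> (\<Sum>n. hcontent t (C n))"
    using hcontent_UN_le[of t C] hcontent_mono order_trans by blast
  also have "\<dots> = (\<Sum>n\<in>{0, 1}. hcontent t (C n))" by (rule suminf_finite) (auto simp: C_def)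
  finally show ?thesis by (simp add: C_def)
qed

lemma hcontent_UN_finite_le:
  "finite I \<Longrightarrow> hcontent t (\<Union>i\<in>I. A i) \<le> (\<Sum>i\<in>I. hcontent t (A i))"
proof (induction I rule: finite_induct)
  case (insert i I)
  then show ?case using hcontent_Un_le[of t "A i" "\<Union>i\<in>I. A i"]
    by (simp add: add_left_mono order_trans)
qed simp

lemma hcontent_finite_cover_le:
  assumes "finite I" "E \<subseteq> (\<Union>i\<in>I. U i)" "\<And>i. i \<in> I \<Longrightarrow> bounded (U i)"
    "\<And>i. i \<in> I \<Longrightarrow> diameter (U i) \<le> D" "0 \<le> t" "0 \<le> D"
  shows "hcontent t E \<le> ennreal (card I * D powr t)"
proof -
  obtain f where f: "bij_betw f {0..<card I} I" using ex_bij_betw_nat_finite[OF assms(1)] by blast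
  define V where "V n = (if n < card I then U (f n) else {})" for n
  have fI: "f n \<in> I" if "n < card I" for n using f that by (auto simp: bij_betw_def)
  have "E \<subseteq> (\<Union>n. V n)"
  proof
    fix x assume "x \<in> E"
    then obtain i where i: "i \<in> I" "x \<in> U i" using assms(2) by blast
    then obtain n where "n < card I" "f n = i" using f by (force simp: bij_betw_def)
    then have "x \<in> V n" using i by (simp add: V_def)
    then show "x \<in> (\<Union>n. V n)" by blast
  qed
  then have "hcontent t E \<le> (\<Sum>i. ennreal (diameter (V i) powr t))"
    by (rule hcontent_le) (use assms(3) fI in \<open>simp add: V_def\<close>)
  also have "\<dots> = (\<Sum>i<card I. ennreal (diameter (V i) powr t))"
    by (rule suminf_finite) (auto simp: V_def)
  also have "\<dots> \<le> (\<Sum>i<card I. ennreal (D powr t))"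
    using assms fI by (intro sum_mono ennreal_leI powr_mono2) (auto simp: V_def diameter_ge_0)
  also have "\<dots> = ennreal (card I * D powr t)"
    by (simp add: ennreal_mult ennreal_of_nat_eq_real_of_nat)
  finally show ?thesis .
qed

text \<open>For \<open>t > 0\<close> a cover with small total mass automatically has small diameters.\<close>

lemma hausdorff_measure_eq_0_iff:
  fixes E :: "'a::metric_space set"
  assumes "t > 0"
  shows "hausdorff_measure t E = 0 \<longleftrightarrow> hcontent t E = 0"
proof -
  have eq: "(if U = {} then 0 else ennreal (rpow (diameter U) t)) = ennreal (diameter U powr t)"
    for U :: "'a set" using assms by (simp add: rpow_def)
  have 1: "hcontent t E \<le> hausdorff_content t d E" for d
    unfolding hcontent_def hausdorff_content_def eq by (rule INF_superset_mono) auto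
  have 2: "hausdorff_content t d E = 0" if z: "hcontent t E = 0" and d: "d > 0" for d
  proof (rule ccontr)
    assume ne: "hausdorff_content t d E \<noteq> 0"
    define e where "e = min (hausdorff_content t d E) (ennreal (d powr t))"
    have "hcontent t E < e" using z d ne by (simp add: e_def zero_less_iff_neq_zero)
    then obtain U where U: "E \<subseteq> (\<Union>i. U i)" "\<And>i. bounded (U i)"
      "(\<Sum>i. ennreal (diameter (U i) powr t)) < e" by (rule hcontent_coverE) blast
    have "diameter (U i) \<le> d" for i
    proof -
      have "sum (\<lambda>i. ennreal (diameter (U i) powr t)) {i} \<le> (\<Sum>i. ennreal (diameter (U i) powr t))"
        by (rule sum_le_suminf) auto
      also have "\<dots> < ennreal (d powr t)" using U(3) by (simp add: e_def)
      finally have "diameter (U i) powr t < d powr t" by (simp add: ennreal_less_iff)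
      then show ?thesis using assms d powr_mono2[of t d "diameter (U i)"]
        by (meson less_eq_real_def not_le order_less_imp_le)
    qed
    then have "hausdorff_content t d E \<le> (\<Sum>i. ennreal (diameter (U i) powr t))"
      unfolding hausdorff_content_def eq by (intro INF_lower) (use U in auto)
    also have "\<dots> < hausdorff_content t d E" using U(3) by (simp add: e_def)
    finally show False by simp
  qed
  show ?thesis
  proof
    assume "hausdorff_measure t E = 0"
    then have "hausdorff_content t 1 E \<le> 0"
      unfolding hausdorff_measure_def by (metis SUP_upper greaterThan_iff zero_less_one)
    with 1[of 1] show "hcontent t E = 0" by simp
  next
    assume "hcontent t E = 0"
    then show "hausdorff_measure t E = 0"
      unfolding hausdorff_measure_def using 2 by (simp add: SUP_eq_const[of "{0<..}"] gt_ex)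
  qed
qed

text \<open>For sets of diameter at most one, a larger exponent costs less. Passing from the measure
  at \<open>s\<close> to the content at \<open>t\<close> in one step also absorbs
  \<open>s = 0\<close>, where the two notions differ: \<open>0 powr 0 = 0\<close> gives a point
  content zero.\<close>

lemma hausdorff_measure_eq_0_mono:
  fixes E :: "'a::metric_space set"
  assumes "hausdorff_measure s E = 0" "0 \<le> s" "s < t"
  shows "hcontent t E = 0"
proof -
  have "hcontent t E \<le> hausdorff_content s 1 E" unfolding hausdorff_content_def
  proof (rule INF_greatest)
    fix U :: "nat \<Rightarrow> 'a set"
    assume U: "U \<in> {U. E \<subseteq> (\<Union>i. U i) \<and> (\<forall>i. bounded (U i) \<and> diameter (U i) \<le> 1)}"
    have "hcontent t E \<le> (\<Sum>i. ennreal (diameter (U i) powr t))"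
      by (rule hcontent_le) (use U in auto)
    also have "\<dots> \<le> (\<Sum>i. if U i = {} then 0 else ennreal (rpow (diameter (U i)) s))"
    proof (rule suminf_le)
      fix i
      have d: "0 \<le> diameter (U i)" "diameter (U i) \<le> 1" using U diameter_ge_0 by auto
      \<comment> \<open>For \<open>s = 0\<close> a nonempty set costs one on the right; an empty set
        costs zero on both sides, its diameter being zero.\<close>
      have "diameter (U i) powr t \<le> rpow (diameter (U i)) s"
      proof (cases "s = 0")
        case True
        then show ?thesis using d assms(3) powr_le1[of t "diameter (U i)"] by (simp add: rpow_def)
      next
        case False
        then show ?thesis using d assms powr_mono'[of s t "diameter (U i)"] by (simp add: rpow_def)
      qed
      then show "ennreal (diameter (U i) powr t) \<le> (if U i = {} then 0 else ennreal (rpow (diameter (U i)) s))"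
        by (auto intro: ennreal_leI)
    qed auto
    finally show "hcontent t E \<le> (\<Sum>i. if U i = {} then 0 else ennreal (rpow (diameter (U i)) s))" .
  qed
  also have "\<dots> \<le> hausdorff_measure s E" unfolding hausdorff_measure_def by (rule SUP_upper) auto
  finally show ?thesis using assms(1) by simp
qed

text \<open>The bound \<open>c\<close> restricts the test to exponents close to \<open>s\<close>. It
  will be \<open>d - 1\<close>, above which hyperplanes have content zero.\<close>

lemma hausdorff_dim_ge:
  assumes "\<And>t. c < t \<Longrightarrow> t < s \<Longrightarrow> hcontent t E \<noteq> 0" "c < s"
  shows "ereal s \<le> hausdorff_dim E"
  unfolding hausdorff_dim_def
proof (rule Inf_greatest)
  fix z assume "z \<in> {ereal s |s. 0 \<le> s \<and> hausdorff_measure s E = 0}"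
  then obtain r where r: "z = ereal r" "0 \<le> r" "hausdorff_measure r E = 0" by auto
  show "ereal s \<le> z"
  proof (rule ccontr)
    assume "\<not> ereal s \<le> z"
    then have "r < s" using r by simp
    then obtain t where t: "max r c < t" "t < s" using assms(2) dense[of "max r c" s] by auto
    then have "hcontent t E = 0" using hausdorff_measure_eq_0_mono[OF r(3,2), of t] by simp
    with assms(1)[of t] t show False by simp
  qed
qed

lemma hausdorff_dim_le:
  assumes "\<And>t. s < t \<Longrightarrow> hcontent t E = 0" "0 \<le> s"
  shows "hausdorff_dim E \<le> ereal s"
proof (rule ereal_le_epsilon2)
  fix e :: real assume "0 < e"
  then have "hausdorff_measure (s + e) E = 0" using assms by (simp add: hausdorff_measure_eq_0_iff)
  then have "ereal (s + e) \<in> {ereal s |s. 0 \<le> s \<and> hausdorff_measure s E = 0}"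
    using assms(2) \<open>0 < e\<close> by auto
  then show "hausdorff_dim E \<le> ereal s + ereal e"
    unfolding hausdorff_dim_def by (simp add: Inf_lower)
qed

text \<open>The convergence half of the Borel-Cantelli lemma for content: \<open>E\<close> lies in
  every tail of the family, and the tails of a convergent sum are arbitrarily small.\<close>

lemma hcontent_limsup_eq_0:
  fixes A :: "'i::countable \<Rightarrow> 'a::metric_space set"
  assumes sm: "b summable_on I" and b0: "\<And>i. i \<in> I \<Longrightarrow> 0 \<le> b i"
    and le: "\<And>i. i \<in> I \<Longrightarrow> hcontent t (A i) \<le> ennreal (b i)"
    and sub: "\<And>F. finite F \<Longrightarrow> F \<subseteq> I \<Longrightarrow> E \<subseteq> (\<Union>i\<in>I - F. A i)"
  shows "hcontent t E = 0"
proof -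
  have "hcontent t E \<le> 0 + ennreal e" if e: "e > 0" for e
  proof -
    obtain F where F: "finite F" "F \<subseteq> I" "dist (sum b F) (infsum b I) \<le> e"
      using infsum_finite_approximation[OF sm e] by auto
    \<comment> \<open>The tail is laid out as a sequence through \<open>to_nat\<close>, with empty
      sets at the remaining positions, so that countable subadditivity applies.\<close>
    define B where "B k = (if k \<in> to_nat ` (I - F) then A (from_nat k) else {})" for k
    have "E \<subseteq> (\<Union>k. B k)"
    proof -
      have "A i \<subseteq> (\<Union>k. B k)" if "i \<in> I - F" for i
      proof -
        have "A i = B (to_nat i)" using that by (auto simp: B_def)
        then show ?thesis by (simp add: UN_upper)
      qed
      then have "(\<Union>i\<in>I - F. A i) \<subseteq> (\<Union>k. B k)" by (rule UN_least)
      with sub[OF F(1,2)] show ?thesis by (rule subset_trans)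
    qed
    then have "hcontent t E \<le> hcontent t (\<Union>k. B k)" by (rule hcontent_mono)
    also have "\<dots> \<le> (\<Sum>k. hcontent t (B k))" by (rule hcontent_UN_le)
    also have "\<dots> \<le> ennreal e"
    proof (rule suminf_le_const)
      fix n
      let ?S = "{i \<in> I - F. to_nat i < n}"
      have fin: "finite ?S"
        by (rule finite_imageD[of to_nat]) (auto intro: finite_subset[of _ "{..<n}"] inj_on_subset[OF inj_to_nat])
      have "(\<Sum>k<n. hcontent t (B k)) = (\<Sum>k\<in>to_nat ` ?S. hcontent t (B k))"
        by (rule sum.mono_neutral_right) (auto simp: B_def)
      also have "\<dots> = (\<Sum>i\<in>?S. hcontent t (B (to_nat i)))"
        by (subst sum.reindex) (auto intro: inj_on_subset[OF inj_to_nat])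
      also have "\<dots> \<le> (\<Sum>i\<in>?S. ennreal (b i))" using le by (intro sum_mono) (auto simp: B_def)
      also have "\<dots> = ennreal (sum b ?S)" using b0 by (intro sum_ennreal) auto
      also have "sum b ?S \<le> e"
      proof -
        have "sum b ?S + sum b F = sum b (?S \<union> F)" using fin F(1) by (subst sum.union_disjoint) auto
        also have "\<dots> \<le> infsum b I" using F fin b0 sm by (intro finite_sum_le_infsum) auto
        finally show ?thesis using F(3) by (simp add: dist_real_def)
      qed
      then have "ennreal (sum b ?S) \<le> ennreal e" by (rule ennreal_leI)
      finally show "(\<Sum>k<n. hcontent t (B k)) \<le> ennreal e" .
    qed auto
    finally show ?thesis by simp
  qed
  then have "hcontent t E \<le> 0" by (rule ennreal_le_epsilon)
  then show ?thesis by simp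
qed

section \<open>Slabs and hyperplanes\<close>

definition cube :: "real ^ 'n \<Rightarrow> real \<Rightarrow> (real ^ 'n) set" where
  "cube x l = {z. \<forall>i. \<bar>z $ i - x $ i\<bar> \<le> l}"

lemma cube_eq_cbox: "cube x l = cbox (\<chi> i. x $ i - l) (\<chi> i. x $ i + l)"
  by (auto simp: cube_def mem_box_cart abs_le_iff algebra_simps)

lemma compact_cube: "compact (cube x l)"
  by (simp add: cube_eq_cbox)

lemma card_ge_1: "1 \<le> real CARD('a::finite)"
  by (simp add: Suc_le_eq)

lemma nat_floor_bounds:
  fixes x :: real
  assumes "1 \<le> x"
  shows "real (nat \<lfloor>x\<rfloor>) \<le> x" "x / 2 \<le> real (nat \<lfloor>x\<rfloor>)"
proof -
  have "1 \<le> \<lfloor>x\<rfloor>" using assms by simp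
  moreover have "x < real_of_int \<lfloor>x\<rfloor> + 1" "real_of_int \<lfloor>x\<rfloor> \<le> x" by linarith+
  ultimately show "real (nat \<lfloor>x\<rfloor>) \<le> x" "x / 2 \<le> real (nat \<lfloor>x\<rfloor>)" by linarith+
qed

text \<open>The dominant coordinate carries the norm up to the factor \<open>d\<close>. Along it a
  slab with normal \<open>u\<close> is thin, up to that factor, and serves as a graph over the other
  coordinates.\<close>

lemma ex_coord_ge_norm:
  fixes u :: "real ^ 'n"
  obtains i where "norm u \<le> real CARD('n) * \<bar>u $ i\<bar>" "\<And>j. \<bar>u $ j\<bar> \<le> \<bar>u $ i\<bar>"
proof -
  obtain i where i: "\<And>j. \<bar>u $ j\<bar> \<le> \<bar>u $ i\<bar>"
  proof -
    have "Max (range (\<lambda>j. \<bar>u $ j\<bar>)) \<in> range (\<lambda>j. \<bar>u $ j\<bar>)"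
      by (rule Max_in) auto
    then obtain i where "Max (range (\<lambda>j. \<bar>u $ j\<bar>)) = \<bar>u $ i\<bar>" by (elim imageE)
    moreover have "\<bar>u $ j\<bar> \<le> Max (range (\<lambda>j. \<bar>u $ j\<bar>))" for j by (rule Max_ge) auto
    ultimately show ?thesis using that by metis
  qed
  have "norm u \<le> (\<Sum>j\<in>UNIV. \<bar>u $ j\<bar>)" by (rule norm_le_l1_cart)
  also have "\<dots> \<le> real CARD('n) * \<bar>u $ i\<bar>" using i by (intro sum_bounded_above) auto
  finally show ?thesis using i that by blast
qed

lemma norm_le_card_coord:
  fixes x :: "real ^ 'n"
  assumes "\<And>i. \<bar>x $ i\<bar> \<le> D"
  shows "norm x \<le> real CARD('n) * D"
  using norm_le_l1_cart[of x] sum_bounded_above[of UNIV "\<lambda>i. \<bar>x $ i\<bar>" D] assms by force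

lemma abs_inner_le_card_coord:
  fixes u x :: "real ^ 'n"
  assumes "\<And>i. \<bar>x $ i\<bar> \<le> D"
  shows "\<bar>u \<bullet> x\<bar> \<le> norm u * (real CARD('n) * D)"
  using Cauchy_Schwarz_ineq2[of u x] norm_le_card_coord[OF assms]
  by (meson mult_left_mono norm_ge_zero order_trans)

text \<open>The coordinates other than the dominant one are cut into cells of side \<open>r\<close>,
  about \<open>(R / r)^(d - 1)\<close> of them. Inside a cell the slab condition pins the dominant
  coordinate to an interval of length at most \<open>3 d r\<close>, so each piece has diameter
  \<open>O(r)\<close>.\<close>

lemma hcontent_slab_le:
  fixes v :: "real ^ 'n"
  assumes v: "v \<noteq> 0" and r: "0 < r" "r \<le> 1" and R: "1 \<le> R" and t: "0 \<le> t"
  shows "hcontent t {x \<in> cube 0 R. \<bar>v \<bullet> x - c\<bar> \<le> norm v * r} \<le>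
    ennreal ((5 * R) ^ (CARD('n) - 1) * (6 * real CARD('n) ^ 2) powr t *
      r powr (t - (real CARD('n) - 1)))"
proof -
  let ?d = "real CARD('n)"
  have d1: "?d \<ge> 1" by (rule card_ge_1)
  obtain i where i: "norm v \<le> ?d * \<bar>v $ i\<bar>" "\<And>j. \<bar>v $ j\<bar> \<le> \<bar>v $ i\<bar>"
    using ex_coord_ge_norm[of v] by blast
  have vi: "\<bar>v $ i\<bar> > 0" using i(1) v by (smt (verit) mult_eq_0_iff zero_less_norm_iff)
  let ?E = "{x \<in> cube 0 R. \<bar>v \<bullet> x - c\<bar> \<le> norm v * r}"
  \<comment> \<open>Since \<open>R / r \<ge> 1\<close>, the \<open>2 N + 1\<close> cells per
    coordinate number at most \<open>5 R / r\<close>.\<close>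
  define N where "N = \<lceil>R / r\<rceil>"
  define I where "I = PiE (UNIV - {i}) (\<lambda>_. {-N..N})"
  define U where "U k = {x \<in> ?E. \<forall>j\<in>UNIV - {i}. \<lfloor>x $ j / r\<rfloor> = k j}" for k
  have Rr: "R / r \<ge> 1" using R r by (simp add: field_simps)
  have fin: "finite I" unfolding I_def by (intro finite_PiE) auto
  have cov: "?E \<subseteq> (\<Union>k\<in>I. U k)"
  proof
    fix x assume x: "x \<in> ?E"
    define k where "k = restrict (\<lambda>j. \<lfloor>x $ j / r\<rfloor>) (UNIV - {i})"
    have "\<lfloor>x $ j / r\<rfloor> \<in> {-N..N}" for j
    proof -
      have "\<bar>x $ j\<bar> \<le> R" using x by (auto simp: cube_def)
      then have "- (R / r) \<le> x $ j / r" "x $ j / r \<le> R / r"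
        using r by (auto simp: abs_le_iff field_simps)
      then show ?thesis unfolding N_def atLeastAtMost_iff by linarith
    qed
    then have "k \<in> I" by (auto simp: I_def k_def)
    moreover have "x \<in> U k" using x by (auto simp: U_def k_def)
    ultimately show "x \<in> (\<Union>k\<in>I. U k)" by blast
  qed
  have diff: "dist x y \<le> 6 * ?d ^ 2 * r" if "x \<in> U k" "y \<in> U k" for x y k
  proof -
    let ?D = "6 * ?d * r"
    have sm: "\<bar>x $ j - y $ j\<bar> \<le> r" if "j \<noteq> i" for j
    proof -
      have "\<lfloor>x $ j / r\<rfloor> = \<lfloor>y $ j / r\<rfloor>"
        using \<open>x \<in> U k\<close> \<open>y \<in> U k\<close> that by (auto simp: U_def)
      then have "\<bar>x $ j / r - y $ j / r\<bar> \<le> 1" by linarith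
      then have "\<bar>(x $ j - y $ j) / r\<bar> \<le> 1" by (simp add: diff_divide_distrib)
      then show ?thesis using r by (simp add: abs_divide)
    qed
    have "\<bar>v \<bullet> x - v \<bullet> y\<bar> \<le> 2 * norm v * r"
    proof -
      have "\<bar>v \<bullet> x - c\<bar> \<le> norm v * r" "\<bar>v \<bullet> y - c\<bar> \<le> norm v * r"
        using that by (auto simp: U_def)
      then show ?thesis by linarith
    qed
    then have 1: "\<bar>v \<bullet> (x - y)\<bar> \<le> 2 * norm v * r" by (simp add: inner_diff_right)
    have "v \<bullet> (x - y) = (\<Sum>j\<in>UNIV. v $ j * (x $ j - y $ j))" by (simp add: inner_vec_def)
    also have "\<dots> = v $ i * (x $ i - y $ i) + (\<Sum>j\<in>UNIV - {i}. v $ j * (x $ j - y $ j))"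
      by (rule sum.remove) auto
    finally have 2: "v \<bullet> (x - y) = v $ i * (x $ i - y $ i) + (\<Sum>j\<in>UNIV - {i}. v $ j * (x $ j - y $ j))" .
    have "\<bar>\<Sum>j\<in>UNIV - {i}. v $ j * (x $ j - y $ j)\<bar> \<le> (\<Sum>j\<in>UNIV - {i}. \<bar>v $ j * (x $ j - y $ j)\<bar>)"
      by (rule sum_abs)
    also have "\<dots> \<le> real (card (UNIV - {i})) * (\<bar>v $ i\<bar> * r)"
      using i(2) sm by (intro sum_bounded_above) (auto simp: abs_mult intro!: mult_mono)
    also have "\<dots> \<le> ?d * (\<bar>v $ i\<bar> * r)"
      using r by (intro mult_right_mono) (auto intro: card_mono)
    finally have 3: "\<bar>\<Sum>j\<in>UNIV - {i}. v $ j * (x $ j - y $ j)\<bar> \<le> ?d * (\<bar>v $ i\<bar> * r)" .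
    have "\<bar>v $ i * (x $ i - y $ i)\<bar> \<le> 2 * norm v * r + ?d * (\<bar>v $ i\<bar> * r)"
      using 1 2 3 by linarith
    also have "\<dots> \<le> 2 * (?d * \<bar>v $ i\<bar>) * r + ?d * (\<bar>v $ i\<bar> * r)"
      using i(1) r by (intro add_right_mono mult_right_mono mult_left_mono) auto
    finally have "\<bar>v $ i\<bar> * \<bar>x $ i - y $ i\<bar> \<le> \<bar>v $ i\<bar> * (3 * ?d * r)"
      by (simp add: abs_mult mult_ac)
    then have 4: "\<bar>x $ i - y $ i\<bar> \<le> 3 * ?d * r" using vi by simp
    have "\<bar>(x - y) $ j\<bar> \<le> ?D" for j
    proof (cases "j = i")
      case True
      then show ?thesis using 4 d1 r by simp
    next
      case False
      have "r \<le> ?D" using d1 r mult_right_mono[of 1 "6 * ?d" r] by linarith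
      then show ?thesis using sm[OF False] by simp
    qed
    from norm_le_card_coord[OF this] show ?thesis
      by (simp add: dist_norm power2_eq_square algebra_simps)
  qed
  have bd: "bounded (U k)" for k
    by (rule bounded_subset[OF compact_imp_bounded[OF compact_cube]]) (auto simp: U_def)
  have dm: "diameter (U k) \<le> 6 * ?d ^ 2 * r" for k
    by (rule diameter_le) (use diff[of _ k] r in \<open>auto simp: dist_norm\<close>)
  have "hcontent t ?E \<le> ennreal (card I * (6 * ?d ^ 2 * r) powr t)"
    by (rule hcontent_finite_cover_le[OF fin cov bd dm t]) (use r in auto)
  also have "\<dots> \<le> ennreal ((5 * R) ^ (CARD('n) - 1) * (6 * ?d ^ 2) powr t * r powr (t - (?d - 1)))"
  proof (rule ennreal_leI)
    have "card I = card {-N..N} ^ (CARD('n) - 1)" unfolding I_def by (subst card_PiE) auto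
    then have "real (card I) = real (card {-N..N}) ^ (CARD('n) - 1)" by simp
    also have "\<dots> \<le> (5 * (R / r)) ^ (CARD('n) - 1)"
      using Rr by (intro power_mono) (auto simp: N_def; linarith)+
    also have "\<dots> = (5 * R) ^ (CARD('n) - 1) / r ^ (CARD('n) - 1)"
      by (simp add: power_divide flip: times_divide_eq_right)
    also have "r ^ (CARD('n) - 1) = r powr (?d - 1)"
      using r by (simp add: powr_realpow[symmetric] of_nat_diff)
    finally have "real (card I) * (6 * ?d ^ 2 * r) powr t \<le>
        (5 * R) ^ (CARD('n) - 1) / r powr (?d - 1) * (6 * ?d ^ 2 * r) powr t"
      by (intro mult_right_mono) auto
    also have "\<dots> = (5 * R) ^ (CARD('n) - 1) * (6 * ?d ^ 2) powr t * r powr (t - (?d - 1))"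
      using r by (simp add: powr_mult powr_diff)
    finally show "real (card I) * (6 * ?d ^ 2 * r) powr t \<le> \<dots>" .
  qed
  finally show ?thesis .
qed

lemma UN_cube: "(\<Union>k::nat. cube 0 (real k + 1)) = (UNIV :: (real ^ 'n) set)"
proof -
  have "x \<in> (\<Union>k::nat. cube 0 (real k + 1))" for x :: "real ^ 'n"
  proof -
    obtain k :: nat where "norm x \<le> real k" using real_arch_simple by blast
    then have "\<bar>x $ i\<bar> \<le> real k + 1" for i using component_le_norm_cart[of x i] by linarith
    then show ?thesis by (auto simp: cube_def)
  qed
  then show ?thesis by blast
qed

lemma hcontent_eq_0_if_cubes:
  fixes E :: "(real ^ 'n) set"
  assumes "\<And>R. 1 \<le> R \<Longrightarrow> hcontent t (E \<inter> cube 0 R) = 0"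
  shows "hcontent t E = 0"
proof -
  have "E = (\<Union>k::nat. E \<inter> cube 0 (real k + 1))" using UN_cube by blast
  moreover have "hcontent t \<dots> = 0" by (rule hcontent_UN_eq_0) (use assms in auto)
  ultimately show ?thesis by simp
qed

lemma ennreal_eq_0_if_le_tendsto_0:
  fixes f :: "real \<Rightarrow> real"
  assumes "(f \<longlongrightarrow> 0) (at_right 0)" "\<And>x. 0 < x \<Longrightarrow> x \<le> 1 \<Longrightarrow> e \<le> ennreal (f x)"
  shows "e = 0"
proof -
  have "((\<lambda>x. ennreal (f x)) \<longlongrightarrow> ennreal 0) (at_right 0)"
    using assms(1) by (rule tendsto_ennrealI)
  moreover have "\<forall>\<^sub>F x in at_right 0. e \<le> ennreal (f x)"
    unfolding eventually_at_right_field using assms(2) by (intro exI[of _ 1]) auto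
  ultimately have "e \<le> ennreal 0" by (intro tendsto_lowerbound) auto
  then show ?thesis by simp
qed

text \<open>The slab of half-width \<open>r\<close> around the hyperplane has content
  \<open>O(r^(t - (d - 1)))\<close> in a cube, which tends to zero with \<open>r\<close>.\<close>

lemma hcontent_hyperplane_eq_0:
  fixes v :: "real ^ 'n"
  assumes v: "v \<noteq> 0" and t: "real CARD('n) - 1 < t"
  shows "hcontent t {x. v \<bullet> x = c} = 0"
proof (rule hcontent_eq_0_if_cubes)
  fix R :: real assume R: "1 \<le> R"
  let ?b = "t - (real CARD('n) - 1)" and ?C = "(5 * R) ^ (CARD('n) - 1) * (6 * real CARD('n) ^ 2) powr t"
  have t0: "0 \<le> t" using t card_ge_1[where 'a='n] by linarith
  show "hcontent t ({x. v \<bullet> x = c} \<inter> cube 0 R) = 0"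
  proof (rule ennreal_eq_0_if_le_tendsto_0)
    show "((\<lambda>x. ?C * x powr ?b) \<longlongrightarrow> 0) (at_right 0)"
      by (rule tendsto_mult_right_zero, rule tendsto_zero_powrI[OF _ tendsto_const])
        (use t in \<open>auto simp: eventually_at_right_less tendsto_ident_at eventually_at_filter\<close>)
  next
    fix r :: real assume r: "0 < r" "r \<le> 1"
    have "hcontent t ({x. v \<bullet> x = c} \<inter> cube 0 R) \<le> hcontent t {x \<in> cube 0 R. \<bar>v \<bullet> x - c\<bar> \<le> norm v * r}"
      using r by (intro hcontent_mono) auto
    also have "\<dots> \<le> ennreal (?C * r powr ?b)" by (rule hcontent_slab_le[OF v r R t0])
    finally show "hcontent t ({x. v \<bullet> x = c} \<inter> cube 0 R) \<le> ennreal (?C * r powr ?b)" .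
  qed
qed

text \<open>Only \<open>O(norm v * R)\<close> integers \<open>p\<close> give a slab that meets the
  cube. The factor 7 absorbs \<open>2 M + 1\<close> with
  \<open>M \<le> norm v * (d R) + norm v + 1\<close>, where each of the three terms is at most
  \<open>norm v * (d R)\<close>.\<close>

lemma hcontent_layers_le:
  fixes v :: "real ^ 'n"
  assumes v: "1 \<le> norm v" and r: "0 < r" "r \<le> 1" and R: "1 \<le> R" and t: "0 \<le> t"
  shows "hcontent t {x \<in> cube 0 R. \<exists>p::int. \<bar>v \<bullet> x - p\<bar> \<le> norm v * r} \<le>
    ennreal (norm v * (7 * real CARD('n) * R * (5 * R) ^ (CARD('n) - 1) * (6 * real CARD('n) ^ 2) powr t) *
      r powr (t - (real CARD('n) - 1)))"
proof -
  let ?d = "real CARD('n)"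
  let ?B = "(5 * R) ^ (CARD('n) - 1) * (6 * real CARD('n) ^ 2) powr t * r powr (t - (real CARD('n) - 1))"
  have d1: "?d \<ge> 1" by (rule card_ge_1)
  define M where "M = \<lceil>norm v * (?d * R) + norm v\<rceil>"
  define A where "A p = {x \<in> cube 0 R. \<bar>v \<bullet> x - real_of_int p\<bar> \<le> norm v * r}" for p :: int
  have "{x \<in> cube 0 R. \<exists>p::int. \<bar>v \<bullet> x - p\<bar> \<le> norm v * r} \<subseteq> (\<Union>p\<in>{-M..M}. A p)"
  proof
    fix x assume "x \<in> {x \<in> cube 0 R. \<exists>p::int. \<bar>v \<bullet> x - p\<bar> \<le> norm v * r}"
    then obtain p :: int where x: "x \<in> cube 0 R" and p: "\<bar>v \<bullet> x - p\<bar> \<le> norm v * r" by auto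
    have "\<bar>v \<bullet> x\<bar> \<le> norm v * (?d * R)"
      by (rule abs_inner_le_card_coord) (use x in \<open>simp add: cube_def\<close>)
    moreover have "norm v * r \<le> norm v" using r mult_left_mono[of r 1 "norm v"] by simp
    ultimately have "\<bar>real_of_int p\<bar> \<le> norm v * (?d * R) + norm v" using p by linarith
    then have "p \<in> {-M..M}" unfolding M_def by (auto simp: le_ceiling_iff abs_le_iff) linarith+
    then show "x \<in> (\<Union>p\<in>{-M..M}. A p)" using x p by (auto simp: A_def)
  qed
  then have "hcontent t {x \<in> cube 0 R. \<exists>p::int. \<bar>v \<bullet> x - p\<bar> \<le> norm v * r} \<le> hcontent t (\<Union>p\<in>{-M..M}. A p)"
    by (rule hcontent_mono)
  also have "\<dots> \<le> (\<Sum>p\<in>{-M..M}. hcontent t (A p))" by (rule hcontent_UN_finite_le) simp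
  also have "\<dots> \<le> (\<Sum>p\<in>{-M..M}. ennreal ?B)"
    unfolding A_def using v by (intro sum_mono hcontent_slab_le[OF _ r R t]) auto
  also have "\<dots> = ennreal (card {-M..M} * ?B)" using R
    by (simp add: ennreal_mult ennreal_of_nat_eq_real_of_nat)
  also have "\<dots> \<le> ennreal ((norm v * (7 * ?d * R)) * ?B)"
  proof (rule ennreal_leI, rule mult_right_mono)
    have "1 \<le> ?d * R" using d1 R mult_mono[of 1 ?d 1 R] by simp
    then have "norm v \<le> norm v * (?d * R)" "1 \<le> norm v * (?d * R)"
      using v mult_left_mono[of 1 "?d * R" "norm v"] by auto
    moreover have "0 \<le> M" using calculation v unfolding M_def by linarith
    then have "real (card {-M..M}) = 2 * M + 1" by simp
    moreover have "real_of_int M \<le> norm v * (?d * R) + norm v + 1" unfolding M_def by linarith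
    ultimately show "real (card {-M..M}) \<le> norm v * (7 * ?d * R)" by (simp add: algebra_simps)
  qed (use R in auto)
  also have "(norm v * (7 * ?d * R)) * ?B = norm v * (7 * real CARD('n) * R * (5 * R) ^ (CARD('n) - 1) * (6 * real CARD('n) ^ 2) powr t) *
      r powr (t - (real CARD('n) - 1))" by (simp add: algebra_simps)
  finally show ?thesis .
qed

text \<open>Layers with spacing \<open>r\<close> and half-width \<open>r\<close> cover the whole
  space. With a normal of length \<open>1 / r\<close> the layer bound becomes
  \<open>O(r^(t - d))\<close>.\<close>

lemma hcontent_eq_0_above_dim:
  fixes E :: "(real ^ 'n) set"
  assumes t: "real CARD('n) < t"
  shows "hcontent t E = 0"
proof (rule hcontent_eq_0_if_cubes)
  fix R :: real assume R: "1 \<le> R"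
  let ?b = "t - (real CARD('n) - 1)"
    and ?C = "7 * real CARD('n) * R * (5 * R) ^ (CARD('n) - 1) * (6 * real CARD('n) ^ 2) powr t"
  have t0: "0 \<le> t" using t of_nat_0_le_iff[of "CARD('n)"] by linarith
  show "hcontent t (E \<inter> cube 0 R) = 0"
  proof (rule ennreal_eq_0_if_le_tendsto_0)
    show "((\<lambda>x. ?C * x powr (?b - 1)) \<longlongrightarrow> 0) (at_right 0)"
      by (rule tendsto_mult_right_zero, rule tendsto_zero_powrI[OF _ tendsto_const])
        (use t in \<open>auto simp: eventually_at_right_less tendsto_ident_at eventually_at_filter\<close>)
  next
    fix r :: real assume r: "0 < r" "r \<le> 1"
    obtain e :: "real ^ 'n" where e: "norm e = 1" using vector_choose_size[of 1] by auto
    define v where "v = (1 / r) *\<^sub>R e"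
    have nv: "norm v = 1 / r" using e r by (simp add: v_def)
    have "\<exists>p::int. \<bar>v \<bullet> x - p\<bar> \<le> norm v * r" for x
      using r by (intro exI[of _ "\<lfloor>v \<bullet> x\<rfloor>"]) (simp add: nv, linarith)
    then have "hcontent t (E \<inter> cube 0 R) \<le> hcontent t {x \<in> cube 0 R. \<exists>p::int. \<bar>v \<bullet> x - p\<bar> \<le> norm v * r}"
      by (intro hcontent_mono) auto
    also have "\<dots> \<le> ennreal (norm v * ?C * r powr ?b)"
      by (rule hcontent_layers_le) (use r R t0 nv in auto)
    also have "norm v * ?C * r powr ?b = ?C * r powr (?b - 1)"
      using r powr_diff[of r ?b 1] by (simp add: nv)
    finally show "hcontent t (E \<inter> cube 0 R) \<le> ennreal (?C * r powr (?b - 1))" .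
  qed
qed

section \<open>A Cantor construction\<close>

text \<open>One step of the Cantor construction, with \<open>Y\<close> the centres of the subcubes of half-side
  \<open>l'\<close> kept inside \<open>cube x l\<close>. The last clause bounds how many of them a set of intermediate
  size can meet.\<close>

definition children ::
    "real \<Rightarrow> real \<Rightarrow> (real ^ 'n) set \<Rightarrow> real \<Rightarrow> real \<Rightarrow> real ^ 'n \<Rightarrow> (real ^ 'n) set \<Rightarrow> bool" where
  "children t C S l l' x Y \<longleftrightarrow> finite Y \<and>
     (\<forall>y\<in>Y. cube y l' \<subseteq> cube x l \<inter> S) \<and>
     (\<forall>y\<in>Y. \<forall>y'\<in>Y. \<forall>z\<in>cube y l'. \<forall>z'\<in>cube y' l'. (\<forall>i. \<bar>z $ i - z' $ i\<bar> < l') \<longrightarrow> y = y') \<and>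
     (l / l') powr t \<le> card Y \<and>
     (\<forall>r U. l' \<le> r \<longrightarrow> r < l \<longrightarrow> (\<forall>u\<in>U. \<forall>v\<in>U. \<forall>i. \<bar>u $ i - v $ i\<bar> \<le> r) \<longrightarrow>
        card {y \<in> Y. cube y l' \<inter> U \<noteq> {}} \<le> C * (r / l) powr t * card Y)"

text \<open>The inner scale \<open>l'\<close> is chosen before the centre \<open>x\<close>, so all
  cubes of one generation have the same size. The constant \<open>C\<close> is fixed before both
  scales.\<close>

definition spreading :: "real \<Rightarrow> real \<Rightarrow> (real ^ 'n) set \<Rightarrow> bool" where
  "spreading t C S \<longleftrightarrow> (\<forall>l>0. \<exists>l'>0. l' \<le> l / 2 \<and> (\<forall>x. \<exists>Y. children t C S l l' x Y))"

text \<open>\<open>i\<close> is the absolute level of the root, because scale and target set change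
  from level to level; \<open>n\<close> counts the generations below it.\<close>

primrec descendants :: "(nat \<Rightarrow> 'a \<Rightarrow> 'a set) \<Rightarrow> nat \<Rightarrow> nat \<Rightarrow> 'a \<Rightarrow> 'a set" where
  "descendants Y 0 i x = {x}"
| "descendants Y (Suc n) i x = (\<Union>y\<in>Y i x. descendants Y n (Suc i) y)"

text \<open>The recursion splits at the root, which suits the induction on covers. The nested
  compact sets of the construction grow at the leaves instead.\<close>

lemma descendants_Suc_right:
  "descendants Y (Suc n) i x = (\<Union>y\<in>descendants Y n i x. Y (i + n) y)"
proof (induction n arbitrary: i x)
  case (Suc n)
  have "descendants Y (Suc (Suc n)) i x = (\<Union>y\<in>Y i x. descendants Y (Suc n) (Suc i) y)"
    by (simp only: descendants.simps)
  also have "\<dots> = (\<Union>y\<in>Y i x. \<Union>z\<in>descendants Y n (Suc i) y. Y (Suc i + n) z)"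
    by (simp only: Suc.IH)
  also have "\<dots> = (\<Union>y\<in>descendants Y (Suc n) i x. Y (i + Suc n) y)" by simp
  finally show ?case .
qed simp

lemma cube_descendants_subset:
  assumes "\<And>i x. children t C (S i) (L i) (L (Suc i)) x (Y i x)"
  shows "z \<in> descendants Y n i x \<Longrightarrow> cube z (L (i + n)) \<subseteq> cube x (L i)"
proof (induction n arbitrary: i x)
  case (Suc n)
  then obtain y where y: "y \<in> Y i x" "z \<in> descendants Y n (Suc i) y" by auto
  have "cube z (L (Suc i + n)) \<subseteq> cube y (L (Suc i))" using Suc.IH[OF y(2)] .
  also have "\<dots> \<subseteq> cube x (L i)" using assms[of i x] y(1) by (auto simp: children_def)
  finally show ?case by simp
qed simp

lemma powr_le_mult_sum:
  fixes r :: "'i \<Rightarrow> real"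
  assumes "finite I" "u \<in> I" "l \<le> r u" "0 \<le> l" "1 \<le> C" "0 \<le> t"
  shows "l powr t \<le> C * (\<Sum>u\<in>I. r u powr t)"
proof -
  have "l powr t \<le> r u powr t" using assms by (intro powr_mono2) auto
  also have "\<dots> \<le> (\<Sum>u\<in>I. r u powr t)" using assms by (intro member_le_sum) auto
  also have "\<dots> \<le> C * (\<Sum>u\<in>I. r u powr t)"
    using assms mult_right_mono[of 1 C "\<Sum>u\<in>I. r u powr t"] by (simp add: sum_nonneg)
  finally show ?thesis .
qed

text \<open>Frostman-type bound for finite covers, by induction on the depth of the tree: sets of
  diameter at least \<open>L (Suc i)\<close> meet few children, and the smaller ones meet at most one each.\<close>

lemma finite_cover_sum_ge:
  assumes ch: "\<And>i x. children t C (S i) (L i) (L (Suc i)) x (Y i x)"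
    and L: "\<And>i. 0 < L i" and C: "1 \<le> C" and t: "0 < t"
  shows "finite I \<Longrightarrow> (\<And>u. u \<in> I \<Longrightarrow> L (i + n) \<le> r u) \<Longrightarrow>
    (\<And>u v w j. u \<in> I \<Longrightarrow> v \<in> U u \<Longrightarrow> w \<in> U u \<Longrightarrow> \<bar>v $ j - w $ j\<bar> \<le> r u) \<Longrightarrow>
    (\<And>z. z \<in> descendants Y n i x \<Longrightarrow> \<exists>u\<in>I. cube z (L (i + n)) \<inter> U u \<noteq> {}) \<Longrightarrow>
    L i powr t \<le> C * (\<Sum>u\<in>I. r u powr t)"
proof (induction n arbitrary: i x I)
  case (0 i x I)
  from "0.prems"(4)[of x] obtain u where "u \<in> I" by auto
  then show ?case using powr_le_mult_sum[OF "0.prems"(1)] "0.prems"(2) L[of i] C t by simp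
next
  case (Suc n i x I)
  note fin = Suc.prems(1) and r = Suc.prems(2) and U = Suc.prems(3) and meet = Suc.prems(4)
  show ?case
  proof (cases "\<exists>u\<in>I. L i \<le> r u")
    case True
    then show ?thesis using powr_le_mult_sum[OF fin] L[of i] C t by (meson less_imp_le)
  next
    case False
    define l l' K where "l = L i" and "l' = L (Suc i)" and "K = Y i x"
    have l: "l > 0" "l' > 0" using L by (auto simp: l_def l'_def)
    have rpos: "0 < r u" if "u \<in> I" for u using r[OF that] L[of "i + Suc n"] by linarith
    have chK: "children t C (S i) l l' x K" using ch by (simp add: l_def l'_def K_def)
    \<comment> \<open>Sets of size between the two scales are charged by the counting clause of
      \<open>children\<close>; the remaining ones are smaller than the separation \<open>l'\<close>
      of the children.\<close>
    define Big where "Big = {u \<in> I. l' \<le> r u}"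
    define Kb where "Kb = {y \<in> K. \<exists>u\<in>Big. cube y l' \<inter> U u \<noteq> {}}"
    define J where "J y = {u \<in> I - Big. cube y l' \<inter> U u \<noteq> {}}" for y
    define A B where "A = (\<Sum>u\<in>Big. r u powr t)" and "B = (\<Sum>u\<in>I - Big. r u powr t)"
    have finK: "finite K" using chK by (simp add: children_def)
    have finB: "finite Big" using fin by (simp add: Big_def)
    have "Kb = (\<Union>u\<in>Big. {y \<in> K. cube y l' \<inter> U u \<noteq> {}})" by (auto simp: Kb_def)
    then have "card Kb \<le> (\<Sum>u\<in>Big. card {y \<in> K. cube y l' \<inter> U u \<noteq> {}})"
      using card_UN_le[OF finB] by simp
    then have "real (card Kb) \<le> (\<Sum>u\<in>Big. real (card {y \<in> K. cube y l' \<inter> U u \<noteq> {}}))"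
      by (simp flip: of_nat_sum)
    also have "\<dots> \<le> (\<Sum>u\<in>Big. C * (r u / l) powr t * card K)"
    proof (rule sum_mono)
      fix u assume u: "u \<in> Big"
      then have uI: "u \<in> I" and "l' \<le> r u" by (simp_all add: Big_def)
      moreover have "r u < l" using uI False unfolding l_def by (meson not_le)
      moreover have "\<forall>v\<in>U u. \<forall>w\<in>U u. \<forall>j. \<bar>v $ j - w $ j\<bar> \<le> r u"
        by (intro ballI allI U[OF uI])
      ultimately show "real (card {y \<in> K. cube y l' \<inter> U u \<noteq> {}}) \<le> C * (r u / l) powr t * card K"
        using chK unfolding children_def by blast
    qed
    also have "\<dots> = (\<Sum>u\<in>Big. (C * card K / l powr t) * r u powr t)"
      using l rpos by (intro sum.cong) (auto simp: powr_divide Big_def less_imp_le)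
    also have "\<dots> = C * A * card K / l powr t"
      by (simp add: A_def sum_distrib_left sum_distrib_right sum_divide_distrib mult_ac)
    finally have b1: "real (card Kb) \<le> C * A * card K / l powr t" .
    \<comment> \<open>A child missed by all big sets is met only by small sets, so the induction
      hypothesis applies to it with the subfamily \<open>J y\<close>.\<close>
    have b2: "l' powr t \<le> C * (\<Sum>u\<in>J y. r u powr t)" if y: "y \<in> K - Kb" for y
      unfolding l'_def
    proof (rule Suc.IH)
      show "finite (J y)" using fin by (simp add: J_def)
      show "L (Suc i + n) \<le> r u" if "u \<in> J y" for u using r that by (simp add: J_def)
      show "\<bar>v $ j - w $ j\<bar> \<le> r u" if "u \<in> J y" "v \<in> U u" "w \<in> U u" for u v w j
        using U[of u v w j] that by (simp add: J_def)
      fix z assume z: "z \<in> descendants Y n (Suc i) y"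
      then have "z \<in> descendants Y (Suc n) i x" using y by (auto simp: K_def)
      from meet[OF this] obtain u where u: "u \<in> I" "cube z (L (Suc i + n)) \<inter> U u \<noteq> {}" by auto
      have "cube z (L (Suc i + n)) \<subseteq> cube y l'"
        unfolding l'_def using cube_descendants_subset[OF ch z] .
      then have "cube y l' \<inter> U u \<noteq> {}" using u(2) by blast
      then have "u \<in> J y" using u y by (auto simp: J_def Kb_def)
      then show "\<exists>u\<in>J y. cube z (L (Suc i + n)) \<inter> U u \<noteq> {}" using u by blast
    qed
    \<comment> \<open>By the separation clause a small set meets at most one child, so no small set
      is paid for twice when the bounds \<open>b2\<close> are added.\<close>
    have disj: "J y \<inter> J y' = {}" if "y \<in> K" "y' \<in> K" "y \<noteq> y'" for y y'
    proof (rule ccontr)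
      assume "J y \<inter> J y' \<noteq> {}"
      then obtain u z z' where u: "u \<in> I - Big" "z \<in> cube y l'" "z \<in> U u" "z' \<in> cube y' l'" "z' \<in> U u"
        by (auto simp: J_def)
      have "\<bar>z $ j - z' $ j\<bar> < l'" for j using U[of u z z' j] u by (auto simp: Big_def)
      then show False using chK that u unfolding children_def by blast
    qed
    have "card (K - Kb) * l' powr t \<le> (\<Sum>y\<in>K - Kb. C * (\<Sum>u\<in>J y. r u powr t))"
      using sum_mono[of "K - Kb" "\<lambda>_. l' powr t", OF b2] by simp
    also have "\<dots> = C * (\<Sum>y\<in>K - Kb. \<Sum>u\<in>J y. r u powr t)" by (simp add: sum_distrib_left)
    also have "(\<Sum>y\<in>K - Kb. \<Sum>u\<in>J y. r u powr t) = (\<Sum>u\<in>(\<Union>y\<in>K - Kb. J y). r u powr t)"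
      using finK fin disj by (intro sum.UNION_disjoint[symmetric]) (auto simp: J_def)
    also have "\<dots> \<le> B" unfolding B_def using fin by (intro sum_mono2) (auto simp: J_def)
    finally have b3: "real (card (K - Kb)) * l' powr t \<le> C * B" using C by simp
    have "(l / l') powr t \<le> card K" using chK by (simp add: children_def)
    then have b4: "l powr t \<le> card K * l' powr t" using l by (simp add: powr_divide field_simps)
    have K0: "real (card K) > 0"
      using b4 l by (smt (verit) powr_gt_zero mult_nonneg_nonneg mult_eq_0_iff of_nat_0_le_iff)
    have "card (K - Kb) = card K - card Kb" "card Kb \<le> card K"
      using finK by (auto simp: Kb_def intro!: card_Diff_subset card_mono)
    then have "real (card K) = card Kb + card (K - Kb)" by simp
    \<comment> \<open>Children met by big sets are charged to \<open>A\<close>, the others to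
      \<open>B\<close>. The two shares add up under a single factor \<open>C\<close>, so the
      constant does not deteriorate with the depth.\<close>
    then have "real (card K) * l powr t = card Kb * l powr t + card (K - Kb) * l powr t"
      by (simp add: algebra_simps)
    also have "\<dots> \<le> C * A * card K + card (K - Kb) * (card K * l' powr t)"
      using b1 b4 l by (intro add_mono mult_left_mono) (auto simp: field_simps)
    also have "\<dots> \<le> C * A * card K + C * B * card K"
      using mult_right_mono[OF b3, of "card K"] by (simp add: algebra_simps)
    also have "\<dots> = card K * (C * (A + B))" by (simp add: algebra_simps)
    finally have "l powr t \<le> C * (A + B)" using K0 by simp
    also have "A + B = (\<Sum>u\<in>I. r u powr t)" unfolding A_def B_def using fin
      by (subst add.commute, intro sum.subset_diff[symmetric]) (auto simp: Big_def)
    finally show ?thesis by (simp add: l_def)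
  qed
qed

text \<open>The stage \<open>m\<close> of the tree lies in \<open>S 0\<close>, ...,
  \<open>S (m - 1)\<close>, so the intersection of the nested compact stages lies in all of them. A
  countable cover is enlarged to an open one at small cost; compactness then reduces it to a finite
  cover of one stage, where the tree estimate applies.\<close>

lemma hcontent_INT_spreading_ge:
  fixes S :: "nat \<Rightarrow> (real ^ 'n) set"
  assumes S: "\<And>i. spreading t C (S i)" and C: "1 \<le> C" and t: "0 < t" and l0: "0 < l0"
  shows "ennreal (l0 powr t / C) \<le> hcontent t (cube x0 l0 \<inter> (\<Inter>i. S i))"
proof -
  have "\<exists>L. L 0 = l0 \<and> (\<forall>i. 0 < L i \<and> (L (Suc i) \<le> L i / 2 \<and>
      (\<forall>x. \<exists>Y. children t C (S i) (L i) (L (Suc i)) x Y)))"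
  proof -
    have "\<exists>L. \<forall>i. (0 < L i \<and> (i = 0 \<longrightarrow> L i = l0)) \<and> (L (Suc i) \<le> L i / 2 \<and>
      (\<forall>x. \<exists>Y. children t C (S i) (L i) (L (Suc i)) x Y))"
    proof (rule dependent_nat_choice)
      show "\<exists>x. 0 < x \<and> (0 = (0::nat) \<longrightarrow> x = l0)" using l0 by auto
      show "\<exists>y. (0 < y \<and> (Suc n = 0 \<longrightarrow> y = l0)) \<and> (y \<le> l / 2 \<and> (\<forall>x. \<exists>Y. children t C (S n) l y x Y))"
        if "0 < l \<and> (n = 0 \<longrightarrow> l = l0)" for l n
        using S[of n] that unfolding spreading_def by blast
    qed
    then show ?thesis by blast
  qed
  then obtain L where L0: "L 0 = l0" and L: "\<And>i. 0 < L i" and Lhalf: "\<And>i. L (Suc i) \<le> L i / 2"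
    and "\<And>i x. \<exists>Y. children t C (S i) (L i) (L (Suc i)) x Y" by blast
  then obtain Y where Y: "\<And>i x. children t C (S i) (L i) (L (Suc i)) x (Y i x)" by metis
  define K where "K m = (\<Union>z\<in>descendants Y m 0 x0. cube z (L m))" for m
  have finD: "finite (descendants Y m i x)" for m i x
    by (induction m arbitrary: i x) (use Y in \<open>auto simp: children_def\<close>)
  have K_Suc: "K (Suc m) \<subseteq> K m \<inter> S m" for m
  proof
    fix w assume "w \<in> K (Suc m)"
    then obtain z y where zy: "y \<in> descendants Y m 0 x0" "z \<in> Y m y" "w \<in> cube z (L (Suc m))"
      unfolding K_def descendants_Suc_right by auto
    then have "w \<in> cube y (L m) \<inter> S m" using Y[of m y] unfolding children_def by blast
    then show "w \<in> K m \<inter> S m" using zy(1) by (auto simp: K_def)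
  qed
  have K_mono: "K n \<subseteq> K m" if "m \<le> n" for m n
    using that by (induction rule: dec_induct) (use K_Suc in auto)
  have K_compact: "compact (K m)" for m
    unfolding K_def using finD compact_cube by (intro compact_UN) auto
  have K_sub: "(\<Inter>m. K m) \<subseteq> cube x0 l0 \<inter> (\<Inter>i. S i)"
  proof -
    have "K 0 = cube x0 l0" by (simp add: K_def L0)
    then show ?thesis using K_Suc by blast
  qed
  have Lsmall: "\<exists>m. L m \<le> e" if e0: "e > 0" for e
  proof -
    have le: "L m \<le> l0 * (1/2) ^ m" for m
    proof (induction m)
      case (Suc m)
      then show ?case using Lhalf[of m] by simp
    qed (simp add: L0)
    obtain m where "(1/2::real) ^ m < e / l0" using real_arch_pow_inv[of "e / l0" "1/2"] e0 l0 by auto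
    then have "l0 * (1/2) ^ m \<le> e" using l0 by (simp add: field_simps)
    then show ?thesis using le order_trans by blast
  qed
  have key: "ennreal (l0 powr t / C) \<le> (\<Sum>i. ennreal (diameter (V i) powr t)) + ennreal c"
    if V: "cube x0 l0 \<inter> (\<Inter>i. S i) \<subseteq> (\<Union>i. V i)" "\<And>i. bounded (V i)" and c: "0 < c" for V :: "nat \<Rightarrow> _" and c
  proof -
    \<comment> \<open>Continuity of the power pays for the enlargement: the extra costs form a
      geometric series with sum \<open>c\<close>. Enlarged sets also have positive size, which the
      finite-depth estimate requires.\<close>
    have "\<exists>h>0. (diameter (V i) + h) powr t \<le> diameter (V i) powr t + c * (1/2) ^ Suc i" for i
    proof -
      have "((\<lambda>h. (diameter (V i) + h) powr t) \<longlongrightarrow> (diameter (V i) + 0) powr t) (at_right 0)"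
        using t diameter_ge_0[OF V(2)[of i]]
        by (intro tendsto_powr' tendsto_add tendsto_const tendsto_ident_at)
          (auto simp: eventually_at_filter)
      then have "\<forall>\<^sub>F h in at_right 0. (diameter (V i) + h) powr t < diameter (V i) powr t + c * (1/2) ^ Suc i"
        using c by (intro order_tendstoD(2)) auto
      then have "\<forall>\<^sub>F h in at_right 0. 0 < h \<and> (diameter (V i) + h) powr t < diameter (V i) powr t + c * (1/2) ^ Suc i"
        by (intro eventually_conj eventually_at_right_less)
      then obtain h where "0 < h \<and> (diameter (V i) + h) powr t < diameter (V i) powr t + c * (1/2) ^ Suc i"
        using eventually_happens'[OF trivial_limit_at_right_real] by blast
      then show ?thesis by (intro exI[of _ h]) auto
    qed
    then obtain h where h: "\<And>i. 0 < h i"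
      "\<And>i. (diameter (V i) + h i) powr t \<le> diameter (V i) powr t + c * (1/2) ^ Suc i" by metis
    define U where "U i = (\<Union>x\<in>V i. ball x (h i / 2))" for i
    define r where "r i = diameter (V i) + h i" for i
    have Uopen: "open (U i)" for i by (auto simp: U_def)
    have VU: "V i \<subseteq> U i" for i using h(1)[of i] by (force simp: U_def)
    have rpos: "0 < r i" for i using h(1)[of i] diameter_ge_0[OF V(2)[of i]] by (simp add: r_def)
    have Ud: "\<bar>v $ j - w $ j\<bar> \<le> r i" if vw: "v \<in> U i" "w \<in> U i" for i v w j
    proof -
      obtain a b where ab: "a \<in> V i" "dist a v < h i / 2" "b \<in> V i" "dist b w < h i / 2"
        using vw by (auto simp: U_def)
      have "dist a b \<le> diameter (V i)" using diameter_bounded_bound[OF V(2)[of i]] ab by auto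
      moreover have "dist v w \<le> dist v a + dist a b + dist b w" by (smt (verit) dist_triangle)
      ultimately have "dist v w \<le> r i" using ab by (simp add: r_def dist_commute)
      then show ?thesis using component_le_norm_cart[of "v - w" j] by (simp add: dist_norm)
    qed
    obtain m where m: "K m \<subseteq> (\<Union>i. U i)"
    proof -
      \<comment> \<open>Otherwise the differences would be nested nonempty compact sets, and a
        common point would lie in every stage but outside the cover.\<close>
      have "\<exists>m. K m - (\<Union>i. U i) = {}"
      proof (rule ccontr)
        assume "\<nexists>m. K m - (\<Union>i. U i) = {}"
        then have "\<Inter>(range (\<lambda>m. K m - (\<Union>i. U i))) \<noteq> {}"
          using K_compact Uopen
          by (intro compact_nest compact_diff Diff_mono K_mono) (auto intro: open_UN)
        then obtain x where "\<And>m. x \<in> K m" "x \<notin> (\<Union>i. U i)" by blast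
        moreover have "(\<Inter>m. K m) \<subseteq> (\<Union>i. U i)"
          using subset_trans[OF K_sub V(1)] VU UN_mono[of UNIV UNIV V U] by (meson subset_trans order_refl)
        ultimately show False by (meson INT_I subsetD)
      qed
      then show ?thesis using that by blast
    qed
    obtain I where I: "finite I" "K m \<subseteq> (\<Union>i\<in>I. U i)"
      by (rule compactE_image[OF K_compact[of m], of UNIV U]) (use Uopen m in auto)
    \<comment> \<open>The depth is increased until the cubes are no larger than any covering set;
      inserting 1 keeps the minimum meaningful for empty \<open>I\<close>.\<close>
    obtain m' where m': "L m' \<le> Min (insert 1 (r ` I))"
      using Lsmall[of "Min (insert 1 (r ` I))"] I(1) rpos by auto
    define M where "M = max m m'"
    have Ldec: "decseq L" using Lhalf L by (intro decseq_SucI) (smt (verit) field_sum_of_halves)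
    have LM: "L M \<le> r i" if "i \<in> I" for i
    proof -
      have "L M \<le> L m'" using Ldec by (auto simp: M_def decseq_def)
      also have "\<dots> \<le> r i" using m' that I(1) by simp
      finally show ?thesis .
    qed
    have "L 0 powr t \<le> C * (\<Sum>u\<in>I. r u powr t)"
    proof (rule finite_cover_sum_ge[where S = S and L = L and Y = Y and n = M and x = x0 and U = U])
      fix z assume z: "z \<in> descendants Y M 0 x0"
      have "z \<in> cube z (L M)" using L[of M] by (simp add: cube_def)
      then have "z \<in> K M" using z by (auto simp: K_def)
      then have "z \<in> (\<Union>i\<in>I. U i)" using K_mono[of m M] I(2) by (auto simp: M_def)
      then show "\<exists>u\<in>I. cube z (L (0 + M)) \<inter> U u \<noteq> {}"
        using \<open>z \<in> cube z (L M)\<close> by auto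
    qed (use Y L C t I(1) LM Ud in simp_all)
    then have "l0 powr t / C \<le> (\<Sum>u\<in>I. r u powr t)" using C by (simp add: L0 field_simps)
    then have "ennreal (l0 powr t / C) \<le> ennreal (\<Sum>u\<in>I. r u powr t)" by (rule ennreal_leI)
    also have "\<dots> = (\<Sum>u\<in>I. ennreal (r u powr t))" by (rule sum_ennreal[symmetric]) auto
    also have "\<dots> \<le> (\<Sum>u. ennreal (r u powr t))" by (rule sum_le_suminf) (use I in auto)
    also have "\<dots> \<le> (\<Sum>u. ennreal (diameter (V u) powr t) + ennreal (c * (1/2) ^ Suc u))"
    proof (rule suminf_le)
      fix u
      have "ennreal (r u powr t) \<le> ennreal (diameter (V u) powr t + c * (1/2) ^ Suc u)"
        unfolding r_def by (rule ennreal_leI[OF h(2)])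
      also have "\<dots> = ennreal (diameter (V u) powr t) + ennreal (c * (1/2) ^ Suc u)"
        using c by (intro ennreal_plus) auto
      finally show "ennreal (r u powr t) \<le> \<dots>" .
    qed auto
    also have "\<dots> = (\<Sum>u. ennreal (diameter (V u) powr t)) + (\<Sum>u. ennreal (c * (1/2) ^ Suc u))"
      by (rule suminf_add[symmetric]) auto
    also have "(\<Sum>u. ennreal (c * (1/2) ^ Suc u)) = ennreal c"
      using sums_mult[OF power_half_series, of c] c by (intro suminf_ennreal_eq) auto
    finally show ?thesis .
  qed
  show ?thesis unfolding hcontent_def
  proof (rule INF_greatest, rule ennreal_le_epsilon)
    fix V :: "nat \<Rightarrow> (real ^ 'n) set" and c :: real
    assume "V \<in> {U. cube x0 l0 \<inter> \<Inter> (range S) \<subseteq> \<Union> (range U) \<and> (\<forall>i. bounded (U i))}" "0 < c"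
    then show "ennreal (l0 powr t / C) \<le> (\<Sum>i. ennreal (diameter (V i) powr t)) + ennreal c"
      by (intro key) auto
  qed
qed

section \<open>Layers of parallel slabs\<close>

lemma card_le_of_spread:
  fixes A :: "nat set"
  assumes "finite A" "\<And>a b. a \<in> A \<Longrightarrow> b \<in> A \<Longrightarrow> real a - real b \<le> D" "0 \<le> D"
  shows "real (card A) \<le> D + 1"
proof (cases "A = {}")
  case False
  have "A \<subseteq> {Min A..Max A}" using assms(1) by auto
  then have "card A \<le> Suc (Max A) - Min A" using card_mono[of "{Min A..Max A}" A] by simp
  moreover have "Min A \<le> Max A" using assms(1) False by simp
  moreover have "real (Max A) - real (Min A) \<le> D" using assms False by simp
  ultimately show ?thesis by linarith
qed (use assms in simp)

text \<open>The centres lie on the hyperplanes where \<open>u \<bullet> y - c\<close> is an integer,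
  above a grid of mesh \<open>4 l'\<close> in all coordinates but the dominant one,
  \<open>i\<close>. The cubes stay in \<open>S\<close> because its layers have half-width at least
  \<open>d l'\<close>. The hypothesis \<open>sp\<close> keeps layers \<open>3 l'\<close> apart,
  \<open>Nl\<close> gives at least one layer, and \<open>big\<close> supplies enough of them to
  reach exponent \<open>t - (d - 1)\<close> across the layers and to repay the factor 8 lost by the
  grid in every other coordinate.\<close>

lemma children_in_layers:
  fixes u x :: "real ^ 'n"
  assumes t: "real CARD('n) - 1 < t" "t \<le> real CARD('n)"
    and l: "0 < l" and l': "0 < l'" "l' \<le> l / 8" and sp: "3 * l' * norm u \<le> 1"
    and Nl: "real CARD('n) \<le> norm u * l"
    and S: "{y. \<exists>p::int. \<bar>u \<bullet> y - c - p\<bar> \<le> norm u * (real CARD('n) * l')} \<subseteq> S"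
    and big: "2 * real CARD('n) * 8 ^ (CARD('n) - 1) * (l / l') powr (t - (real CARD('n) - 1)) \<le> norm u * l"
  shows "\<exists>Y. children t (8 * 16 ^ (CARD('n) - 1)) S l l' x Y"
proof -
  let ?d = "real CARD('n)" and ?E = "CARD('n) - 1"
  define b where "b = t - (?d - 1)"
  have b: "0 < b" "b \<le> 1" using t by (auto simp: b_def)
  have d1: "?d \<ge> 1" by (rule card_ge_1)
  have powE: "z powr (?d - 1) = z ^ ?E" if "z > 0" for z :: real
    using that by (simp add: powr_realpow[symmetric] of_nat_diff)
  have powt: "z powr t = z ^ ?E * z powr b" if "z > 0" for z :: real
    using powr_add[of z "?d - 1" b] powE[OF that] by (simp add: b_def)
  obtain i where i: "norm u \<le> ?d * \<bar>u $ i\<bar>" using ex_coord_ge_norm[of u] by blast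
  define v where "v = \<bar>u $ i\<bar>"
  have vl: "1 \<le> v * l"
  proof -
    have "?d \<le> ?d * v * l" using Nl mult_right_mono[OF i, of l] l unfolding v_def by linarith
    then show ?thesis using d1 by (simp add: mult.assoc)
  qed
  then have v: "v > 0" using l by (smt (verit) zero_less_mult_pos2)
  have vu: "v \<le> norm u" using component_le_norm_cart[of u i] by (simp add: v_def)
  define s where "s = sgn (u $ i)"
  have s: "s * s = 1" "u $ i = s * v" "s = 1 \<or> s = -1" using v by (auto simp: s_def v_def sgn_if)
  define N1 N2 where "N1 = nat \<lfloor>v * l\<rfloor>" and "N2 = nat \<lfloor>l / (4 * l')\<rfloor>"
  have q2: "l / (4 * l') \<ge> 2" using l' by (simp add: field_simps)
  have N1: "real N1 \<le> v * l" "v * l / 2 \<le> real N1"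
    unfolding N1_def using nat_floor_bounds[OF vl] by auto
  have N2: "real N2 \<le> l / (4 * l')" "l / (4 * l') / 2 \<le> real N2"
    unfolding N2_def using nat_floor_bounds[of "l / (4 * l')"] q2 by auto
  have N2': "4 * l' * real N2 \<le> l" "l / (8 * l') \<le> real N2" using N2 l' by (simp_all add: field_simps)
  define w where "w k = (\<chi> j. if j = i then x $ i - l / 2 else x $ j - l / 2 + 4 * l' * real (k j))"
    for k :: "'n \<Rightarrow> nat"
  \<comment> \<open>The fractional part by which \<open>w k\<close> must move along axis
    \<open>i\<close>, measured in units of the layer spacing \<open>1 / v\<close>, to reach the next
    hyperplane. The sign \<open>s\<close> accounts for the orientation of
    \<open>u $ i\<close>.\<close>
  define F where "F k = frac (- s * (u \<bullet> w k - c))" for k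
  have F: "0 \<le> F k" "F k < 1" for k by (simp_all add: F_def frac_lt_1)
  define y where "y k m = w k + axis i ((F k + real m) / v)" for k m
  have y_i: "y k m $ i = x $ i - l / 2 + (F k + real m) / v" for k m
    by (simp add: y_def w_def axis_def)
  have y_j: "y k m $ j = x $ j - l / 2 + 4 * l' * real (k j)" if "j \<noteq> i" for k m j
    using that by (simp add: y_def w_def axis_def)
  have y_int: "\<exists>p::int. u \<bullet> y k m - c = p" for k m
  proof -
    have "u \<bullet> y k m = u \<bullet> w k + s * (F k + real m)"
      using v s(2) by (simp add: y_def inner_add_right inner_axis)
    also have "F k = - s * (u \<bullet> w k - c) - \<lfloor>- s * (u \<bullet> w k - c)\<rfloor>"
      by (simp add: F_def frac_def)
    finally have eq: "u \<bullet> y k m - c = (u \<bullet> w k - c) * (1 - s * s) + s * (real m - \<lfloor>- s * (u \<bullet> w k - c)\<rfloor>)"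
      by (simp add: algebra_simps)
    show ?thesis using s(3)
    proof
      assume "s = 1"
      then show ?thesis using eq by (intro exI[of _ "int m - \<lfloor>- s * (u \<bullet> w k - c)\<rfloor>"]) simp
    next
      assume "s = -1"
      then show ?thesis using eq by (intro exI[of _ "\<lfloor>- s * (u \<bullet> w k - c)\<rfloor> - int m"]) simp
    qed
  qed
  define P where "P = PiE (UNIV - {i}) (\<lambda>_. {..<N2})"
  define I where "I = P \<times> {..<N1}"
  define Y where "Y = (\<lambda>(k, m). y k m) ` I"
  have finP: "finite P" unfolding P_def by (intro finite_PiE) auto
  have finI: "finite I" using finP by (simp add: I_def)
  have kN: "k j < N2" if "k \<in> P" "j \<noteq> i" for k j using that by (auto simp: P_def)
  have inS: "cube (y k m) l' \<subseteq> cube x l \<inter> S" if k: "k \<in> P" and m: "m < N1" for k m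
  proof
    fix z assume z: "z \<in> cube (y k m) l'"
    then have zy: "\<bar>z $ j - y k m $ j\<bar> \<le> l'" for j by (simp add: cube_def)
    have yx: "\<bar>y k m $ j - x $ j\<bar> \<le> l / 2" for j
    proof (cases "j = i")
      case True
      have "F k + real m \<le> real N1" using F[of k] m by linarith
      then have "F k + real m \<le> v * l" using N1 by linarith
      then have "(F k + real m) / v \<le> l" using v by (simp add: field_simps)
      moreover have "0 \<le> (F k + real m) / v" using F[of k] v by simp
      ultimately show ?thesis unfolding True y_i by linarith
    next
      case False
      have "4 * l' * real (k j) \<le> 4 * l' * real N2" using kN[OF k False] l' by (intro mult_left_mono) auto
      moreover have "0 \<le> 4 * l' * real (k j)" using l' by simp
      ultimately show ?thesis unfolding y_j[OF False] using N2'(1) by linarith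
    qed
    have "\<bar>z $ j - x $ j\<bar> \<le> l" for j using zy[of j] yx[of j] l' by linarith
    then have 1: "z \<in> cube x l" by (simp add: cube_def)
    obtain p :: int where p: "u \<bullet> y k m - c = p" using y_int by blast
    have "\<bar>u \<bullet> (z - y k m)\<bar> \<le> norm u * (?d * l')"
      by (rule abs_inner_le_card_coord) (use zy in simp)
    then have "\<bar>u \<bullet> z - c - p\<bar> \<le> norm u * (?d * l')"
      using p by (simp add: inner_diff_right flip: p)
    then show "z \<in> cube x l \<inter> S" using 1 S by blast
  qed
  \<comment> \<open>Cubes of half-side \<open>l'\<close> that contain points less than
    \<open>l'\<close> apart have centres less than \<open>3 l'\<close> apart. Grid mesh
    \<open>4 l'\<close> and layer spacing \<open>1 / v \<ge> 3 l'\<close> exclude this for distinct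
    indices.\<close>
  have sep: "k = k' \<and> m = m'"
    if k: "k \<in> P" "k' \<in> P" and close: "\<And>j. \<bar>y k m $ j - y k' m' $ j\<bar> < 3 * l'" for k k' m m'
  proof -
    have "k j = k' j" for j
    proof (cases "j = i")
      case True
      then show ?thesis using k by (auto simp: P_def PiE_def extensional_def)
    next
      case False
      have "\<bar>4 * l' * real (k j) - 4 * l' * real (k' j)\<bar> < 3 * l'"
        using close[of j] by (simp add: y_j[OF False])
      then have "4 * l' * \<bar>real (k j) - real (k' j)\<bar> < 4 * l' * 1"
        using l' by (simp add: abs_mult flip: right_diff_distrib)
      then have "\<bar>real (k j) - real (k' j)\<bar> < 1" using l' by simp
      then show ?thesis by linarith
    qed
    then have kk: "k = k'" by blast
    have "\<bar>(F k + real m) / v - (F k + real m') / v\<bar> < 3 * l'" using close[of i] by (simp add: y_i kk)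
    then have "\<bar>real m - real m'\<bar> < 3 * l' * v"
      using v by (simp add: abs_divide field_simps flip: diff_divide_distrib)
    also have "\<dots> \<le> 3 * l' * norm u" using vu l' by simp
    also have "\<dots> \<le> 1" by (rule sp)
    finally show ?thesis using kk by linarith
  qed
  have inj: "inj_on (\<lambda>(k, m). y k m) I"
  proof (rule inj_onI)
    fix a a' assume a: "a \<in> I" "a' \<in> I" "(\<lambda>(k, m). y k m) a = (\<lambda>(k, m). y k m) a'"
    obtain k m k' m' where e: "a = (k, m)" "a' = (k', m')" by (cases a, cases a')
    have "k = k' \<and> m = m'" by (rule sep) (use a l' in \<open>auto simp: e I_def\<close>)
    then show "a = a'" by (simp add: e)
  qed
  have "card P = N2 ^ ?E" unfolding P_def by (subst card_PiE) auto
  then have cardY: "card Y = N2 ^ ?E * N1" 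
    unfolding Y_def card_image[OF inj] by (simp add: I_def card_cartesian_product)
  have cardY_ge: "(l / (8 * l')) ^ ?E * (v * l / 2) \<le> card Y"
    unfolding cardY of_nat_mult of_nat_power
    using N1(2) N2'(2) l l' v by (intro mult_mono power_mono) auto
  have bigv: "8 ^ ?E * (l / l') powr b \<le> v * l / 2"
  proof -
    have "norm u * l \<le> ?d * v * l" using i l by (simp add: v_def)
    moreover have "2 * (?d * (8 ^ ?E * (l / l') powr b)) \<le> norm u * l"
      using big by (simp only: b_def mult_ac)
    ultimately have "?d * (8 ^ ?E * (l / l') powr b) \<le> ?d * v * l / 2" by linarith
    also have "\<dots> = ?d * (v * l / 2)" by simp
    finally show ?thesis using d1 by simp
  qed
  have sep2: "\<forall>y\<in>Y. \<forall>y'\<in>Y. \<forall>z\<in>cube y l'. \<forall>z'\<in>cube y' l'. (\<forall>i. \<bar>z $ i - z' $ i\<bar> < l') \<longrightarrow> y = y'"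
  proof (intro ballI impI)
    fix a a' z z' assume a: "a \<in> Y" "a' \<in> Y" "z \<in> cube a l'" "z' \<in> cube a' l'" "\<forall>i. \<bar>z $ i - z' $ i\<bar> < l'"
    obtain k m k' m' where e: "a = y k m" "k \<in> P" "a' = y k' m'" "k' \<in> P"
      using a(1,2) by (auto simp: Y_def I_def)
    have "\<bar>a $ j - a' $ j\<bar> < 3 * l'" for j
    proof -
      have "\<bar>z $ j - a $ j\<bar> \<le> l'" "\<bar>z' $ j - a' $ j\<bar> \<le> l'" "\<bar>z $ j - z' $ j\<bar> < l'"
        using a by (auto simp: cube_def)
      then show ?thesis by linarith
    qed
    then have "k = k' \<and> m = m'" using sep[OF e(2,4), of m m'] by (simp add: e)
    then show "a = a'" by (simp add: e)
  qed
  have dense: "(l / l') powr t \<le> card Y"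
  proof -
    have "(l / l') powr t = (l / (8 * l')) ^ ?E * (8 ^ ?E * (l / l') powr b)"
      using l l' by (simp add: powt power_divide power_mult_distrib)
    also have "\<dots> \<le> (l / (8 * l')) ^ ?E * (v * l / 2)" using bigv l l' by (intro mult_left_mono) auto
    finally show ?thesis using cardY_ge by linarith
  qed
  \<comment> \<open>A set of size \<open>r\<close> meets at most \<open>2 r / l'\<close> grid
    positions in each of the other coordinates and at most \<open>3 r v + 1\<close> layers. Both
    \<open>r v\<close> and the additive 1 must be compared with
    \<open>(r / l) powr b * (v l)\<close>.\<close>
  have count: "card {y \<in> Y. cube y l' \<inter> U \<noteq> {}} \<le> 8 * 16 ^ ?E * (r / l) powr t * card Y"
    if r: "l' \<le> r" "r < l" and U: "\<forall>u\<in>U. \<forall>v\<in>U. \<forall>i. \<bar>u $ i - v $ i\<bar> \<le> r" for r U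
  proof -
    define J where "J = {a \<in> I. cube (y (fst a) (snd a)) l' \<inter> U \<noteq> {}}"
    have finJ: "finite J" using finI by (simp add: J_def)
    have "{y \<in> Y. cube y l' \<inter> U \<noteq> {}} = (\<lambda>a. y (fst a) (snd a)) ` J"
      unfolding Y_def J_def case_prod_unfold by blast
    then have c1: "card {y \<in> Y. cube y l' \<inter> U \<noteq> {}} \<le> card J"
      using card_image_le[OF finJ] by simp
    have close: "\<bar>y (fst a) (snd a) $ j - y (fst a') (snd a') $ j\<bar> \<le> 3 * r" if "a \<in> J" "a' \<in> J" for a a' j
    proof -
      obtain z z' where z: "z \<in> cube (y (fst a) (snd a)) l'" "z \<in> U" "z' \<in> cube (y (fst a') (snd a')) l'" "z' \<in> U"
        using \<open>a \<in> J\<close> \<open>a' \<in> J\<close> by (auto simp: J_def)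
      have "\<bar>z $ j - z' $ j\<bar> \<le> r" using U z by blast
      moreover have "\<bar>z $ j - y (fst a) (snd a) $ j\<bar> \<le> l'" "\<bar>z' $ j - y (fst a') (snd a') $ j\<bar> \<le> l'"
        using z by (auto simp: cube_def)
      ultimately show ?thesis using r by linarith
    qed
    define Kj where "Kj j = (\<lambda>a. fst a j) ` J" for j
    define M where "M k = {m. (k, m) \<in> J}" for k
    have r0: "r > 0" using r l' by linarith
    have cK: "real (card (Kj j)) \<le> 2 * r / l'" if j: "j \<noteq> i" for j
    proof -
      have "real (card (Kj j)) \<le> 3 * r / (4 * l') + 1"
      proof (rule card_le_of_spread)
        fix a b assume "a \<in> Kj j" "b \<in> Kj j"
        then obtain e f where ef: "e \<in> J" "a = fst e j" "f \<in> J" "b = fst f j" by (auto simp: Kj_def)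
        have "4 * l' * real a - 4 * l' * real b \<le> 3 * r"
          using close[OF ef(1,3), of j] by (simp add: y_j[OF j] ef)
        then have "4 * l' * (real a - real b) \<le> 3 * r" by (simp add: algebra_simps)
        then show "real a - real b \<le> 3 * r / (4 * l')" using l' by (simp add: field_simps)
      qed (use finJ r0 l' in \<open>auto simp: Kj_def\<close>)
      also have "\<dots> \<le> 2 * r / l'" using r l' by (simp add: field_simps)
      finally show ?thesis .
    qed
    have finM: "finite (M k)" for k unfolding M_def
      by (rule finite_subset[of _ "snd ` J"]) (use finJ in \<open>force+\<close>)
    have cM: "real (card (M k)) \<le> 3 * r * v + 1" for k
    proof (rule card_le_of_spread)
      fix a b assume "a \<in> M k" "b \<in> M k"
      then have "\<bar>(F k + real a) / v - (F k + real b) / v\<bar> \<le> 3 * r"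
        using close[of "(k, a)" "(k, b)" i] by (simp add: M_def y_i)
      then have "\<bar>real a - real b\<bar> \<le> 3 * r * v"
        using v by (simp add: abs_divide field_simps flip: diff_divide_distrib)
      then show "real a - real b \<le> 3 * r * v" by linarith
    qed (use r0 v finM in auto)
    let ?Q = "PiE (UNIV - {i}) Kj"
    have finQ: "finite ?Q" using finJ by (intro finite_PiE) (auto simp: Kj_def)
    have "J \<subseteq> Sigma ?Q M"
    proof
      fix a assume a: "a \<in> J"
      then have "fst a \<in> P" by (auto simp: J_def I_def)
      then have "fst a \<in> ?Q" using a by (auto simp: P_def PiE_def Pi_def Kj_def)
      then show "a \<in> Sigma ?Q M" using a by (cases a) (auto simp: M_def)
    qed
    then have "card J \<le> card (Sigma ?Q M)" using finQ finM by (intro card_mono) auto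
    also have "\<dots> = (\<Sum>k\<in>?Q. card (M k))" using finQ finM by (simp add: card_SigmaI)
    finally have "real (card J) \<le> (\<Sum>k\<in>?Q. real (card (M k)))" by (simp flip: of_nat_sum)
    also have "\<dots> \<le> real (card ?Q) * (3 * r * v + 1)" using cM by (intro sum_bounded_above) auto
    also have "real (card ?Q) = (\<Prod>j\<in>UNIV - {i}. real (card (Kj j)))" by (subst card_PiE) auto
    also have "\<dots> \<le> (\<Prod>j\<in>UNIV - {i}. 2 * r / l')" using cK by (intro prod_mono) auto
    also have "\<dots> = (2 * r / l') ^ ?E" by simp
    finally have c2: "real (card J) \<le> (2 * r / l') ^ ?E * (3 * r * v + 1)"
      using r0 v by (simp add: mult_right_mono)
    have rl: "0 < r / l" "r / l < 1" using r0 r l by auto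
    \<comment> \<open>Here \<open>b \<le> 1\<close> enters, that is \<open>t \<le> d\<close>: it
      controls the count when many layers are met.\<close>
    have "r / l \<le> (r / l) powr b" using rl b powr_mono'[of b 1 "r / l"] l r0 by simp
    then have p1: "3 * r * v \<le> 3 * ((r / l) powr b * v * l)" 
      using l v mult_right_mono[of "r / l" "(r / l) powr b" "v * l"] by (simp add: field_simps)
    \<comment> \<open>The case of a single layer. As \<open>r \<ge> l'\<close>, it suffices to have
      \<open>(l / l') powr b \<le> v l\<close>, which is the abundance of layers
      \<open>bigv\<close>.\<close>
    have p2: "1 \<le> (r / l) powr b * v * l"
    proof -
      have "(l / l') powr b \<le> 8 ^ ?E * (l / l') powr b"
        using mult_right_mono[of 1 "8 ^ ?E" "(l / l') powr b"] by simp
      then have h: "(l / l') powr b \<le> v * l" using bigv vl by linarith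
      have "(l' / l) powr b * (l / l') powr b = 1" using l l' by (simp flip: powr_mult)
      moreover have "(l' / l) powr b \<le> (r / l) powr b"
        using l l' r b by (intro powr_mono2 divide_right_mono) auto
      ultimately have "1 \<le> (r / l) powr b * (l / l') powr b"
        by (metis mult_right_mono powr_ge_zero)
      also have "\<dots> \<le> (r / l) powr b * (v * l)" using h by (intro mult_left_mono) auto
      finally show ?thesis by (simp add: mult.assoc)
    qed
    \<comment> \<open>Comparison with the lower bound
      \<open>(l / (8 l'))^(d - 1) * (v l / 2)\<close> for the number of children: the 16 is
      \<open>2 * 8\<close>, and the 8 in front comes from \<open>3 + 1\<close> and the halved
      \<open>v l\<close>.\<close>
    have "2 * r / l' = 16 * (r / l) * (l / (8 * l'))" using l l' by simp
    then have eq: "(2 * r / l') ^ ?E = 16 ^ ?E * (r / l) ^ ?E * (l / (8 * l')) ^ ?E"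
      by (simp only: power_mult_distrib)
    have "real (card {y \<in> Y. cube y l' \<inter> U \<noteq> {}}) \<le> (2 * r / l') ^ ?E * (3 * r * v + 1)"
      using c1 c2 by linarith
    also have "\<dots> \<le> (2 * r / l') ^ ?E * (4 * ((r / l) powr b * v * l))"
      using p1 p2 r0 l' by (intro mult_left_mono) auto
    also have "\<dots> = 8 * 16 ^ ?E * (r / l) powr t * ((l / (8 * l')) ^ ?E * (v * l / 2))"
      unfolding eq powt[OF rl(1)] by simp
    also have "\<dots> \<le> 8 * 16 ^ ?E * (r / l) powr t * card Y"
      using cardY_ge by (intro mult_left_mono) auto
    finally show ?thesis .
  qed
  have "children t (8 * 16 ^ ?E) S l l' x Y" unfolding children_def
  proof (intro conjI)
    show "\<forall>y\<in>Y. cube y l' \<subseteq> cube x l \<inter> S" using inS by (auto simp: Y_def I_def)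
    show "\<forall>r U. l' \<le> r \<longrightarrow> r < l \<longrightarrow> (\<forall>u\<in>U. \<forall>v\<in>U. \<forall>i. \<bar>u $ i - v $ i\<bar> \<le> r) \<longrightarrow>
      real (card {y \<in> Y. cube y l' \<inter> U \<noteq> {}}) \<le> 8 * 16 ^ ?E * (r / l) powr t * real (card Y)"
      using count by blast
  qed (use finI sep2 dense in \<open>auto simp: Y_def\<close>)
  then show ?thesis by blast
qed

text \<open>With \<open>N = norm u\<close> large, cubes of size \<open>l'\<close> of order
  \<open>N^(-k - 1)\<close> fit into the layers. The number of available layers, of order
  \<open>N l\<close>, must exceed \<open>(l / l')^b\<close>, of order \<open>N^((k + 1) b)\<close>,
  which is the condition on \<open>k\<close>. The constant \<open>c0\<close> only affects how large
  \<open>N\<close> has to be.\<close>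

lemma spreading_if_layers:
  fixes S :: "(real ^ 'n) set"
  assumes t: "real CARD('n) - 1 < t" "t \<le> real CARD('n)"
    and k: "0 < k" "(k + 1) * (t - (real CARD('n) - 1)) < 1" and c0: "0 < c0"
    and ex: "\<And>B. \<exists>u c. B \<le> norm u \<and> {y. \<exists>p::int. \<bar>u \<bullet> y - c - p\<bar> \<le> c0 * norm u powr - k} \<subseteq> S"
  shows "spreading t (8 * 16 ^ (CARD('n) - 1)) S"
  unfolding spreading_def
proof (intro allI impI)
  fix l :: real assume l: "0 < l"
  let ?d = "real CARD('n)"
  define b where "b = t - (?d - 1)"
  \<comment> \<open>Chosen so that \<open>norm u * (d * g (norm u))\<close> is exactly the
    half-width \<open>c0 * norm u powr - k\<close> of a layer.\<close>
  define g where "g N = c0 * N powr (- k - 1) / ?d" for N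
  \<comment> \<open>The factors of the abundance condition that are free of \<open>N\<close>; that
    condition becomes \<open>A * N powr ((k + 1) * b - 1) \<le> l\<close>.\<close>
  define A where "A = 2 * ?d * 8 ^ (CARD('n) - 1) * (l * ?d / c0) powr b"
  have d1: "?d \<ge> 1" by (rule card_ge_1)
  have gt: "\<forall>\<^sub>F N in at_top. (0::real) < N" by (rule eventually_gt_at_top)
  have lim: "((\<lambda>N. c * N powr e) \<longlongrightarrow> 0) at_top" if "e < 0" for c e :: real
    using that by (intro tendsto_mult_right_zero tendsto_neg_powr filterlim_ident)
  have "\<forall>\<^sub>F N in at_top. c0 / ?d * N powr (- k - 1) < l / 8"
    by (rule order_tendstoD(2)[OF lim]) (use k l in auto)
  moreover have "\<forall>\<^sub>F N in at_top. 3 * c0 / ?d * N powr - k < 1"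
    by (rule order_tendstoD(2)[OF lim]) (use k in auto)
  moreover have "\<forall>\<^sub>F N in at_top. A * N powr ((k + 1) * b - 1) < l"
    by (rule order_tendstoD(2)[OF lim]) (use k l in \<open>auto simp: b_def\<close>)
  moreover have "\<forall>\<^sub>F N in at_top. ?d / l \<le> N" by (rule eventually_ge_at_top)
  ultimately have "\<forall>\<^sub>F N in at_top. 0 < N \<and> c0 / ?d * N powr (- k - 1) < l / 8 \<and>
      3 * c0 / ?d * N powr - k < 1 \<and> A * N powr ((k + 1) * b - 1) < l \<and> ?d / l \<le> N"
    using gt by eventually_elim auto
  then obtain B where B: "\<And>N. B \<le> N \<Longrightarrow> 0 < N \<and> c0 / ?d * N powr (- k - 1) < l / 8 \<and>
      3 * c0 / ?d * N powr - k < 1 \<and> A * N powr ((k + 1) * b - 1) < l \<and> ?d / l \<le> N"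
    unfolding eventually_at_top_linorder by blast
  obtain u c where u: "B \<le> norm u" and
      uS: "{y. \<exists>p::int. \<bar>u \<bullet> y - c - p\<bar> \<le> c0 * norm u powr - k} \<subseteq> S"
        using ex by blast
  define N l' where "N = norm u" and "l' = g N"
  have N: "0 < N" "c0 / ?d * N powr (- k - 1) < l / 8" "3 * c0 / ?d * N powr - k < 1"
    "A * N powr ((k + 1) * b - 1) < l" "?d / l \<le> N" using B[OF u] by (auto simp: N_def)
  have Np: "N powr (- k - 1) * N = N powr - k" using N(1) powr_add[of N "- k - 1" 1] by simp
  have l'0: "0 < l'" using N(1) c0 d1 by (simp add: l'_def g_def)
  have l'8: "l' \<le> l / 8" using N(2) by (simp add: l'_def g_def)
  have w: "norm u * (?d * l') = c0 * N powr - k"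
    using Np d1 by (simp add: l'_def g_def N_def mult_ac)
  have sp: "3 * l' * norm u \<le> 1"
  proof -
    have "3 * l' * norm u = 3 * c0 / ?d * N powr - k" using w d1 by (simp add: N_def field_simps)
    then show ?thesis using N(3) by simp
  qed
  have big: "2 * ?d * 8 ^ (CARD('n) - 1) * (l / l') powr b \<le> norm u * l"
  proof -
    have "l / l' = (l * ?d / c0) * N powr (k + 1)"
      using N(1) d1 c0 by (simp add: l'_def g_def powr_minus_divide powr_diff powr_add field_simps)
    then have "(l / l') powr b = (l * ?d / c0) powr b * N powr ((k + 1) * b)"
      using powr_mult[of "l * ?d / c0" "N powr (k + 1)" b] by (simp only: powr_powr)
    then have "2 * ?d * 8 ^ (CARD('n) - 1) * (l / l') powr b = N * (A * N powr ((k + 1) * b - 1))"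
      using N(1) by (simp add: A_def powr_diff)
    also have "\<dots> \<le> N * l" using N(1,4) by (intro mult_left_mono) auto
    finally show ?thesis by (simp add: N_def)
  qed
  have "\<exists>Y. children t (8 * 16 ^ (CARD('n) - 1)) S l l' x Y" for x
  proof (rule children_in_layers[OF t l l'0 l'8 sp])
    show "?d \<le> norm u * l" using N(5) l by (simp add: N_def field_simps)
    show "{y. \<exists>p::int. \<bar>u \<bullet> y - c - p\<bar> \<le> norm u * (?d * l')} \<subseteq> S"
      using uS by (simp add: w N_def)
    show "2 * ?d * 8 ^ (CARD('n) - 1) * (l / l') powr (t - (?d - 1)) \<le> norm u * l"
      using big by (simp add: b_def)
  qed
  then show "\<exists>l'>0. l' \<le> l / 2 \<and> (\<forall>x. \<exists>Y. children t (8 * 16 ^ (CARD('n) - 1)) S l l' x Y)"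
    using l'0 l'8 l by (intro exI[of _ l']) auto
qed

section \<open>Packing dimension\<close>

text \<open>A grid of mesh \<open>4 e\<close> in the ball has of order \<open>(r / e)^d\<close>
  points. By density they can be moved into \<open>F\<close> with disjoint balls of radius
  \<open>e\<close>, whose sum is of order \<open>r^d * e^(s - d)\<close> and blows up as
  \<open>e\<close> tends to zero.\<close>

lemma packing_premeasure_eq_top:
  fixes F :: "(real ^ 'n) set"
  assumes sub: "ball x r \<subseteq> closure F" and r: "0 < r" and s: "s < real CARD('n)"
  shows "packing_premeasure s F = top"
proof -
  let ?d = "real CARD('n)"
  have d1: "?d \<ge> 1" by (rule card_ge_1)
  have pack: "\<exists>B\<in>packings f F. ennreal ((r / (16 * ?d)) ^ CARD('n) * 2 powr s * e powr (s - ?d)) \<le>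
      (\<Sum>\<^sub>\<infinity>(x, r)\<in>B. ennreal ((2 * r) powr s))"
    if e: "0 < e" "e \<le> f" "e \<le> r / (8 * ?d)" for e f
  proof -
    define N where "N = nat \<lfloor>r / (8 * ?d * e)\<rfloor>"
    have "1 \<le> r / (8 * ?d * e)" using e d1 by (simp add: field_simps)
    note fl = nat_floor_bounds[OF this, folded N_def]
    have N: "4 * e * real N \<le> r / (2 * ?d)" "r / (16 * ?d * e) \<le> real N"
      using fl e d1 by (simp_all add: field_simps)
    define P where "P = PiE (UNIV :: 'n set) (\<lambda>_. {..<N})"
    define y where "y k = (\<chi> j. x $ j + 4 * e * real (k j))" for k :: "'n \<Rightarrow> nat"
    have finP: "finite P" unfolding P_def by (intro finite_PiE) auto
    have "\<exists>z\<in>F. dist z (y k) < e / 2" if "k \<in> P" for k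
    proof -
      have "\<bar>(y k - x) $ j\<bar> \<le> r / (2 * ?d)" for j
      proof -
        have "4 * e * real (k j) \<le> 4 * e * real N"
          using PiE_mem[OF that[unfolded P_def], of j] e by (intro mult_left_mono) auto
        then have "4 * e * real (k j) \<le> r / (2 * ?d)" using N(1) by (rule order_trans)
        then show ?thesis using e by (simp add: y_def)
      qed
      then have "norm (y k - x) \<le> ?d * (r / (2 * ?d))" by (rule norm_le_card_coord)
      also have "\<dots> < r" using r d1 by simp
      finally have "y k \<in> ball x r" by (simp add: dist_norm norm_minus_commute)
      then have "y k \<in> closure F" using sub by blast
      then show ?thesis unfolding closure_approachable using e(1) half_gt_zero by blast
    qed
    then obtain z where z: "\<And>k. k \<in> P \<Longrightarrow> z k \<in> F \<and> dist (z k) (y k) < e / 2"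
      by metis
    \<comment> \<open>Mesh \<open>4 e\<close> minus two displacements below \<open>e / 2\<close>
      leaves more than \<open>3 e\<close>, so closed balls of radius \<open>e\<close> are
      disjoint.\<close>
    have far: "2 * e < dist (z k) (z k')" if k: "k \<in> P" "k' \<in> P" "k \<noteq> k'" for k k'
    proof -
      obtain j where j: "k j \<noteq> k' j" using k(3) by blast
      have "1 \<le> \<bar>real (k j) - real (k' j)\<bar>" using j by linarith
      then have "4 * e \<le> 4 * e * \<bar>real (k j) - real (k' j)\<bar>" using e by simp
      also have "\<dots> = \<bar>(y k - y k') $ j\<bar>"
        using e by (simp add: y_def abs_mult flip: right_diff_distrib)
      also have "\<dots> \<le> dist (y k) (y k')" unfolding dist_norm by (rule component_le_norm_cart)
      finally have "4 * e \<le> dist (y k) (y k')" .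
      moreover have "dist (y k) (y k') \<le> dist (z k) (y k) + dist (z k) (z k') + dist (z k') (y k')"
        using dist_triangle[of "y k" "y k'" "z k"] dist_triangle[of "z k" "y k'" "z k'"]
        by (simp add: dist_commute)
      ultimately show ?thesis using z[OF k(1)] z[OF k(2)] e by linarith
    qed
    define B where "B = (\<lambda>k. (z k, e)) ` P"
    have inj: "inj_on (\<lambda>k. (z k, e)) P"
    proof (rule inj_onI, rule ccontr)
      fix k k' assume "k \<in> P" "k' \<in> P" "(z k, e) = (z k', e)" "k \<noteq> k'"
      then show False using far[of k k'] e by simp
    qed
    have "B \<in> packings f F" unfolding packings_def pairwise_def
    proof (intro CollectI conjI ballI impI)
      show "B \<subseteq> F \<times> {0<..f}" using z e by (auto simp: B_def)
      fix a b assume "a \<in> B" "b \<in> B" "a \<noteq> b"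
      then obtain k k' where k: "k \<in> P" "k' \<in> P" "a = (z k, e)" "b = (z k', e)" "k \<noteq> k'"
        by (auto simp: B_def)
      have "cball (z k) e \<inter> cball (z k') e = {}"
      proof (rule ccontr)
        assume "cball (z k) e \<inter> cball (z k') e \<noteq> {}"
        then obtain w where "dist (z k) w \<le> e" "dist (z k') w \<le> e" by auto
        then show False using far[OF k(1,2,5)] dist_triangle2[of "z k" "z k'" w] by linarith
      qed
      then show "(case a of (x, r) \<Rightarrow> \<lambda>(y, t). cball x r \<inter> cball y t = {}) b"
        using k by simp
    qed
    moreover have "ennreal ((r / (16 * ?d)) ^ CARD('n) * 2 powr s * e powr (s - ?d)) \<le>
      (\<Sum>\<^sub>\<infinity>(x, r)\<in>B. ennreal ((2 * r) powr s))"
    proof -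
      have "(r / (16 * ?d)) ^ CARD('n) * 2 powr s * e powr (s - ?d) =
          (r / (16 * ?d * e)) ^ CARD('n) * (2 * e) powr s"
        using e by (simp add: powr_diff powr_realpow powr_mult power_divide power_mult_distrib)
      also have "\<dots> \<le> real N ^ CARD('n) * (2 * e) powr s"
        using N(2) r d1 e by (intro mult_right_mono power_mono) auto
      also have "real N ^ CARD('n) = real (card P)" unfolding P_def by (subst card_PiE) auto
      finally have "ennreal ((r / (16 * ?d)) ^ CARD('n) * 2 powr s * e powr (s - ?d)) \<le>
          ennreal (real (card P) * (2 * e) powr s)" by (rule ennreal_leI)
      also have "\<dots> = (\<Sum>k\<in>P. ennreal ((2 * e) powr s))"
        by (simp add: ennreal_mult ennreal_of_nat_eq_real_of_nat)
      also have "\<dots> = (\<Sum>(x, r)\<in>B. ennreal ((2 * r) powr s))"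
        unfolding B_def by (subst sum.reindex[OF inj]) simp
      also have "\<dots> = (\<Sum>\<^sub>\<infinity>(x, r)\<in>B. ennreal ((2 * r) powr s))"
        using finP by (simp add: B_def)
      finally show ?thesis .
    qed
    ultimately show ?thesis by blast
  qed
  have "(SUP B\<in>packings f F. \<Sum>\<^sub>\<infinity>(x, r)\<in>B. ennreal ((2 * r) powr s)) = top" if f: "0 < f" for f
  proof (rule ccontr)
    let ?S = "SUP B\<in>packings f F. \<Sum>\<^sub>\<infinity>(x, r)\<in>B. ennreal ((2 * r) powr s)"
    let ?c = "(r / (16 * ?d)) ^ CARD('n) * 2 powr s"
    assume "?S \<noteq> top"
    then obtain M where M: "?S = ennreal M" "0 \<le> M" by (cases ?S) auto
    have c: "?c > 0" using r d1 by simp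
    define A where "A = (M + 1) / ?c"
    have A: "A > 0" using c M by (simp add: A_def)
    \<comment> \<open>The last entry solves \<open>e powr (s - d) = A\<close>. As
      \<open>s < d\<close>, any smaller \<open>e\<close> gives at least \<open>A\<close>, and the
      packing sum is at least \<open>?c * A = M + 1\<close>.\<close>
    define e where "e = min (min f (r / (8 * ?d))) (A powr (- 1 / (?d - s)))"
    have e: "0 < e" "e \<le> f" "e \<le> r / (8 * ?d)" "e \<le> A powr (- 1 / (?d - s))"
      using f r d1 A by (auto simp: e_def)
    have "- 1 / (?d - s) * (s - ?d) = 1" using s by (simp add: divide_simps)
    then have "A = (A powr (- 1 / (?d - s))) powr (s - ?d)" unfolding powr_powr using A by simp
    also have "\<dots> \<le> e powr (s - ?d)" using e s by (intro powr_mono2') auto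
    finally have "M + 1 \<le> ?c * e powr (s - ?d)" using c by (simp add: A_def field_simps)
    obtain B where B: "B \<in> packings f F" "ennreal (?c * e powr (s - ?d)) \<le>
      (\<Sum>\<^sub>\<infinity>(x, r)\<in>B. ennreal ((2 * r) powr s))" using pack[OF e(1-3)] by blast
    have "ennreal (M + 1) \<le> ennreal (?c * e powr (s - ?d))"
      using \<open>M + 1 \<le> ?c * e powr (s - ?d)\<close> by (rule ennreal_leI)
    also note B(2)
    also have "(\<Sum>\<^sub>\<infinity>(x, r)\<in>B. ennreal ((2 * r) powr s)) \<le> ?S"
      using B(1) by (rule SUP_upper)
    finally show False using M by simp
  qed
  then show ?thesis unfolding packing_premeasure_def by (subst INF_cong[OF refl, of _ _ "\<lambda>_. top"]) auto
qed

text \<open>Disjoint balls centred in \<open>Q\<close> with radii at most one have total volume at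
  most that of the ball of radius \<open>R + 1\<close>. Above the dimension, \<open>(2 r)^s\<close>
  is at most \<open>(2 e)^(s - d)\<close> times a multiple of the volume, and this factor vanishes
  with \<open>e\<close>.\<close>

lemma packing_premeasure_eq_0:
  fixes Q :: "(real ^ 'n) set"
  assumes bQ: "bounded Q" and s: "real CARD('n) < s"
  shows "packing_premeasure s Q = 0"
proof -
  let ?d = "real CARD('n)" and ?n = "CARD('n)"
  obtain R where R: "R > 0" "\<And>x. x \<in> Q \<Longrightarrow> norm x \<le> R"
    using bQ by (auto simp: bounded_pos)
  define c where "c = unit_ball_vol ?d"
  have c: "c > 0" by (simp add: c_def)
  have vol: "measure lborel (cball x r) = c * r ^ ?n" if "0 \<le> r" for x :: "real ^ 'n" and r
    using content_cball[OF that, of x] by (simp add: c_def)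
  define K where "K = 2 ^ ?n * (R + 1) ^ ?n"
  have bound: "(\<Sum>\<^sub>\<infinity>(x, r)\<in>B. ennreal ((2 * r) powr s)) \<le> ennreal (K * (2 * e) powr (s - ?d))"
    if B: "B \<in> packings e Q" and e: "0 < e" "e \<le> 1" for B e
  proof -
    have Bs: "\<And>x r. (x, r) \<in> B \<Longrightarrow> x \<in> Q \<and> 0 < r \<and> r \<le> e"
      and Bd: "\<And>a b. a \<in> B \<Longrightarrow> b \<in> B \<Longrightarrow> a \<noteq> b \<Longrightarrow> cball (fst a) (snd a) \<inter> cball (fst b) (snd b) = {}"
      using B unfolding packings_def pairwise_def by (auto simp: case_prod_unfold)
    have fin: "(\<Sum>(x, r)\<in>G. ennreal ((2 * r) powr s)) \<le> ennreal (K * (2 * e) powr (s - ?d))"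
      if G: "finite G" "G \<subseteq> B" for G
    proof -
      have "(\<Sum>a\<in>G. c * snd a ^ ?n) = (\<Sum>a\<in>G. measure lborel (cball (fst a) (snd a)))"
        using G Bs by (intro sum.cong refl vol[symmetric]) (force simp: less_imp_le)
      also have "\<dots> = measure lborel (\<Union>a\<in>G. cball (fst a) (snd a))"
      proof (rule measure_finite_Union[symmetric])
        show "disjoint_family_on (\<lambda>a. cball (fst a) (snd a)) G"
          unfolding disjoint_family_on_def by (intro ballI impI Bd subsetD[OF G(2)])
        show "emeasure lborel (cball (fst a) (snd a)) \<noteq> \<infinity>" for a :: "(real ^ 'n) \<times> real"
          using emeasure_lborel_cball_finite[of "fst a" "snd a"] by simp
      qed (use G in auto)
      also have "\<dots> \<le> measure lborel (cball 0 (R + 1) :: (real ^ 'n) set)"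
      proof (rule measure_mono_fmeasurable)
        show "(\<Union>a\<in>G. cball (fst a) (snd a)) \<subseteq> cball 0 (R + 1)"
        proof
          fix w assume "w \<in> (\<Union>a\<in>G. cball (fst a) (snd a))"
          then obtain x r where xr: "(x, r) \<in> G" "dist x w \<le> r" by auto
          then have "norm x \<le> R" "r \<le> 1" using Bs[of x r] G R(2)[of x] e by auto
          moreover have "norm w \<le> norm x + dist x w"
            using norm_triangle_ineq[of x "w - x"] by (simp add: dist_norm norm_minus_commute)
          ultimately show "w \<in> cball 0 (R + 1)" using xr by simp
        qed
        show "cball (0 :: real ^ 'n) (R + 1) \<in> fmeasurable lborel"
          using emeasure_lborel_cball_finite by (intro fmeasurableI) auto
      qed (use G in auto)
      also have "\<dots> = c * (R + 1) ^ ?n" using R by (intro vol) auto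
      finally have "c * (\<Sum>a\<in>G. snd a ^ ?n) \<le> c * (R + 1) ^ ?n" by (simp add: sum_distrib_left)
      then have v: "(\<Sum>a\<in>G. snd a ^ ?n) \<le> (R + 1) ^ ?n" using c by simp
      have "(\<Sum>a\<in>G. (2 * snd a) powr s) \<le> (\<Sum>a\<in>G. 2 ^ ?n * (2 * e) powr (s - ?d) * snd a ^ ?n)"
      proof (rule sum_mono)
        fix a assume "a \<in> G"
        then have a: "0 < snd a" "snd a \<le> e" using G Bs[of "fst a" "snd a"] by auto
        have "(2 * snd a) powr s = (2 * snd a) powr (s - ?d) * (2 * snd a) powr ?d" by (simp flip: powr_add)
        also have "\<dots> \<le> (2 * e) powr (s - ?d) * (2 * snd a) powr ?d"
          using a s by (intro mult_right_mono powr_mono2) auto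
        also have "(2 * snd a) powr ?d = 2 ^ ?n * snd a ^ ?n"
          using a by (simp add: powr_realpow power_mult_distrib)
        finally show "(2 * snd a) powr s \<le> 2 ^ ?n * (2 * e) powr (s - ?d) * snd a ^ ?n" by (simp add: mult_ac)
      qed
      also have "\<dots> = 2 ^ ?n * (2 * e) powr (s - ?d) * (\<Sum>a\<in>G. snd a ^ ?n)"
        by (simp add: sum_distrib_left)
      also have "\<dots> \<le> 2 ^ ?n * (2 * e) powr (s - ?d) * (R + 1) ^ ?n" using v by (intro mult_left_mono) auto
      also have "\<dots> = K * (2 * e) powr (s - ?d)" by (simp add: K_def)
      finally have "ennreal (\<Sum>a\<in>G. (2 * snd a) powr s) \<le> ennreal (K * (2 * e) powr (s - ?d))"
        by (rule ennreal_leI)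
      moreover have "(\<Sum>(x, r)\<in>G. ennreal ((2 * r) powr s)) = ennreal (\<Sum>a\<in>G. (2 * snd a) powr s)"
        by (simp add: case_prod_unfold sum_ennreal)
      ultimately show ?thesis by simp
    qed
    then show ?thesis by (subst nonneg_infsum_complete) (auto intro!: SUP_least)
  qed
  show ?thesis
  proof (rule ennreal_eq_0_if_le_tendsto_0)
    show "((\<lambda>e. K * (2 * e) powr (s - ?d)) \<longlongrightarrow> 0) (at_right 0)"
    proof (rule tendsto_mult_right_zero, rule tendsto_zero_powrI[OF _ tendsto_const])
      show "((\<lambda>e. 2 * e :: real) \<longlongrightarrow> 0) (at_right 0)"
        using tendsto_mult_right_zero[OF tendsto_ident_at, of 2 "{0::real<..}"] by simp
    qed (use s in \<open>auto simp: eventually_at_filter\<close>)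
    fix e :: real assume e: "0 < e" "e \<le> 1"
    have "packing_premeasure s Q \<le> (SUP B\<in>packings e Q. \<Sum>\<^sub>\<infinity>(x, r)\<in>B. ennreal ((2 * r) powr s))"
      unfolding packing_premeasure_def using e by (intro INF_lower) auto
    also have "\<dots> \<le> ennreal (K * (2 * e) powr (s - ?d))" using bound e by (intro SUP_least) auto
    finally show "packing_premeasure s Q \<le> ennreal (K * (2 * e) powr (s - ?d))" .
  qed
qed

lemma packing_dim_le_card: "packing_dim (E :: (real ^ 'n) set) \<le> ereal (real CARD('n))"
proof (rule ereal_le_epsilon2)
  fix e :: real assume e: "0 < e"
  let ?s = "real CARD('n) + e"
  have "packing_measure ?s E \<le> (\<Sum>i. packing_premeasure ?s (cube 0 (real i + 1) :: (real ^ 'n) set))"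
    unfolding packing_measure_def by (rule INF_lower) (simp add: UN_cube)
  also have "\<dots> = 0"
    using e by (simp add: packing_premeasure_eq_0 compact_imp_bounded[OF compact_cube])
  finally have "packing_measure ?s E = 0" by simp
  then have "ereal ?s \<in> {ereal s |s. 0 \<le> s \<and> packing_measure s E = 0}" using e by auto
  then show "packing_dim E \<le> ereal (real CARD('n)) + ereal e"
    unfolding packing_dim_def by (simp add: Inf_lower)
qed

text \<open>If the residual set were covered by countably many sets of finite premeasure, one of their
  closures would have interior by Baire, and there the premeasure is infinite.\<close>

lemma packing_dim_residual:
  fixes \<G> :: "(real ^ 'n) set set"
  assumes G: "countable \<G>" "\<And>T. T \<in> \<G> \<Longrightarrow> open T" "\<And>T. T \<in> \<G> \<Longrightarrow> closure T = UNIV"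
    and W: "open W" "W \<noteq> {}" and sub: "\<Inter>\<G> \<inter> W \<subseteq> E"
  shows "packing_dim E = ereal (real CARD('n))"
proof (rule antisym[OF packing_dim_le_card])
  show "ereal (real CARD('n)) \<le> packing_dim E" unfolding packing_dim_def
  proof (rule Inf_greatest)
    fix z assume "z \<in> {ereal s |s. 0 \<le> s \<and> packing_measure s E = 0}"
    then obtain s where s: "z = ereal s" "packing_measure s E = 0" by auto
    show "ereal (real CARD('n)) \<le> z"
    proof (rule ccontr)
      assume "\<not> ereal (real CARD('n)) \<le> z"
      then have sd: "s < real CARD('n)" using s by simp
      have "packing_measure s E < 1" using s(2) by simp
      then obtain F where F: "E \<subseteq> (\<Union>i. F i)" "(\<Sum>i. packing_premeasure s (F i)) < 1"
        unfolding packing_measure_def INF_less_iff by blast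
      have int: "interior (closure (F i)) = {}" for i
      proof (rule ccontr)
        assume "interior (closure (F i)) \<noteq> {}"
        then obtain x r where "0 < r" "ball x r \<subseteq> closure (F i)"
          by (meson ex_in_conv mem_interior)
        then have "packing_premeasure s (F i) = top" using packing_premeasure_eq_top sd by blast
        moreover have "sum (\<lambda>i. packing_premeasure s (F i)) {i} \<le> (\<Sum>i. packing_premeasure s (F i))"
          by (rule sum_le_suminf) auto
        ultimately show False using F(2) by (simp add: top.extremum_unique)
      qed
      let ?\<H> = "\<G> \<union> range (\<lambda>i. - closure (F i))"
      have "UNIV \<subseteq> closure (\<Inter>?\<H>)"
      proof (rule Baire)
        fix T assume "T \<in> ?\<H>"
        then show "openin (top_of_set UNIV) T \<and> UNIV \<subseteq> closure T"
          using G int by (auto simp: closure_complement)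
      qed (use G in auto)
      then have "W \<inter> closure (\<Inter>?\<H>) \<noteq> {}" using W by auto
      then have "W \<inter> \<Inter>?\<H> \<noteq> {}" using open_Int_closure_eq_empty[OF W(1)] by blast
      then obtain x where x: "x \<in> W" "x \<in> \<Inter>?\<H>" by blast
      then have "x \<in> E" using sub by auto
      then obtain i where "x \<in> F i" using F(1) by blast
      moreover have "x \<in> - closure (F i)" using x(2) by blast
      ultimately show False using closure_subset by blast
    qed
  qed
qed

section \<open>Lower bounds for the Hoelder exponent\<close>

abbreviation vnorm :: "int ^ 'n \<Rightarrow> real" where
  "vnorm n \<equiv> norm (real_vec n)"

lemma real_vec_nth [simp]: "real_vec n $ i = of_int (n $ i)"
  by (simp add: real_vec_def)

lemma real_vec_eq_0_iff [simp]: "real_vec n = 0 \<longleftrightarrow> n = 0"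
  by (simp add: vec_eq_iff)

lemma real_vec_zero [simp]: "real_vec 0 = 0"
  by simp

lemma norm_real_vec_ge_1:
  assumes "n \<noteq> 0"
  shows "1 \<le> vnorm n"
proof -
  obtain i where "n $ i \<noteq> 0" using assms by (auto simp: vec_eq_iff)
  then have "1 \<le> \<bar>n $ i\<bar>" by linarith
  then have "1 \<le> \<bar>real_vec n $ i\<bar>" by simp
  then show ?thesis using component_le_norm_cart[of "real_vec n" i] by linarith
qed

lemma finite_norm_real_vec_le: "finite {n :: int ^ 'n. vnorm n \<le> R}"
proof (rule finite_subset)
  show "{n :: int ^ 'n. vnorm n \<le> R} \<subseteq> vec_lambda ` PiE UNIV (\<lambda>_. {-\<lceil>R\<rceil>..\<lceil>R\<rceil>})"
  proof
    fix n :: "int ^ 'n" assume n: "n \<in> {n. vnorm n \<le> R}"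
    have "n $ i \<in> {-\<lceil>R\<rceil>..\<lceil>R\<rceil>}" for i
    proof -
      have "\<bar>real_of_int (n $ i)\<bar> \<le> R" using n component_le_norm_cart[of "real_vec n" i] by simp
      then show ?thesis unfolding atLeastAtMost_iff by linarith
    qed
    then show "n \<in> vec_lambda ` PiE UNIV (\<lambda>_. {-\<lceil>R\<rceil>..\<lceil>R\<rceil>})"
      by (intro image_eqI[of _ _ "vec_nth n"]) auto
  qed
  show "finite ((vec_lambda :: ('n \<Rightarrow> int) \<Rightarrow> _) ` PiE UNIV (\<lambda>_. {-\<lceil>R\<rceil>..\<lceil>R\<rceil>}))"
    by (intro finite_imageI finite_PiE) auto
qed

section \<open>Counting and summation over a sparse support\<close>

lemma eventually_at_infinity_in:
  "eventually P (at_infinity_in S) \<longleftrightarrow> (\<exists>R. \<forall>n\<in>S. R \<le> vnorm n \<longrightarrow> P n)"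
  unfolding at_infinity_in_def eventually_inf_principal eventually_filtercomap_at_top_linorder by auto

lemma sparse_count_le:
  assumes sp: "sparse_int_set S" and e: "0 < e"
  obtains R0 where "1 < R0" "\<And>R. R0 \<le> R \<Longrightarrow> real (card {n \<in> S. vnorm n < R}) \<le> R powr e"
proof -
  have "\<forall>\<^sub>F R in at_top. ln (real (card {n \<in> S. vnorm n < R})) / ln R < e"
    using sp e unfolding sparse_int_set_def by (intro order_tendstoD(2)) auto
  moreover have "\<forall>\<^sub>F R in at_top. (1::real) < R" by (rule eventually_gt_at_top)
  ultimately have "\<forall>\<^sub>F R in at_top. 1 < R \<and> ln (real (card {n \<in> S. vnorm n < R})) / ln R < e"
    by eventually_elim auto
  then obtain R0 where R0: "\<And>R. R0 \<le> R \<Longrightarrow> 1 < R \<and> ln (real (card {n \<in> S. vnorm n < R})) / ln R < e"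
    unfolding eventually_at_top_linorder by blast
  show ?thesis
  proof (rule that)
    show "1 < R0" using R0[of R0] by simp
    fix R assume "R0 \<le> R"
    let ?c = "real (card {n \<in> S. vnorm n < R})"
    have R: "1 < R" "ln ?c / ln R < e" using R0[OF \<open>R0 \<le> R\<close>] by auto
    show "?c \<le> R powr e"
    proof (cases "?c = 0")
      case False
      have "ln ?c < ln R * e" using R by (simp add: field_simps)
      also have "\<dots> = ln (R powr e)" using R by (simp add: ln_powr)
      finally have "ln ?c < ln (R powr e)" .
      moreover have "0 < ?c" "0 < R powr e" using False R by auto
      ultimately show ?thesis by (meson ln_less_cancel_iff less_imp_le)
    qed simp
  qed
qed

text \<open>In dyadic blocks, sparseness with exponent \<open>k / 2\<close> bounds the number of
  vectors with norm near \<open>2^i\<close> by \<open>2^((i + 1) k / 2)\<close>, while each term is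
  at most \<open>2^(- i k)\<close>. The blocks are dominated by a geometric series with ratio
  \<open>2^(- k / 2)\<close>.\<close>

lemma summable_on_sparse:
  assumes sp: "sparse_int_set S" and k: "0 < k"
  shows "(\<lambda>n. vnorm n powr - k) summable_on S"
proof -
  obtain R0 where R0: "1 < R0"
    "\<And>R. R0 \<le> R \<Longrightarrow> real (card {n \<in> S. vnorm n < R}) \<le> R powr (k / 2)"
    using sparse_count_le[OF sp, of "k / 2"] k by auto
  define N where "N n = vnorm n" for n :: "int ^ 'a"
  define S1 where "S1 = {n \<in> S. R0 \<le> N n}"
  define q where "q = (2::real) powr (- k / 2)"
  have q: "0 < q" "q < 1" using k powr_less_mono[of "- k / 2" 0 2] by (auto simp: q_def)
  define j where "j n = nat \<lfloor>log 2 (N n)\<rfloor>" for n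
  have j: "2 ^ j n \<le> N n" "N n < 2 ^ Suc (j n)" if "n \<in> S1" for n
  proof -
    have N1: "1 < N n" using that R0(1) by (simp add: S1_def)
    then have l0: "0 \<le> \<lfloor>log 2 (N n)\<rfloor>" by simp
    have "2 powr real (j n) \<le> N n" using N1 l0 by (simp add: j_def powr_le_iff)
    moreover have "N n < 2 powr (real (j n) + 1)" using N1 l0 by (simp add: j_def less_powr_iff)
    moreover have "2 powr (real (j n) + 1) = 2 ^ Suc (j n)" by (simp add: powr_add powr_realpow)
    ultimately show "2 ^ j n \<le> N n" "N n < 2 ^ Suc (j n)" by (simp_all add: powr_realpow)
  qed
  have "(\<lambda>n. N n powr - k) summable_on S1"
  proof (rule nonneg_bdd_above_summable_on)
    show "bdd_above (sum (\<lambda>n. N n powr - k) ` {F. F \<subseteq> S1 \<and> finite F})"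
    proof (rule bdd_aboveI2)
      fix F assume "F \<in> {F. F \<subseteq> S1 \<and> finite F}"
      then have F: "F \<subseteq> S1" "finite F" by auto
      have "(\<Sum>n\<in>F. N n powr - k) = (\<Sum>i\<in>j ` F. \<Sum>n\<in>{n \<in> F. j n = i}. N n powr - k)"
        using F by (intro sum.group[symmetric]) auto
      also have "\<dots> \<le> (\<Sum>i\<in>j ` F. 2 powr (k / 2) * q ^ i)"
      proof (rule sum_mono)
        fix i assume "i \<in> j ` F"
        then obtain n0 where n0: "n0 \<in> F" "j n0 = i" by auto
        \<comment> \<open>The count is available above \<open>R0\<close> only; a block that contains
          a vector of \<open>S1\<close> reaches beyond it.\<close>
        have R: "R0 \<le> 2 ^ Suc i"
        proof -
          have "R0 \<le> N n0" using n0 F by (auto simp: S1_def)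
          also have "\<dots> < 2 ^ Suc i" using j(2)[of n0] n0 F by auto
          finally show ?thesis by simp
        qed
        have "(\<Sum>n\<in>{n \<in> F. j n = i}. N n powr - k) \<le> real (card {n \<in> F. j n = i}) * (2 ^ i) powr - k"
        proof (rule sum_bounded_above)
          fix n assume "n \<in> {n \<in> F. j n = i}"
          then have "2 ^ i \<le> N n" using j(1)[of n] F by auto
          then show "N n powr - k \<le> (2 ^ i) powr - k" using k by (intro powr_mono2') auto
        qed
        also have "real (card {n \<in> F. j n = i}) \<le> real (card {n \<in> S. vnorm n < 2 ^ Suc i})"
        proof (intro of_nat_mono card_mono)
          show "finite {n \<in> S. vnorm n < 2 ^ Suc i}"
            by (rule finite_subset[OF _ finite_norm_real_vec_le[of "2 ^ Suc i"]]) auto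
          show "{n \<in> F. j n = i} \<subseteq> {n \<in> S. vnorm n < 2 ^ Suc i}"
            using F j(2) by (auto simp: S1_def N_def)
        qed
        also have "\<dots> \<le> (2 ^ Suc i) powr (k / 2)" by (rule R0(2)[OF R])
        also have "(2 ^ Suc i) powr (k / 2) * (2 ^ i) powr - k = 2 powr (k / 2) * q ^ i"
        proof -
          have "(2::real) ^ Suc i = 2 powr (real i + 1)" "(2::real) ^ i = 2 powr real i"
            "q ^ i = q powr real i" using q by (simp_all add: powr_add powr_realpow)
          then show ?thesis by (simp add: q_def powr_powr field_simps flip: powr_add)
        qed
        finally show "(\<Sum>n\<in>{n \<in> F. j n = i}. N n powr - k) \<le> 2 powr (k / 2) * q ^ i"
          by (simp add: mult_right_mono)
      qed
      also have "\<dots> = 2 powr (k / 2) * (\<Sum>i\<in>j ` F. q ^ i)" by (simp add: sum_distrib_left)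
      also have "\<dots> \<le> 2 powr (k / 2) * (\<Sum>i. q ^ i)"
        using F q by (intro mult_left_mono sum_le_suminf) auto
      finally show "(\<Sum>n\<in>F. N n powr - k) \<le> 2 powr (k / 2) * (\<Sum>i. q ^ i)" .
    qed
  qed auto
  moreover have "(\<lambda>n. N n powr - k) summable_on (S - S1)"
    by (rule summable_on_finite, rule finite_subset[OF _ finite_norm_real_vec_le[of R0]])
      (auto simp: S1_def N_def)
  ultimately have "(\<lambda>n. N n powr - k) summable_on (S1 \<union> (S - S1))"
    by (intro summable_on_Un_disjoint) auto
  moreover have "S1 \<union> (S - S1) = S" by (auto simp: S1_def)
  ultimately show ?thesis by (simp add: N_def)
qed

section \<open>The sawtooth away from the integers\<close>

lemma abs_sawtooth_le: "\<bar>sawtooth x\<bar> \<le> 1 / 2"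
proof -
  have "\<bar>x - of_int \<lfloor>x\<rfloor> - 1 / 2\<bar> \<le> 1 / 2" by linarith
  then show ?thesis by (simp add: sawtooth_def)
qed

lemma ex_int_gap:
  fixes y :: real
  assumes "y \<notin> \<int>"
  shows "\<exists>e>0. \<forall>p::int. e \<le> \<bar>y - p\<bar>"
proof -
  have f: "\<lfloor>y\<rfloor> < y" "y < \<lfloor>y\<rfloor> + 1"
    using assms by (metis Ints_of_int antisym_conv2 of_int_floor_le, linarith)
  let ?e = "min (y - \<lfloor>y\<rfloor>) (\<lfloor>y\<rfloor> + 1 - y)"
  have "?e \<le> \<bar>y - p\<bar>" for p :: int
  proof (cases "p \<le> \<lfloor>y\<rfloor>")
    case True
    then have "real_of_int p \<le> \<lfloor>y\<rfloor>" by simp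
    then show ?thesis using f by linarith
  next
    case False
    then have "\<lfloor>y\<rfloor> + 1 \<le> real_of_int p" by linarith
    then show ?thesis using f by linarith
  qed
  moreover have "0 < ?e" using f by simp
  ultimately show ?thesis by blast
qed

text \<open>The quotient of \<open>real_vec n \<bullet> x - of_int p\<close> by
  \<open>vnorm n\<close> is, up to sign, the distance from \<open>x\<close> to a hyperplane.
  Finitely many normals leave a common positive distance \<open>d\<close>.\<close>

lemma ex_uniform_gap:
  assumes fin: "finite F" and off: "\<And>n. n \<in> F \<Longrightarrow> real_vec n \<bullet> x \<notin> \<int>"
  obtains d where "0 < d"
    "\<And>n p. n \<in> F \<Longrightarrow> vnorm n * d \<le> \<bar>real_vec n \<bullet> x - of_int p\<bar>"
proof -
  have "\<exists>e>0. \<forall>p::int. e \<le> \<bar>real_vec n \<bullet> x - p\<bar>" if "n \<in> F" for n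
    using off[OF that] by (rule ex_int_gap)
  then obtain e where e: "\<And>n. n \<in> F \<Longrightarrow> 0 < e n"
    "\<And>n p. n \<in> F \<Longrightarrow> e n \<le> \<bar>real_vec n \<bullet> x - of_int p\<bar>" by metis
  have N: "0 < vnorm n" if "n \<in> F" for n using off[OF that] by auto
  define d where "d = Min (insert 1 ((\<lambda>n. e n / vnorm n) ` F))"
  show ?thesis
  proof (rule that[of d])
    show "0 < d" unfolding d_def using fin e(1) N by (subst Min_gr_iff) auto
    fix n p assume n: "n \<in> F"
    have "d \<le> e n / vnorm n" unfolding d_def using fin n by (intro Min_le) auto
    then have "vnorm n * d \<le> e n" using N[OF n] by (simp add: field_simps)
    then show "vnorm n * d \<le> \<bar>real_vec n \<bullet> x - of_int p\<bar>" using e(2)[OF n, of p] by linarith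
  qed
qed

text \<open>No integer is as close to \<open>u\<close> as \<open>v\<close> is, so the segment
  between them crosses no jump and the sawtooth has slope one along it.\<close>

lemma sawtooth_diff_eq:
  fixes u v :: real
  assumes "\<And>p::int. \<bar>v - u\<bar> < \<bar>u - p\<bar>"
  shows "sawtooth v - sawtooth u = v - u"
proof -
  have fu: "\<lfloor>u\<rfloor> < u" "u < \<lfloor>u\<rfloor> + 1"
    using assms[of "\<lfloor>u\<rfloor>"] by linarith+
  have v: "\<lfloor>u\<rfloor> < v" "v < \<lfloor>u\<rfloor> + 1"
    using assms[of "\<lfloor>u\<rfloor>"] assms[of "\<lfloor>u\<rfloor> + 1"] fu by auto
  then have fl: "\<lfloor>v\<rfloor> = \<lfloor>u\<rfloor>" by linarith
  have "u \<notin> \<int>" "v \<notin> \<int>" using fu v fl by (auto elim!: Ints_cases)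
  then have "sawtooth u = u - \<lfloor>u\<rfloor> - 1 / 2" "sawtooth v = v - \<lfloor>u\<rfloor> - 1 / 2"
    by (simp_all add: sawtooth_def fl)
  then show ?thesis by linarith
qed

section \<open>Constant and affine Taylor polynomials\<close>

lemma poly_degree_less_const: "0 < \<alpha> \<Longrightarrow> poly_degree_less \<alpha> (\<lambda>_. b)"
  unfolding poly_degree_less_def by (intro exI[of _ "{\<lambda>_. 0}"] exI[of _ "\<lambda>_. b"]) auto

lemma poly_degree_less_affine:
  fixes v :: "real ^ 'n"
  assumes "1 < \<alpha>"
  shows "poly_degree_less \<alpha> (\<lambda>x. b + v \<bullet> x)"
proof -
  define e where "e i = (\<lambda>j. if j = i then 1 else 0 :: nat)" for i :: 'n
  \<comment> \<open>Coefficients are indexed by multi-indices, so the entries of \<open>v\<close>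
    are read back through the injection \<open>e\<close> of the coordinates into the unit
    multi-indices.\<close>
  define c where "c k = (if k = (\<lambda>_. 0) then b else v $ (THE i. k = e i))" for k :: "'n \<Rightarrow> nat"
  have e0: "e i \<noteq> (\<lambda>_. 0)" for i by (metis e_def zero_neq_one)
  have inj: "inj e" by (rule injI) (metis e_def zero_neq_one)
  have ce: "c (e i) = v $ i" for i
  proof -
    have "(THE i'. e i = e i') = i" using inj by (auto simp: inj_eq)
    then show ?thesis using e0 by (simp add: c_def)
  qed
  have pe: "(\<Prod>j\<in>UNIV. (x $ j) ^ e i j) = x $ i" for x :: "real ^ 'n" and i
  proof -
    have "(\<Prod>j\<in>UNIV. (x $ j) ^ e i j) = (\<Prod>j\<in>UNIV. if j = i then x $ j else 1)"
      by (intro prod.cong) (auto simp: e_def)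
    then show ?thesis by simp
  qed
  have "(\<lambda>x. b + v \<bullet> x) = (\<lambda>x. \<Sum>k\<in>insert (\<lambda>_. 0) (range e). c k * (\<Prod>i\<in>UNIV. (x $ i) ^ k i))"
  proof
    fix x :: "real ^ 'n"
    have "(\<Sum>k\<in>insert (\<lambda>_. 0) (range e). c k * (\<Prod>i\<in>UNIV. (x $ i) ^ k i)) =
        b + (\<Sum>k\<in>range e. c k * (\<Prod>i\<in>UNIV. (x $ i) ^ k i))"
      using e0[symmetric] by (subst sum.insert) (auto simp: c_def)
    also have "(\<Sum>k\<in>range e. c k * (\<Prod>i\<in>UNIV. (x $ i) ^ k i)) = v \<bullet> x"
      by (subst sum.reindex[OF inj]) (simp add: ce pe inner_vec_def)
    finally show "b + v \<bullet> x = (\<Sum>k\<in>insert (\<lambda>_. 0) (range e). c k * (\<Prod>i\<in>UNIV. (x $ i) ^ k i))" by simp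
  qed
  moreover have "\<forall>k\<in>insert (\<lambda>_. 0) (range e). real (\<Sum>i\<in>UNIV. k i) < \<alpha>"
  proof -
    have "(\<Sum>j\<in>UNIV. e i j) = 1" for i by (simp add: e_def)
    then show ?thesis using assms by (auto simp del: of_nat_sum)
  qed
  ultimately show ?thesis unfolding poly_degree_less_def by (intro exI conjI) auto
qed

lemma summable_davenport:
  assumes "(\<lambda>n. \<bar>a n\<bar>) summable_on UNIV"
  shows "(\<lambda>n. a n * sawtooth (real_vec n \<bullet> x)) summable_on A"
proof (rule abs_summable_summable, rule summable_on_comparison_test)
  show "(\<lambda>n. \<bar>a n\<bar>) summable_on A" using assms by (rule summable_on_subset_banach) simp
  show "norm (a n * sawtooth (real_vec n \<bullet> x)) \<le> \<bar>a n\<bar>" for n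
    using abs_sawtooth_le[of "real_vec n \<bullet> x"] by (simp add: abs_mult mult_left_le)
qed auto

lemma davenport_series_supp:
  "davenport_series a x = (\<Sum>\<^sub>\<infinity>n\<in>supp a - {0}. a n * sawtooth (real_vec n \<bullet> x))"
  unfolding davenport_series_def by (rule infsum_cong_neutral) (auto simp: supp_def)

text \<open>Each term of the series minus its linear part is \<open>O(|y - x|\<^sup>\<alpha> |n|\<^sup>-\<^sup>\<kappa>)\<close> with a positive
  \<open>\<kappa>\<close>, which is summable over a sparse support.\<close>

lemma holder_exponent_ge:
  fixes a :: "int ^ 'n \<Rightarrow> real"
  assumes sm: "(\<lambda>n. \<bar>a n\<bar>) summable_on UNIV" and sp: "sparse_int_set (supp a)"
    and K: "0 < K" and decay: "\<And>n. n \<in> supp a \<Longrightarrow> \<bar>a n\<bar> \<le> K * vnorm n powr - g"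
    and \<alpha>: "0 < \<alpha>" "\<alpha> < B" "\<alpha> < g"
    and off: "\<And>n. n \<in> supp a \<Longrightarrow> n \<noteq> 0 \<Longrightarrow> real_vec n \<bullet> x \<notin> \<int>"
    and far: "\<And>n p. n \<in> supp a \<Longrightarrow> R0 \<le> vnorm n \<Longrightarrow>
       vnorm n * \<bar>a n\<bar> powr (1 / B) < \<bar>real_vec n \<bullet> x - of_int p\<bar>"
  shows "ereal \<alpha> \<le> holder_exponent (davenport_series a) x"
proof -
  define S where "S = supp a - {0}"
  define N where "N n = vnorm n" for n :: "int ^ 'n"
  have N1: "1 \<le> N n" if "n \<in> S" for n using that norm_real_vec_ge_1 by (auto simp: S_def N_def)
  have smN: "(\<lambda>n. N n powr - k) summable_on S" if "0 < k" for k
    using summable_on_subset_banach[OF summable_on_sparse[OF sp that], of S] by (auto simp: N_def S_def)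
  have dec: "\<bar>a n\<bar> \<le> K * N n powr - g" if "n \<in> S" for n
    using decay that by (auto simp: S_def N_def)
  have B: "0 < B" using \<alpha> by simp
  \<comment> \<open>The two decay rates that occur: \<open>g - \<alpha>\<close> when a term is
    bounded by \<open>(N n * r) powr \<alpha>\<close>, and \<open>g * (1 - \<alpha> / B)\<close>
    when its jump is crossed.\<close>
  define k where "k = min (g - \<alpha>) (g * (1 - \<alpha> / B))"
  have k: "0 < k" using \<alpha> by (simp add: k_def)
  \<comment> \<open>Switches the affine part on. Degree below \<alpha> permits it exactly for
    \<alpha> > 1, so at \<alpha> = 1 only a constant is subtracted.\<close>
  define b where "b = (if 1 < \<alpha> then 1 else 0 :: real)"
  have "finite {n \<in> S. N n < R0}"
    by (rule finite_subset[OF _ finite_norm_real_vec_le[of R0]]) (auto simp: N_def)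
  then obtain w where "0 < w"
    "\<And>n p. n \<in> {n \<in> S. N n < R0} \<Longrightarrow> N n * w \<le> \<bar>real_vec n \<bullet> x - of_int p\<bar>"
    unfolding N_def by (rule ex_uniform_gap) (use off in \<open>auto simp: S_def\<close>)
  then have w: "0 < w"
    "\<And>n p. n \<in> S \<Longrightarrow> N n < R0 \<Longrightarrow> N n * w \<le> \<bar>real_vec n \<bullet> x - of_int p\<bar>" by simp_all
  define K' where "K' = 2 * K powr (1 - \<alpha> / B) + K"
  have K': "0 < K'" using K by (simp add: K'_def add_nonneg_pos)
  define T where "T y n = sawtooth (real_vec n \<bullet> y) - sawtooth (real_vec n \<bullet> x) - b * (real_vec n \<bullet> (y - x))"
    for y n
  have term_le: "\<bar>a n * T y n\<bar> \<le> K' * norm (y - x) powr \<alpha> * N n powr - k"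
    if n: "n \<in> S" and y: "norm (y - x) < w" for y n
  proof -
    define r where "r = norm (y - x)"
    have r: "0 \<le> r" "r < w" using y by (auto simp: r_def)
    have Nn: "1 \<le> N n" by (rule N1[OF n])
    let ?d = "real_vec n \<bullet> (y - x)"
    have d: "\<bar>?d\<bar> \<le> N n * r" unfolding N_def r_def by (rule Cauchy_Schwarz_ineq2)
    have deq: "real_vec n \<bullet> y - real_vec n \<bullet> x = ?d" by (simp add: inner_diff_right)
    have sd: "\<bar>sawtooth (real_vec n \<bullet> y) - sawtooth (real_vec n \<bullet> x)\<bar> \<le> 1"
      using abs_sawtooth_le[of "real_vec n \<bullet> y"] abs_sawtooth_le[of "real_vec n \<bullet> x"] by linarith
    have small: "\<bar>a n\<bar> * (N n * r) powr \<alpha> \<le> K * r powr \<alpha> * N n powr - k"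
    proof -
      have "\<bar>a n\<bar> * (N n * r) powr \<alpha> \<le> K * N n powr - g * (N n * r) powr \<alpha>"
        using dec[OF n] by (intro mult_right_mono) auto
      also have "\<dots> = K * r powr \<alpha> * N n powr - (g - \<alpha>)"
        using r Nn by (simp add: powr_mult powr_diff powr_minus field_simps)
      also have "\<dots> \<le> K * r powr \<alpha> * N n powr - k"
        using K Nn by (intro mult_left_mono powr_mono) (auto simp: k_def)
      finally show ?thesis .
    qed
    \<comment> \<open>The cases ask whether the ball of radius \<open>r\<close> around
      \<open>x\<close> can reach a hyperplane with normal \<open>n\<close>. If not, the sawtooth is
      affine between \<open>x\<close> and \<open>y\<close>.\<close>
    show ?thesis
    proof (cases "\<exists>p::int. \<bar>real_vec n \<bullet> x - p\<bar> \<le> N n * r")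
      case False
      then have "sawtooth (real_vec n \<bullet> y) - sawtooth (real_vec n \<bullet> x) = ?d"
        using sawtooth_diff_eq[of "real_vec n \<bullet> y" "real_vec n \<bullet> x"] d
        by (simp add: deq not_le) (meson le_less_trans)
      then have Teq: "T y n = (1 - b) * ?d" and d1: "\<bar>?d\<bar> \<le> 1"
        using sd by (auto simp: T_def algebra_simps)
      have "\<bar>T y n\<bar> \<le> (N n * r) powr \<alpha>"
      proof (cases "1 < \<alpha>")
        case True
        then show ?thesis by (simp add: Teq b_def)
      next
        case False
        have "\<bar>?d\<bar> \<le> (N n * r) powr \<alpha>"
        proof (cases "N n * r \<le> 1")
          case True
          have "N n * r \<le> (N n * r) powr \<alpha>"
            using True False r Nn powr_mono'[of \<alpha> 1 "N n * r"] by simp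
          then show ?thesis using d by linarith
        next
          case False
          then have "1 \<le> (N n * r) powr \<alpha>" using \<alpha> by (intro ge_one_powr_ge_zero) auto
          then show ?thesis using d1 by linarith
        qed
        then show ?thesis using False by (simp add: Teq b_def)
      qed
      then have "\<bar>a n * T y n\<bar> \<le> \<bar>a n\<bar> * (N n * r) powr \<alpha>"
        by (simp add: abs_mult mult_left_mono)
      also note small
      also have "K * r powr \<alpha> * N n powr - k \<le> K' * r powr \<alpha> * N n powr - k"
        unfolding K'_def by (intro mult_right_mono) auto
      finally show ?thesis by (simp add: r_def)
    next
      case True
      then obtain p :: int where p: "\<bar>real_vec n \<bullet> x - p\<bar> \<le> N n * r" by blast
      \<comment> \<open>Short normals keep distance \<open>w\<close> from \<open>x\<close>, so a
        crossing within \<open>r < w\<close> involves a long normal, to which \<open>far\<close>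
        applies.\<close>
      have R: "R0 \<le> N n"
      proof (rule ccontr)
        assume "\<not> R0 \<le> N n"
        then have "N n * w \<le> N n * r" using w(2)[OF n, of p] p by linarith
        then show False using r Nn by simp
      qed
      have "N n * \<bar>a n\<bar> powr (1 / B) < N n * r" 
        using less_le_trans[OF far[of n p, folded N_def] p] n R by (simp add: S_def)
      then have ar: "\<bar>a n\<bar> powr (1 / B) < r" using Nn by simp
      \<comment> \<open>Interpolation: the share \<alpha> / B of the exponent turns
        \<open>\<bar>a n\<bar> powr (1 / B) < r\<close> into the factor
        \<open>r powr \<alpha>\<close>, and the rest supplies decay in \<open>N n\<close>.\<close>
      have a1: "\<bar>a n\<bar> \<le> K powr (1 - \<alpha> / B) * r powr \<alpha> * N n powr - k"
      proof -
        have q: "0 \<le> 1 - \<alpha> / B" using \<alpha> B by simp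
        have "\<bar>a n\<bar> = \<bar>a n\<bar> powr (\<alpha> / B) * \<bar>a n\<bar> powr (1 - \<alpha> / B)"
          by (simp flip: powr_add)
        also have "\<bar>a n\<bar> powr (\<alpha> / B) = (\<bar>a n\<bar> powr (1 / B)) powr \<alpha>"
          by (simp add: powr_powr)
        also have "\<dots> * \<bar>a n\<bar> powr (1 - \<alpha> / B) \<le> r powr \<alpha> * (K * N n powr - g) powr (1 - \<alpha> / B)"
          using ar \<alpha> q dec[OF n] by (intro mult_mono powr_mono2) auto
        also have "\<dots> = K powr (1 - \<alpha> / B) * r powr \<alpha> * N n powr - (g * (1 - \<alpha> / B))"
          using K by (simp add: powr_mult powr_powr mult_ac)
        also have "\<dots> \<le> K powr (1 - \<alpha> / B) * r powr \<alpha> * N n powr - k"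
          using Nn by (intro mult_left_mono powr_mono) (auto simp: k_def)
        finally show ?thesis .
      qed
      have "\<bar>T y n\<bar> \<le> 2 + (N n * r) powr \<alpha>"
      proof (cases "1 < \<alpha>")
        case True
        have "N n * r \<le> 1 + (N n * r) powr \<alpha>"
        proof (cases "N n * r \<le> 1")
          case True
          then show ?thesis by (smt (verit) powr_ge_zero)
        next
          case False
          then have "(N n * r) powr 1 \<le> (N n * r) powr \<alpha>"
            using \<open>1 < \<alpha>\<close> by (intro powr_mono) auto
          then show ?thesis using False by simp
        qed
        then show ?thesis using sd d True by (simp add: T_def b_def)
      next
        case False
        then show ?thesis using sd by (simp add: T_def b_def) (smt (verit) powr_ge_zero)
      qed
      then have "\<bar>a n * T y n\<bar> \<le> \<bar>a n\<bar> * (2 + (N n * r) powr \<alpha>)"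
        by (simp add: abs_mult mult_left_mono)
      also have "\<dots> = 2 * \<bar>a n\<bar> + \<bar>a n\<bar> * (N n * r) powr \<alpha>"
        by (simp add: algebra_simps)
      also have "\<dots> \<le> 2 * (K powr (1 - \<alpha> / B) * r powr \<alpha> * N n powr - k) + K * r powr \<alpha> * N n powr - k"
        using a1 small by linarith
      also have "\<dots> = K' * r powr \<alpha> * N n powr - k" by (simp add: K'_def algebra_simps)
      finally show ?thesis by (simp add: r_def)
    qed
  qed
  \<comment> \<open>The formal gradient. It is needed for \<alpha> > 1 only, and then
    \<open>g > 1\<close> makes the series converge.\<close>
  obtain v :: "real ^ 'n" where v: "b \<noteq> 0 \<Longrightarrow> ((\<lambda>n. a n *\<^sub>R real_vec n) has_sum v) S"
  proof (cases "1 < \<alpha>")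
    case True
    have sK: "(\<lambda>n. K * N n powr - (g - 1)) summable_on S"
      using True \<alpha> by (intro summable_on_cmult_right smN) auto
    have le: "norm (a n *\<^sub>R real_vec n) \<le> K * N n powr - (g - 1)" if "n \<in> S" for n
    proof -
      have "norm (a n *\<^sub>R real_vec n) = \<bar>a n\<bar> * N n" by (simp add: N_def)
      also have "\<dots> \<le> K * N n powr - g * N n"
        using dec[OF that] N1[OF that] by (intro mult_right_mono) auto
      also have "\<dots> = K * N n powr - (g - 1)"
        using N1[OF that] powr_add[of "N n" "- g" 1] by (simp add: algebra_simps)
      finally show ?thesis .
    qed
    have "(\<lambda>n. a n *\<^sub>R real_vec n) summable_on S"
      by (rule abs_summable_summable, rule summable_on_comparison_test[OF sK le norm_ge_zero])
    then show ?thesis by (intro that[of "infsum (\<lambda>n. a n *\<^sub>R real_vec n) S"] has_sum_infsum)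
  next
    case False
    then show ?thesis using that by (simp add: b_def)
  qed
  let ?f = "davenport_series a"
  define \<Sigma> where "\<Sigma> = infsum (\<lambda>n. N n powr - k) S"
  have main: "\<bar>?f y - (?f x + b * (v \<bullet> (y - x)))\<bar> \<le> (K' * \<Sigma> + 1) * norm (y - x) powr \<alpha>"
    if y: "norm (y - x) < w" for y
  proof -
    have f: "((\<lambda>n. a n * sawtooth (real_vec n \<bullet> z)) has_sum ?f z) S" for z
      unfolding davenport_series_supp S_def by (rule has_sum_infsum[OF summable_davenport[OF sm]])
    have L: "((\<lambda>n. b * (a n * (real_vec n \<bullet> (y - x)))) has_sum b * (v \<bullet> (y - x))) S"
    proof (cases "b = 0")
      case False
      from has_sum_bounded_linear[OF bounded_linear_inner_left v[OF False], of "y - x"]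
      show ?thesis by (intro has_sum_cmult_right) (simp add: o_def)
    qed simp
    have "((\<lambda>n. a n * sawtooth (real_vec n \<bullet> y) + - (a n * sawtooth (real_vec n \<bullet> x)) +
          - (b * (a n * (real_vec n \<bullet> (y - x)))))
        has_sum ?f y + - ?f x + - (b * (v \<bullet> (y - x)))) S"
      by (intro has_sum_add f has_sum_uminus[THEN iffD2]) (simp_all add: f L)
    moreover have "(\<lambda>n. a n * sawtooth (real_vec n \<bullet> y) + - (a n * sawtooth (real_vec n \<bullet> x)) +
          - (b * (a n * (real_vec n \<bullet> (y - x))))) = (\<lambda>n. a n * T y n)"
      by (auto simp: T_def algebra_simps)
    ultimately have hs: "((\<lambda>n. a n * T y n) has_sum ?f y - ?f x - b * (v \<bullet> (y - x))) S"
      by simp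
    have sb: "((\<lambda>n. K' * norm (y - x) powr \<alpha> * N n powr - k) has_sum K' * norm (y - x) powr \<alpha> * \<Sigma>) S"
      unfolding \<Sigma>_def by (intro has_sum_cmult_right has_sum_infsum smN k)
    have "norm (?f y - ?f x - b * (v \<bullet> (y - x))) \<le> K' * norm (y - x) powr \<alpha> * \<Sigma>"
      by (rule norm_infsum_le[OF hs sb]) (use term_le y in auto)
    also have "\<dots> \<le> (K' * \<Sigma> + 1) * norm (y - x) powr \<alpha>" by (simp add: algebra_simps)
    finally show ?thesis by (simp add: algebra_simps)
  qed
  have "poly_degree_less \<alpha> (\<lambda>y. ?f x + b * (v \<bullet> (y - x)))"
  proof (cases "1 < \<alpha>")
    case True
    have "(\<lambda>y. ?f x + b * (v \<bullet> (y - x))) = (\<lambda>y. (?f x - v \<bullet> x) + v \<bullet> y)"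
      using True by (auto simp: b_def inner_diff_right)
    then show ?thesis using poly_degree_less_affine[OF True] by simp
  next
    case False
    then show ?thesis using poly_degree_less_const[OF \<alpha>(1)] by (simp add: b_def)
  qed
  moreover have "\<forall>\<^sub>F y in nhds x. \<bar>?f y - (?f x + b * (v \<bullet> (y - x)))\<bar> \<le> (K' * \<Sigma> + 1) * rpow (norm (y - x)) \<alpha>"
    unfolding eventually_nhds_metric using w(1) main \<alpha>(1)
    by (intro exI[of _ w]) (auto simp: rpow_def dist_norm)
  moreover have "0 < K' * \<Sigma> + 1"
    using K' infsum_nonneg[of S "\<lambda>n. N n powr - k"] by (simp add: \<Sigma>_def add_nonneg_pos)
  ultimately have "ereal \<alpha> \<in> {ereal \<alpha> | \<alpha>. 0 \<le> \<alpha> \<and> (\<exists>C>0. \<exists>P. poly_degree_less \<alpha> P \<and>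
        (\<forall>\<^sub>F y in nhds x. \<bar>?f y - P y\<bar> \<le> C * rpow (norm (y - x)) \<alpha>))}"
    using less_imp_le[OF \<alpha>(1)] by blast
  then show ?thesis unfolding holder_exponent_def by (rule Sup_upper)
qed

text \<open>The layers of \<open>n\<close> cost at most a constant times
  \<open>N * \<bar>a n\<bar> powr (b / B)\<close> with \<open>b = t - (d - 1)\<close>, hence
  \<open>N powr (1 - g b / B)\<close>. The exponent is negative because \<open>b > B / g\<close>,
  and over a sparse support any negative exponent gives a convergent sum.\<close>

lemma hcontent_well_approximable_eq_0:
  fixes a :: "int ^ 'n \<Rightarrow> real"
  assumes sp: "sparse_int_set (supp a)"
    and K: "0 < K" and decay: "\<And>n. n \<in> supp a \<Longrightarrow> \<bar>a n\<bar> \<le> K * vnorm n powr - g"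
    and g: "0 < g" "0 < B" and t: "real CARD('n) - 1 + B / g < t"
  shows "hcontent t {x. \<forall>R. \<exists>n\<in>supp a. R \<le> vnorm n \<and>
    (\<exists>p::int. \<bar>real_vec n \<bullet> x - p\<bar> \<le> vnorm n * \<bar>a n\<bar> powr (1 / B))} = 0"
    (is "hcontent t ?E = 0")
proof (rule hcontent_eq_0_if_cubes)
  fix R :: real assume R: "1 \<le> R"
  define N where "N n = vnorm n" for n :: "int ^ 'n"
  let ?d = "real CARD('n)"
  define b where "b = t - (?d - 1)"
  have b: "B / g < b" using t by (simp add: b_def)
  have b0: "0 < b" using b g by (smt (verit) divide_pos_pos)
  have t0: "0 \<le> t" using b0 card_ge_1[where 'a='n] unfolding b_def by linarith
  define k where "k = g * (b / B) - 1"
  have k: "0 < k" using b g by (simp add: k_def field_simps)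
  define I where "I = {n \<in> supp a. 1 \<le> N n \<and> \<bar>a n\<bar> \<le> 1}"
  define C where "C = 7 * ?d * R * (5 * R) ^ (CARD('n) - 1) * (6 * ?d ^ 2) powr t"
  have C: "0 \<le> C" using R by (simp add: C_def)
  define A where "A n = {x \<in> cube 0 R. \<exists>p::int. \<bar>real_vec n \<bullet> x - p\<bar> \<le> vnorm n * \<bar>a n\<bar> powr (1 / B)}" for n
  show "hcontent t (?E \<inter> cube 0 R) = 0"
  proof (rule hcontent_limsup_eq_0[where I = I and A = A])
    show "(\<lambda>n. C * K powr (b / B) * N n powr - k) summable_on I"
      using summable_on_sparse[OF sp k] unfolding N_def
      by (intro summable_on_cmult_right) (rule summable_on_subset_banach, auto simp: I_def)
    show "0 \<le> C * K powr (b / B) * N n powr - k" for n using C by simp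
    fix n assume n: "n \<in> I"
    have a0: "0 < \<bar>a n\<bar>" using n by (auto simp: I_def supp_def)
    have "hcontent t (A n) \<le> ennreal (vnorm n * C * (\<bar>a n\<bar> powr (1 / B)) powr (t - (?d - 1)))"
      unfolding A_def C_def
      by (rule hcontent_layers_le) (use n R t0 a0 g in \<open>auto simp: I_def N_def powr_le1\<close>)
    also have "\<dots> \<le> ennreal (C * K powr (b / B) * N n powr - k)"
    proof (rule ennreal_leI)
      have N1: "1 \<le> N n" using n by (simp add: I_def)
      have "(\<bar>a n\<bar> powr (1 / B)) powr (t - (?d - 1)) = \<bar>a n\<bar> powr (b / B)"
        by (simp add: powr_powr b_def)
      also have "\<dots> \<le> (K * N n powr - g) powr (b / B)"
        using decay[of n] n b0 g by (intro powr_mono2) (auto simp: I_def N_def)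
      also have "\<dots> = K powr (b / B) * N n powr - (g * (b / B))"
        using K by (simp add: powr_mult powr_powr)
      finally have "vnorm n * C * (\<bar>a n\<bar> powr (1 / B)) powr (t - (?d - 1)) \<le>
          vnorm n * C * (K powr (b / B) * N n powr - (g * (b / B)))"
        using C by (intro mult_left_mono) auto
      also have "\<dots> = C * K powr (b / B) * (N n powr - (g * (b / B)) * N n)" by (simp add: N_def)
      also have "N n powr - (g * (b / B)) * N n = N n powr - k"
        using N1 powr_add[of "N n" "- (g * (b / B))" 1] by (simp add: k_def)
      finally show "vnorm n * C * (\<bar>a n\<bar> powr (1 / B)) powr (t - (?d - 1)) \<le>
          C * K powr (b / B) * N n powr - k" .
    qed
    finally show "hcontent t (A n) \<le> ennreal (C * K powr (b / B) * N n powr - k)" .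
  next
    fix F assume F: "finite F" "F \<subseteq> I"
    \<comment> \<open>A vector at least this long is outside \<open>F\<close>, and its decay bound
      is at most one because its norm is at least \<open>K powr (1 / g)\<close>; hence it belongs to
      \<open>I\<close>.\<close>
    define R1 where "R1 = Max (insert (max 1 (K powr (1 / g))) (N ` F)) + 1"
    show "?E \<inter> cube 0 R \<subseteq> (\<Union>n\<in>I - F. A n)"
    proof
      fix x assume x: "x \<in> ?E \<inter> cube 0 R"
      then obtain n where n: "n \<in> supp a" "R1 \<le> N n"
        "\<exists>p::int. \<bar>real_vec n \<bullet> x - p\<bar> \<le> vnorm n * \<bar>a n\<bar> powr (1 / B)"
        unfolding N_def by blast
      have ge: "z + 1 \<le> N n" if "z \<in> insert (max 1 (K powr (1 / g))) (N ` F)" for z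
        using n(2) Max_ge[OF _ that] F(1) unfolding R1_def by force
      have "n \<notin> F" using ge[of "N n"] by auto
      have N1: "1 \<le> N n" "K powr (1 / g) \<le> N n" using ge[of "max 1 (K powr (1 / g))"] by auto
      have "\<bar>a n\<bar> \<le> K * N n powr - g" using decay[OF n(1)] by (simp add: N_def)
      also have "\<dots> \<le> K * (K powr (1 / g)) powr - g"
        using K g N1 by (intro mult_left_mono powr_mono2') auto
      also have "\<dots> = 1" using K g by (simp add: powr_powr powr_minus)
      finally have "n \<in> I" using n N1 by (simp add: I_def)
      then show "x \<in> (\<Union>n\<in>I - F. A n)" using \<open>n \<notin> F\<close> n(3) x by (auto simp: A_def)
    qed
  qed
qed

section \<open>Jumps of Davenport series\<close>

lemma real_vec_scale: "real_vec (l *s q) = of_int l *\<^sub>R real_vec q"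
  by (simp add: vec_eq_iff)

lemma real_vec_eq_iff: "real_vec m = real_vec n \<longleftrightarrow> m = n"
  by (simp add: vec_eq_iff)

text \<open>The denominator of \<open>u\<close> in lowest terms divides \<open>p\<close> and every
  entry of \<open>q\<close>, hence their gcd, which is one. So a real multiple of a reduced
  hyperplane with integer data is an integer multiple.\<close>

lemma int_of_reduced_multiples:
  fixes q n :: "int ^ 'n" and p :: int
  assumes q: "q \<noteq> 0" and gcd: "Gcd (insert p (range (($) q))) = 1"
    and n: "real_vec n = u *\<^sub>R real_vec q" and up: "u * of_int p \<in> \<int>"
  obtains l where "n = l *s q"
proof -
  obtain i where i: "q $ i \<noteq> 0" using q by (auto simp: vec_eq_iff)
  have comp: "of_int (n $ j) = u * of_int (q $ j)" for j
    using arg_cong[OF n, of "\<lambda>v. v $ j"] by simp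
  have "u = of_int (n $ i) / of_int (q $ i)" using comp[of i] i by simp
  then have "u \<in> \<rat>" by simp
  then obtain s t where st: "t > 0" "coprime s t" "u = of_int s / of_int t" by (elim Rats_cases')
  have dvd: "t dvd m" if "u * of_int m \<in> \<int>" for m
  proof -
    from that obtain k where "u * of_int m = of_int k" by (auto elim: Ints_cases)
    then have "real_of_int (s * m) = real_of_int (k * t)" using st by (simp add: field_simps)
    then have "s * m = k * t" by (simp only: of_int_eq_iff)
    then have "t dvd s * m" by simp
    then show ?thesis using st(2) by (simp add: coprime_commute coprime_dvd_mult_right_iff)
  qed
  have "t dvd Gcd (insert p (range (($) q)))"
  proof (rule Gcd_greatest)
    fix b assume "b \<in> insert p (range (($) q))"
    then show "t dvd b" using dvd up comp by (metis Ints_of_int image_iff insert_iff)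
  qed
  then have "t dvd 1" unfolding gcd .
  then have "t = 1" using st(1) by simp
  then have "real_vec n = real_vec (s *s q)" using n st(3) by (simp add: real_vec_scale)
  then have "n = s *s q" by (simp only: real_vec_eq_iff)
  then show ?thesis by (rule that)
qed

section \<open>Symmetric differences of the sawtooth\<close>

lemma sawtooth_add_int: "sawtooth (x + of_int k) = sawtooth x"
  by (simp add: sawtooth_def)

lemma sawtooth_small:
  assumes "0 < e" "e < 1"
  shows "sawtooth e = e - 1 / 2" "sawtooth (- e) = 1 / 2 - e"
proof -
  have "\<lfloor>e\<rfloor> = 0" "\<lfloor>- e\<rfloor> = -1" using assms by linarith+
  moreover have "e \<notin> \<int>" "- e \<notin> \<int>" using assms calculation by (auto elim!: Ints_cases)
  ultimately show "sawtooth e = e - 1 / 2" "sawtooth (- e) = 1 / 2 - e" by (simp_all add: sawtooth_def)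
qed

lemma sawtooth_jump_int:
  assumes "u \<in> \<int>" "c \<noteq> 0"
  shows "((\<lambda>t. sawtooth (u + t * c) - sawtooth (u - t * c)) \<longlongrightarrow> - sgn c) (at_right 0)"
proof -
  obtain k where k: "u = of_int k" using assms(1) by (auto elim: Ints_cases)
  have ev: "\<forall>\<^sub>F t in at_right 0. sgn c * (2 * (t * \<bar>c\<bar>) - 1) = sawtooth (u + t * c) - sawtooth (u - t * c)"
    unfolding eventually_at_right_field
  proof (intro exI[of _ "1 / \<bar>c\<bar>"] conjI allI impI)
    fix t :: real assume "0 < t" "t < 1 / \<bar>c\<bar>"
    then have e: "0 < t * \<bar>c\<bar>" "t * \<bar>c\<bar> < 1" using assms(2) by (auto simp: field_simps)
    have "sawtooth (u + t * c) = sawtooth (t * c)" "sawtooth (u - t * c) = sawtooth (- (t * c))"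
      using sawtooth_add_int[of "t * c" k] sawtooth_add_int[of "- (t * c)" k] by (simp_all add: k algebra_simps)
    then show "sgn c * (2 * (t * \<bar>c\<bar>) - 1) = sawtooth (u + t * c) - sawtooth (u - t * c)"
      using sawtooth_small[OF e] assms(2) by (cases "c > 0") (simp_all add: sgn_if)
  qed (use assms in auto)
  have "((\<lambda>t. sgn c * (2 * (t * \<bar>c\<bar>) - 1)) \<longlongrightarrow> sgn c * (2 * (0 * \<bar>c\<bar>) - 1)) (at_right 0)"
    by (intro tendsto_intros)
  then have "((\<lambda>t. sgn c * (2 * (t * \<bar>c\<bar>) - 1)) \<longlongrightarrow> - sgn c) (at_right 0)"
    by simp
  then show ?thesis by (rule Lim_transform_eventually[OF _ ev])
qed

lemma isCont_sawtooth:
  assumes "u \<notin> \<int>"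
  shows "isCont sawtooth u"
proof -
  obtain e where e: "0 < e" "\<And>p::int. e \<le> \<bar>u - p\<bar>" using ex_int_gap[OF assms] by blast
  have "\<forall>\<^sub>F v in nhds u. sawtooth u + (v - u) = sawtooth v"
    unfolding eventually_nhds_metric
  proof (intro exI[of _ e] conjI allI impI)
    fix v assume "dist v u < e"
    then have "\<bar>v - u\<bar> < \<bar>u - p\<bar>" for p :: int using e(2)[of p] by (simp add: dist_real_def)
    then show "sawtooth u + (v - u) = sawtooth v" using sawtooth_diff_eq[of v u] by simp
  qed (rule e(1))
  moreover have "isCont (\<lambda>v. sawtooth u + (v - u)) u" by (intro continuous_intros)
  ultimately show ?thesis
    using isCont_cong[of "\<lambda>v. sawtooth u + (v - u)" sawtooth u] by simp
qed

lemma sawtooth_jump_nonint: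
  assumes "u \<notin> \<int>"
  shows "((\<lambda>t. sawtooth (u + t * c) - sawtooth (u - t * c)) \<longlongrightarrow> 0) (at_right 0)"
proof -
  have "((\<lambda>t. u + t * c) \<longlongrightarrow> u + 0 * c) (at_right 0)" "((\<lambda>t. u - t * c) \<longlongrightarrow> u - 0 * c) (at_right 0)"
    by (intro tendsto_intros)+
  then have "((\<lambda>t. sawtooth (u + t * c)) \<longlongrightarrow> sawtooth u) (at_right 0)"
    "((\<lambda>t. sawtooth (u - t * c)) \<longlongrightarrow> sawtooth u) (at_right 0)"
    using isCont_tendsto_compose[OF isCont_sawtooth[OF assms]] by auto
  from tendsto_diff[OF this] show ?thesis by simp
qed

text \<open>A majorant independent of the parameter makes the partial sums converge uniformly by the
  Weierstrass test, so the limit may be taken term by term.\<close>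

lemma tendsto_infsum_dominated:
  fixes F :: "real \<Rightarrow> 'i \<Rightarrow> real"
  assumes lim: "\<And>n. n \<in> A \<Longrightarrow> ((\<lambda>t. F t n) \<longlongrightarrow> G n) \<F>"
    and bd: "\<And>t n. n \<in> A \<Longrightarrow> \<bar>F t n\<bar> \<le> b n" and bG: "\<And>n. n \<in> A \<Longrightarrow> \<bar>G n\<bar> \<le> b n"
    and sm: "b summable_on A"
  shows "((\<lambda>t. infsum (F t) A) \<longlongrightarrow> infsum G A) \<F>"
proof (rule swap_uniform_limit'[where F = "finite_subsets_at_top A" and S = UNIV])
  show "uniform_limit UNIV (\<lambda>X t. \<Sum>n\<in>X. F t n) (\<lambda>t. infsum (F t) A) (finite_subsets_at_top A)"
    by (rule Weierstrass_m_test_general[OF _ sm]) (use bd in auto)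
  show "\<forall>\<^sub>F X in finite_subsets_at_top A. ((\<lambda>t. \<Sum>n\<in>X. F t n) \<longlongrightarrow> sum G X) \<F>"
    by (rule eventually_finite_subsets_at_top_weakI) (use lim in \<open>auto intro!: tendsto_sum\<close>)
  have "(\<lambda>n. norm (G n)) summable_on A"
    by (rule summable_on_comparison_test[OF sm]) (use bG in auto)
  from has_sum_infsum[OF abs_summable_summable[OF this]]
  show "(sum G \<longlongrightarrow> infsum G A) (finite_subsets_at_top A)" by (simp add: has_sum_def)
qed auto

text \<open>The coefficients and the sign are both odd, so \<open>l *s q\<close> and its negative
  contribute equally. This is the factor 2 in \<open>jump_seq\<close>; the minus sign reflects that
  the sawtooth drops by one at an integer.\<close>

lemma jump_seq_as_infsum:
  fixes a :: "int ^ 'n \<Rightarrow> real"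
  assumes odd: "odd_seq a" and sm: "(\<lambda>n. \<bar>a n\<bar>) summable_on UNIV" and q: "q \<noteq> 0"
  defines "M \<equiv> (\<lambda>l. l *s q) ` (UNIV - {0 :: int})"
  shows "(\<Sum>\<^sub>\<infinity>n\<in>M. a n * - sgn (real_vec n \<bullet> real_vec q)) = - jump_seq a q"
proof -
  have qq: "0 < real_vec q \<bullet> real_vec q" using q by (simp add: inner_gt_zero_iff)
  have sgn: "sgn (real_vec (l *s q) \<bullet> real_vec q) = of_int (sgn l)" for l :: int
    using qq by (simp add: real_vec_scale sgn_mult) (simp add: sgn_if)
  have inj: "inj_on (\<lambda>l::int. l *s q) A" for A
  proof (rule inj_onI)
    fix l m :: int assume "l *s q = m *s q"
    obtain i where "q $ i \<noteq> 0" using q by (auto simp: vec_eq_iff)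
    then show "l = m" using arg_cong[OF \<open>l *s q = m *s q\<close>, of "\<lambda>v. v $ i"] by simp
  qed
  have injn: "inj_on (\<lambda>l::nat. int l *s q) A" for A
    by (rule inj_onI) (use injD[OF inj[of UNIV]] in force)
  define P where "P = (\<lambda>l::nat. int l *s q) ` {1..}"
  define Q where "Q = (\<lambda>l::nat. - (int l *s q)) ` {1..}"
  have PQ: "M = P \<union> Q"
  proof -
    have "l *s q \<in> P \<union> Q" if "l \<noteq> 0" for l :: int
    proof (cases "l > 0")
      case True
      then have "l *s q = int (nat l) *s q" "nat l \<in> {1..}" by auto
      then show ?thesis unfolding P_def by blast
    next
      case False
      then have "l *s q = - (int (nat (- l)) *s q)" "nat (- l) \<in> {1..}" using that by (auto simp: vec_eq_iff)
      then show ?thesis unfolding Q_def by blast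
    qed
    moreover have "int l *s q \<in> M" "- (int l *s q) \<in> M" if "1 \<le> l" for l
    proof -
      show "int l *s q \<in> M" unfolding M_def using that by auto
      have "- (int l *s q) = (- int l) *s q" by (simp add: vec_eq_iff)
      then show "- (int l *s q) \<in> M" unfolding M_def using that by auto
    qed
    ultimately show ?thesis unfolding M_def P_def Q_def by auto
  qed
  have disj: "P \<inter> Q = {}"
  proof (rule ccontr)
    assume "P \<inter> Q \<noteq> {}"
    then obtain l m :: nat where "1 \<le> l" "1 \<le> m" "int l *s q = - (int m *s q)" by (auto simp: P_def Q_def)
    then have "int l *s q = (- int m) *s q" by (simp add: vec_eq_iff)
    then have "int l = - int m" using inj[of UNIV] by (auto dest: injD)
    then show False using \<open>1 \<le> l\<close> by simp
  qed
  let ?H = "\<lambda>n. a n * - sgn (real_vec n \<bullet> real_vec q)"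
  have smH: "?H summable_on A" for A
  proof (rule abs_summable_summable, rule summable_on_comparison_test)
    show "(\<lambda>n. \<bar>a n\<bar>) summable_on A" using sm by (rule summable_on_subset_banach) simp
    show "norm (?H n) \<le> \<bar>a n\<bar>" for n by (simp add: abs_mult abs_sgn_eq)
  qed auto
  define J where "J = (\<Sum>\<^sub>\<infinity>l\<in>{1::nat..}. a (int l *s q))"
  have "infsum ?H P = (\<Sum>\<^sub>\<infinity>l\<in>{1..}. ?H (int l *s q))"
    unfolding P_def by (subst infsum_reindex[OF injn]) (simp add: o_def)
  also have "\<dots> = (\<Sum>\<^sub>\<infinity>l\<in>{1..}. - a (int l *s q))"
    by (rule infsum_cong) (simp add: sgn)
  finally have 1: "infsum ?H P = - J" by (simp add: infsum_uminus J_def)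
  have "infsum ?H Q = (\<Sum>\<^sub>\<infinity>l\<in>{1..}. ?H (- (int l *s q)))"
  proof -
    have "inj_on (\<lambda>l::nat. - (int l *s q)) {1..}" using injn[of "{1..}"] by (auto simp: inj_on_def)
    then show ?thesis unfolding Q_def by (subst infsum_reindex) (auto simp: o_def)
  qed
  also have "\<dots> = (\<Sum>\<^sub>\<infinity>l\<in>{1..}. - a (int l *s q))"
  proof (rule infsum_cong)
    fix l :: nat assume l: "l \<in> {1..}"
    have "- (int l *s q) = (- int l) *s q" by (simp add: vec_eq_iff)
    then have "sgn (real_vec (- (int l *s q)) \<bullet> real_vec q) = -1" using sgn[of "- int l"] l by simp
    moreover have "a (- (int l *s q)) = - a (int l *s q)" using odd by (simp add: odd_seq_def)
    ultimately show "?H (- (int l *s q)) = - a (int l *s q)" by simp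
  qed
  finally have 2: "infsum ?H Q = - J" by (simp add: infsum_uminus J_def)
  have "infsum ?H M = infsum ?H P + infsum ?H Q"
    unfolding PQ by (rule infsum_Un_disjoint[OF smH smH disj])
  then show ?thesis using 1 2 by (simp add: jump_seq_def J_def)
qed

text \<open>By \<open>gen\<close>, at this point only the terms with \<open>n\<close> a nonzero
  multiple of \<open>q\<close> are discontinuous; each contributes its own jump and all other terms
  cancel in the limit.\<close>

lemma davenport_jump:
  fixes a :: "int ^ 'n \<Rightarrow> real"
  assumes odd: "odd_seq a" and sm: "(\<lambda>n. \<bar>a n\<bar>) summable_on UNIV" and q: "q \<noteq> 0"
    and x: "real_vec q \<bullet> x = of_int p"
    and gen: "\<And>n. real_vec n \<bullet> x \<in> \<int> \<Longrightarrow> \<exists>l. n = l *s q"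
  shows "((\<lambda>t. davenport_series a (x + t *\<^sub>R real_vec q) - davenport_series a (x - t *\<^sub>R real_vec q))
     \<longlongrightarrow> - jump_seq a q) (at_right 0)"
proof -
  define c where "c n = real_vec n \<bullet> real_vec q" for n
  define M where "M = (\<lambda>l. l *s q) ` (UNIV - {0 :: int})"
  define F where "F t n = a n * (sawtooth (real_vec n \<bullet> x + t * c n) - sawtooth (real_vec n \<bullet> x - t * c n))" for t n
  define G where "G n = (if n \<in> M then a n * - sgn (c n) else 0)" for n
  have qq: "0 < real_vec q \<bullet> real_vec q" using q by (simp add: inner_gt_zero_iff)
  have "((\<lambda>t. infsum (F t) (UNIV - {0})) \<longlongrightarrow> infsum G (UNIV - {0})) (at_right 0)"
  proof (rule tendsto_infsum_dominated)
    show "(\<lambda>n. \<bar>a n\<bar>) summable_on (UNIV - {0})" using sm by (rule summable_on_subset_banach) simp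
    show "\<bar>F t n\<bar> \<le> \<bar>a n\<bar>" for t n
    proof -
      have "\<bar>sawtooth (real_vec n \<bullet> x + t * c n) - sawtooth (real_vec n \<bullet> x - t * c n)\<bar> \<le> 1"
        using abs_sawtooth_le[of "real_vec n \<bullet> x + t * c n"] abs_sawtooth_le[of "real_vec n \<bullet> x - t * c n"]
        by linarith
      then show ?thesis by (simp add: F_def abs_mult mult_left_le)
    qed
    show "\<bar>G n\<bar> \<le> \<bar>a n\<bar>" for n by (simp add: G_def abs_mult abs_sgn_eq)
    fix n :: "int ^ 'n" assume n: "n \<in> UNIV - {0}"
    show "((\<lambda>t. F t n) \<longlongrightarrow> G n) (at_right 0)"
    proof (cases "n \<in> M")
      case True
      then obtain l where l: "n = l *s q" "l \<noteq> 0" by (auto simp: M_def)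
      have "real_vec n \<bullet> x \<in> \<int>" using x by (simp add: l real_vec_scale)
      moreover have "c n \<noteq> 0" using l qq by (simp add: c_def real_vec_scale)
      ultimately show ?thesis unfolding F_def using True
        by (simp only: G_def if_True) (intro tendsto_mult_left sawtooth_jump_int)
    next
      case False
      have "real_vec n \<bullet> x \<notin> \<int>"
      proof
        assume "real_vec n \<bullet> x \<in> \<int>"
        then obtain l where l: "n = l *s q" using gen by blast
        then have "l \<noteq> 0" using n by auto
        then show False using False l by (auto simp: M_def)
      qed
      from tendsto_mult_left[OF sawtooth_jump_nonint[OF this], of "a n" "c n"]
      show ?thesis using False by (simp add: F_def G_def)
    qed
  qed
  moreover have "infsum G (UNIV - {0}) = (\<Sum>\<^sub>\<infinity>n\<in>M. a n * - sgn (c n))"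
  proof (rule infsum_cong_neutral)
    fix n assume n: "n \<in> M - (UNIV - {0})"
    then obtain l :: int where "n = l *s q" "l \<noteq> 0" unfolding M_def by blast
    moreover have "n = 0" using n by simp
    ultimately have False using q by (auto simp: vec_eq_iff)
    then show "a n * - sgn (c n) = 0" ..
  qed (auto simp: G_def)
  moreover have "\<dots> = - jump_seq a q"
    unfolding M_def c_def by (rule jump_seq_as_infsum[OF odd sm q])
  moreover have "infsum (F t) (UNIV - {0}) =
      davenport_series a (x + t *\<^sub>R real_vec q) - davenport_series a (x - t *\<^sub>R real_vec q)" for t
  proof -
    have "infsum (F t) (UNIV - {0}) = (\<Sum>\<^sub>\<infinity>n\<in>UNIV - {0}. a n * sawtooth (real_vec n \<bullet> (x + t *\<^sub>R real_vec q)) -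
        a n * sawtooth (real_vec n \<bullet> (x - t *\<^sub>R real_vec q)))"
      by (rule infsum_cong) (simp add: F_def c_def inner_add_right inner_diff_right right_diff_distrib)
    also have "\<dots> = davenport_series a (x + t *\<^sub>R real_vec q) - davenport_series a (x - t *\<^sub>R real_vec q)"
      unfolding davenport_series_def
      using infsum_add[OF summable_davenport[OF sm] summable_on_uminus[THEN iffD2, OF summable_davenport[OF sm]]]
      by (simp add: infsum_uminus)
    finally show ?thesis .
  qed
  ultimately show ?thesis by simp
qed

text \<open>Genericity is wanted inside a hyperplane, which is itself a null set. Points
  \<open>y\<close> of the full space are projected onto it instead: an unwanted integer value at the
  projection \<open>P y\<close> puts \<open>y\<close> on one of countably many hyperplanes with
  normal \<open>w n\<close>, unless \<open>w n = 0\<close>. In that case \<open>n\<close> is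
  parallel to \<open>q\<close>, and reducedness makes it an integer multiple.\<close>

lemma ex_generic_point:
  fixes q :: "int ^ 'n"
  assumes q: "q \<noteq> 0" and gcd: "Gcd (insert p (range (($) q))) = 1" and e: "0 < e"
  obtains z where "real_vec q \<bullet> z = of_int p"
    "norm (z - x) \<le> \<bar>real_vec q \<bullet> x - of_int p\<bar> / vnorm q + e"
    "\<And>n. real_vec n \<bullet> z \<in> \<int> \<Longrightarrow> \<exists>l. n = l *s q"
proof -
  define v where "v = real_vec q"
  have v: "v \<noteq> 0" "0 < norm v" "v \<bullet> v = (norm v)\<^sup>2"
    using q by (simp_all add: v_def power2_norm_eq_inner)
  define P where "P y = y - ((v \<bullet> y - of_int p) / (v \<bullet> v)) *\<^sub>R v" for y
  have Pv: "v \<bullet> P y = of_int p" for y using v by (simp add: P_def inner_diff_right)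
  have Pd: "norm (P y - y) = \<bar>v \<bullet> y - of_int p\<bar> / norm v" for y
    using v by (simp add: P_def abs_divide power2_eq_square)
  \<comment> \<open>The component of \<open>n\<close> orthogonal to \<open>q\<close>; it is the
    normal seen by \<open>y\<close> when the value is taken at the projection.\<close>
  define w where "w n = real_vec n - ((real_vec n \<bullet> v) / (v \<bullet> v)) *\<^sub>R v" for n
  have inner: "real_vec n \<bullet> P y = w n \<bullet> y + (real_vec n \<bullet> v) / (v \<bullet> v) * of_int p" for n y
    using v by (simp add: P_def w_def inner_diff_right inner_diff_left field_simps)
  define I where "I = {n. \<nexists>l. n = l *s q}"
  define Z where "Z = (\<Union>(n, m) \<in> {n \<in> I. w n \<noteq> 0} \<times> (UNIV :: int set).
      {y. w n \<bullet> y = of_int m - (real_vec n \<bullet> v) / (v \<bullet> v) * of_int p})"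
  have "negligible Z"
    unfolding Z_def by (intro negligible_countable_Union) (auto intro!: negligible_hyperplane)
  then have "\<not> ball x (e / 2) \<subseteq> Z"
    using e open_not_negligible[of "ball x (e / 2)"] negligible_subset by auto
  then obtain y where "y \<in> ball x (e / 2)" and y2: "y \<notin> Z" by blast
  then have y: "dist x y < e / 2" "y \<notin> Z" by simp_all
  show ?thesis
  proof (rule that[of "P y"])
    show "real_vec q \<bullet> P y = of_int p" using Pv by (simp add: v_def)
    have "\<bar>v \<bullet> y - of_int p\<bar> \<le> \<bar>v \<bullet> x - of_int p\<bar> + norm v * (e / 2)"
    proof -
      have "\<bar>v \<bullet> (y - x)\<bar> \<le> norm v * norm (y - x)" by (rule Cauchy_Schwarz_ineq2)
      also have "\<dots> \<le> norm v * (e / 2)"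
        using y by (intro mult_left_mono) (auto simp: dist_norm norm_minus_commute)
      finally show ?thesis unfolding inner_diff_right by linarith
    qed
    then have "\<bar>v \<bullet> y - of_int p\<bar> / norm v \<le> (\<bar>v \<bullet> x - of_int p\<bar> + norm v * (e / 2)) / norm v"
      using v by (intro divide_right_mono) auto
    also have "\<dots> = \<bar>v \<bullet> x - of_int p\<bar> / norm v + e / 2"
      using v by (simp add: add_divide_distrib)
    finally have "norm (P y - y) \<le> \<bar>v \<bullet> x - of_int p\<bar> / norm v + e / 2" by (simp add: Pd)
    moreover have "norm (P y - x) \<le> norm (P y - y) + norm (y - x)"
      using norm_triangle_ineq[of "P y - y" "y - x"] by simp
    moreover have "norm (y - x) < e / 2" using y(1) by (simp add: dist_norm norm_minus_commute)
    ultimately show "norm (P y - x) \<le> \<bar>real_vec q \<bullet> x - of_int p\<bar> / vnorm q + e"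
      by (simp add: v_def)
    fix n assume int: "real_vec n \<bullet> P y \<in> \<int>"
    show "\<exists>l. n = l *s q"
    proof (rule ccontr)
      assume "\<nexists>l. n = l *s q"
      then have nI: "n \<in> I" by (simp add: I_def)
      obtain m :: int where m: "w n \<bullet> y + (real_vec n \<bullet> v) / (v \<bullet> v) * of_int p = of_int m"
        using int by (auto simp: inner elim: Ints_cases)
      show False
      proof (cases "w n = 0")
        case True
        then have "real_vec n = ((real_vec n \<bullet> v) / (v \<bullet> v)) *\<^sub>R real_vec q"
          by (simp add: w_def v_def)
        moreover have "(real_vec n \<bullet> v) / (v \<bullet> v) * of_int p \<in> \<int>" using m True by simp
        ultimately obtain l where "n = l *s q" using int_of_reduced_multiples[OF q gcd] by blast
        then show False using nI by (auto simp: I_def)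
      next
        case False
        moreover have "w n \<bullet> y = of_int m - (real_vec n \<bullet> v) / (v \<bullet> v) * of_int p"
          using m by linarith
        ultimately have "y \<in> Z" unfolding Z_def by (intro UN_I[of "(n, m)"]) (use nI in auto)
        then show False using y by blast
      qed
    qed
  qed
qed

section \<open>Jumps as an obstruction to regularity\<close>

lemma isCont_poly_degree_less:
  assumes "poly_degree_less \<alpha> P"
  shows "isCont P x"
proof -
  obtain K c where P: "P = (\<lambda>x. \<Sum>k\<in>K. c k * (\<Prod>i\<in>UNIV. (x $ i) ^ k i))"
    using assms unfolding poly_degree_less_def by blast
  show ?thesis unfolding P by (intro continuous_intros)
qed

text \<open>A jump \<open>A\<^sub>q\<close> at distance \<open>D\<close> from \<open>x\<close> cannot be followed by a continuous \<open>P\<close>, so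
  \<open>|A\<^sub>q| \<le> 2 C D\<^sup>\<alpha>\<close> whenever \<open>|f - P| \<le> C |y - x|\<^sup>\<alpha>\<close> near \<open>x\<close>.\<close>

lemma jump_le_of_holder:
  fixes a :: "int ^ 'n \<Rightarrow> real"
  assumes odd: "odd_seq a" and sm: "(\<lambda>n. \<bar>a n\<bar>) summable_on UNIV" and q: "q \<noteq> 0"
    and gcd: "Gcd (insert p (range (($) q))) = 1" and P: "\<And>y. isCont P y"
    and \<alpha>: "0 < \<alpha>" and C: "0 < C"
    and hol: "\<And>y. norm (y - x) < r \<Longrightarrow> \<bar>davenport_series a y - P y\<bar> \<le> C * norm (y - x) powr \<alpha>"
    and D: "D = \<bar>real_vec q \<bullet> x - of_int p\<bar> / vnorm q" "D < r"
  shows "\<bar>jump_seq a q\<bar> \<le> 2 * C * D powr \<alpha>"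
proof -
  let ?f = "davenport_series a" and ?v = "real_vec q"
  have D0: "0 \<le> D" by (simp add: D(1))
  \<comment> \<open>The slack \<open>e\<close> is spent twice: once to replace the foot of the
    perpendicular by a generic point, once to move off the hyperplane in both directions. It is sent
    to zero afterwards.\<close>
  have step: "\<bar>jump_seq a q\<bar> \<le> 2 * C * (D + 2 * e) powr \<alpha>" if e: "0 < e" "D + 2 * e < r" for e
  proof -
    obtain z where z: "?v \<bullet> z = of_int p" "norm (z - x) \<le> D + e"
      "\<And>n. real_vec n \<bullet> z \<in> \<int> \<Longrightarrow> \<exists>l. n = l *s q"
      using ex_generic_point[OF q gcd e(1), of x] unfolding D(1) by blast
    have nv: "0 < norm ?v" using q by simp
    let ?g = "\<lambda>t. \<bar>(?f (z + t *\<^sub>R ?v) - ?f (z - t *\<^sub>R ?v)) - (P (z + t *\<^sub>R ?v) - P (z - t *\<^sub>R ?v))\<bar>"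
    have J: "((\<lambda>t. ?f (z + t *\<^sub>R ?v) - ?f (z - t *\<^sub>R ?v)) \<longlongrightarrow> - jump_seq a q) (at_right 0)"
      by (rule davenport_jump[OF odd sm q z(1,3)])
    have "((\<lambda>t. P (z + t *\<^sub>R ?v) - P (z - t *\<^sub>R ?v)) \<longlongrightarrow> P z - P z) (at_right 0)"
    proof (intro tendsto_diff isCont_tendsto_compose[OF P])
      show "((\<lambda>t. z + t *\<^sub>R ?v) \<longlongrightarrow> z) (at_right 0)" "((\<lambda>t. z - t *\<^sub>R ?v) \<longlongrightarrow> z) (at_right 0)"
        by (auto intro!: tendsto_eq_intros)
    qed
    from tendsto_rabs[OF tendsto_diff[OF J this]] have lim: "(?g \<longlongrightarrow> \<bar>- jump_seq a q - (P z - P z)\<bar>) (at_right 0)" .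
    have "\<forall>\<^sub>F t in at_right 0. ?g t
        \<le> 2 * C * (D + 2 * e) powr \<alpha>" unfolding eventually_at_right_field
    proof (intro exI[of _ "e / norm ?v"] conjI allI impI)
      fix t :: real assume t: "0 < t" "t < e / norm ?v"
      then have te: "norm (t *\<^sub>R ?v) \<le> e" using nv by (simp add: field_simps)
      have *: "\<bar>?f y - P y\<bar> \<le> C * (D + 2 * e) powr \<alpha>" if "norm (y - x) \<le> D + 2 * e" for y
      proof -
        have "\<bar>?f y - P y\<bar> \<le> C * norm (y - x) powr \<alpha>" using that e by (intro hol) auto
        also have "\<dots> \<le> C * (D + 2 * e) powr \<alpha>"
          using that C \<alpha> by (intro mult_left_mono powr_mono2) auto
        finally show ?thesis .
      qed
      have "norm (z + t *\<^sub>R ?v - x) \<le> D + 2 * e"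
        using norm_triangle_ineq[of "z - x" "t *\<^sub>R ?v"] z(2) te by (simp add: algebra_simps)
      moreover have "norm (z - t *\<^sub>R ?v - x) \<le> D + 2 * e"
        using norm_triangle_ineq4[of "z - x" "t *\<^sub>R ?v"] z(2) te by (simp add: algebra_simps)
      ultimately show "?g t
        \<le> 2 * C * (D + 2 * e) powr \<alpha>"
        using *[of "z + t *\<^sub>R ?v"] *[of "z - t *\<^sub>R ?v"] by linarith
    qed (use e nv in auto)
    from tendsto_upperbound[OF lim this] show ?thesis by simp
  qed
  have "((\<lambda>e. 2 * C * (D + 2 * e) powr \<alpha>) \<longlongrightarrow> 2 * C * (D + 2 * 0) powr \<alpha>) (at_right 0)"
    using \<alpha> D0 by (intro tendsto_mult_left tendsto_powr' tendsto_add tendsto_const tendsto_ident_at)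
      (auto simp: eventually_at_filter)
  moreover have "\<forall>\<^sub>F e in at_right 0. \<bar>jump_seq a q\<bar> \<le> 2 * C * (D + 2 * e) powr \<alpha>"
    unfolding eventually_at_right_field
    using step D(2) by (intro exI[of _ "(r - D) / 2"]) (auto simp: field_simps)
  ultimately have "\<bar>jump_seq a q\<bar> \<le> 2 * C * (D + 2 * 0) powr \<alpha>"
    by (intro tendsto_lowerbound[of _ _ "at_right 0"]) auto
  then show ?thesis by simp
qed

section \<open>Large intersection\<close>

text \<open>After translation and rescaling, a similarity is an isometry fixing the origin, hence
  orthogonal. It therefore carries layers with normal \<open>v\<close> to layers with a normal of
  length \<open>norm v / r\<close> and a shifted offset.\<close>

lemma similarity_affine:
  fixes f :: "'a::euclidean_space \<Rightarrow> 'a"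
  assumes "similarity f"
  obtains r b T where "0 < r" "\<And>v. norm (T v) = norm v"
    "\<And>v x. v \<bullet> x = ((1 / r) *\<^sub>R T v) \<bullet> f x - ((1 / r) *\<^sub>R T v) \<bullet> b" "bij f"
proof -
  obtain r where r: "0 < r" "\<And>x y. dist (f x) (f y) = r * dist x y"
    using assms unfolding similarity_def by blast
  define T where "T x = (1 / r) *\<^sub>R (f x - f 0)" for x
  have f: "f x = f 0 + r *\<^sub>R T x" for x using r by (simp add: T_def)
  have ot: "orthogonal_transformation T" unfolding orthogonal_transformation_isometry
  proof (intro conjI allI)
    show "T 0 = 0" by (simp add: T_def)
    show "dist (T x) (T y) = dist x y" for x y
    proof -
      have "dist (T x) (T y) = norm ((1 / r) *\<^sub>R (f x - f y))"
        by (simp add: T_def dist_norm flip: scaleR_diff_right)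
      also have "\<dots> = dist (f x) (f y) / r" using r by (simp add: dist_norm)
      finally show ?thesis using r by simp
    qed
  qed
  show ?thesis
  proof (rule that[of r T "f 0"])
    show "norm (T v) = norm v" for v using ot by (simp add: orthogonal_transformation_norm)
    have "T v \<bullet> T x = v \<bullet> x" for v x using ot by (simp add: orthogonal_transformation_def)
    then show "v \<bullet> x = ((1 / r) *\<^sub>R T v) \<bullet> f x - ((1 / r) *\<^sub>R T v) \<bullet> f 0" for v x
      using r by (subst f) (simp add: inner_add_right)
    have "\<exists>x. y = f x" for y
    proof -
      obtain x where "(1 / r) *\<^sub>R (y - f 0) = T x"
        using orthogonal_transformation_surj[OF ot] by (metis surjD)
      then have "f x = f 0 + r *\<^sub>R ((1 / r) *\<^sub>R (y - f 0))" by (subst f) simp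
      then have "f x = y" using r by simp
      then show ?thesis by blast
    qed
    then have "surj f" by (simp add: surj_def)
    moreover have "inj f" using r by (intro injI) (metis dist_eq_0_iff mult_eq_0_iff less_irrefl)
    ultimately show "bij f" by (simp add: bij_def)
  qed (rule r(1))
qed

section \<open>The limsup set and its Baire category\<close>

definition rational_hyperplanes :: "(real ^ 'n) set" where
  "rational_hyperplanes = (\<Union>(p, q) \<in> UNIV \<times> {q. q \<noteq> 0}. hyperplane p q)"

lemma discontinuity_set_subset: "discontinuity_set A \<subseteq> rational_hyperplanes"
proof
  fix x assume "x \<in> discontinuity_set A"
  then obtain p q where "q \<in> pos_int_vecs" "x \<in> hyperplane p q"
    by (auto simp: discontinuity_set_def hyperplane_indices_def)
  moreover from this have "q \<noteq> 0" by (auto simp: pos_int_vecs_def)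
  ultimately show "x \<in> rational_hyperplanes" by (auto simp: rational_hyperplanes_def)
qed

text \<open>The strict inequality makes the layers open, as required for a \<open_free> set.\<close>

definition layers :: "(int ^ 'n \<Rightarrow> real) \<Rightarrow> real \<Rightarrow> int ^ 'n \<Rightarrow> (real ^ 'n) set" where
  "layers a h n = {x. \<exists>p::int. \<bar>real_vec n \<bullet> x - p\<bar> < vnorm n * \<bar>a n\<bar> powr (1 / h)}"

definition tail_layers :: "(int ^ 'n \<Rightarrow> real) \<Rightarrow> real \<Rightarrow> nat \<Rightarrow> (real ^ 'n) set" where
  "tail_layers a h k = (\<Union>n\<in>{n \<in> supp a. real k \<le> vnorm n}. layers a h n)"

text \<open>All rational hyperplanes are removed, not only those where the series jumps, so that
  \<open>real_vec q \<bullet> x\<close> is never an integer for \<open>q \<noteq> 0\<close>. They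
  are countably many and have content zero above \<open>d - 1\<close>.\<close>

definition approx_set :: "(int ^ 'n \<Rightarrow> real) \<Rightarrow> real \<Rightarrow> (real ^ 'n) set" where
  "approx_set a h = (\<Inter>k. tail_layers a h k) - rational_hyperplanes"

definition approx_family :: "(int ^ 'n \<Rightarrow> real) \<Rightarrow> real \<Rightarrow> (real ^ 'n) set set" where
  "approx_family a h = range (tail_layers a h) \<union> (\<lambda>(p, q). - hyperplane p q) ` (UNIV \<times> {q. q \<noteq> 0})"

lemma approx_set_eq: "approx_set a h = \<Inter>(approx_family a h)"
  by (auto simp: approx_set_def approx_family_def rational_hyperplanes_def)

lemma countable_approx_family: "countable (approx_family a h)"
  unfolding approx_family_def by (intro countable_Un countable_image) auto

lemma open_layers: "open (layers a h n)"
proof -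
  have "layers a h n = (\<Union>p::int. {x. \<bar>real_vec n \<bullet> x - p\<bar> < vnorm n * \<bar>a n\<bar> powr (1 / h)})"
    by (auto simp: layers_def)
  also have "open \<dots>" by (intro open_UN ballI open_Collect_less continuous_intros)
  finally show ?thesis .
qed

lemma open_approx_family:
  assumes "T \<in> approx_family a h"
  shows "open T"
proof -
  have "open (tail_layers a h k)" for k unfolding tail_layers_def using open_layers by blast
  moreover have "open (- hyperplane p q)" for p and q :: "int ^ 'a"
    unfolding hyperplane_def using closed_hyperplane open_Compl by blast
  ultimately show ?thesis using assms by (auto simp: approx_family_def)
qed

lemma gdelta_approx_set: "gdelta_in euclidean (approx_set a h)"
  unfolding approx_set_eq
proof (rule gdelta_in_Inter[OF countable_approx_family])
  show "approx_family a h \<noteq> {}" by (auto simp: approx_family_def)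
  show "gdelta_in euclidean T" if "T \<in> approx_family a h" for T
    using open_approx_family[OF that] by (intro open_imp_gdelta_in) simp
qed

text \<open>Every point is within \<open>1 / vnorm n\<close> of a hyperplane with normal
  \<open>n\<close>, so an unbounded support makes each tail dense.\<close>

lemma closure_approx_family:
  assumes unb: "\<And>B. \<exists>n\<in>supp a. B \<le> vnorm n" and T: "T \<in> approx_family a h"
  shows "closure T = UNIV"
proof -
  have "closure (tail_layers a h k) = UNIV" for k
  proof -
    have "\<exists>y\<in>tail_layers a h k. dist y x < e" if e: "0 < e" for x e
    proof -
      obtain n where n: "n \<in> supp a" "max (max (real k) 1) (2 / e) \<le> vnorm n" using unb by blast
      define v where "v = real_vec n"
      define m where "m = \<lfloor>v \<bullet> x\<rfloor>"
      have v: "0 < norm v" "2 / e \<le> norm v" "v \<bullet> v = (norm v)\<^sup>2"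
        using n by (auto simp: v_def power2_norm_eq_inner)
      define y where "y = x - ((v \<bullet> x - m) / (v \<bullet> v)) *\<^sub>R v"
      have vv: "0 < v \<bullet> v" using v(1) unfolding v(3) by simp
      have "v \<bullet> y = m" using vv by (simp add: y_def inner_diff_right)
      moreover have "0 < norm v * \<bar>a n\<bar> powr (1 / h)" using v n by (simp add: supp_def)
      ultimately have "y \<in> layers a h n" unfolding layers_def v_def by (intro CollectI exI[of _ m]) simp
      then have 1: "y \<in> tail_layers a h k" using n by (auto simp: tail_layers_def)
      have "dist y x = \<bar>v \<bullet> x - m\<bar> / norm v"
        using v(1) by (simp add: y_def dist_norm abs_divide v(3) power2_eq_square)
      also have "\<dots> \<le> 1 / norm v" using v(1) by (intro divide_right_mono) (auto simp: m_def; linarith)+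
      also have "\<dots> < e" using v e by (simp add: field_simps)
      finally show ?thesis using 1 by blast
    qed
    then show ?thesis by (auto simp: closure_approachable)
  qed
  moreover have "closure (- hyperplane p q) = UNIV" if "q \<noteq> 0" for p and q :: "int ^ 'a"
    using that interior_hyperplane[of "real_vec q" "of_int p"]
    by (simp add: closure_complement hyperplane_def)
  ultimately show ?thesis using T by (auto simp: approx_family_def)
qed

section \<open>Bounds on coefficients and jumps from \<gamma> and \<theta>\<close>

lemma gamma_upper:
  assumes \<gamma>: "gamma a = ereal \<gamma>" and g: "g < \<gamma>" and odd: "odd_seq a"
  obtains K where "0 < K" "\<And>n. n \<in> supp a \<Longrightarrow> \<bar>a n\<bar> \<le> K * vnorm n powr - g"
proof -
  have "ereal g < Liminf (at_infinity_in (supp a)) (\<lambda>n. ereal (- ln \<bar>a n\<bar> / ln (vnorm n)))"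
    using \<gamma> g by (simp add: gamma_def)
  then have "\<forall>\<^sub>F n in at_infinity_in (supp a). ereal g < ereal (- ln \<bar>a n\<bar> / ln (vnorm n))"
    by (rule less_LiminfD)
  then obtain R where R: "\<And>n. n \<in> supp a \<Longrightarrow> R \<le> vnorm n \<Longrightarrow> g < - ln \<bar>a n\<bar> / ln (vnorm n)"
    unfolding eventually_at_infinity_in by auto
  define F where "F = {n \<in> supp a. vnorm n \<le> max R 2}"
  have fin: "finite F" unfolding F_def
    by (rule finite_subset[OF _ finite_norm_real_vec_le[of "max R 2"]]) auto
  define K where "K = Max (insert 1 ((\<lambda>n. \<bar>a n\<bar> * vnorm n powr g) ` F))"
  have K1: "1 \<le> K" unfolding K_def using fin by (intro Max_ge) auto
  show ?thesis
  proof (rule that[of K])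
    show "0 < K" using K1 by simp
    fix n assume n: "n \<in> supp a"
    let ?N = "vnorm n"
    \<comment> \<open>At \<open>n = 0\<close> the right-hand side would be zero, since
      \<open>0 powr - g = 0\<close>; oddness removes this index from the support.\<close>
    have "a 0 = 0" using odd unfolding odd_seq_def by (metis add.inverse_neutral neg_equal_zero)
    then have "n \<noteq> 0" using n by (auto simp: supp_def)
    then have N: "1 \<le> ?N" by (rule norm_real_vec_ge_1)
    show "\<bar>a n\<bar> \<le> K * ?N powr - g"
    proof (cases "n \<in> F")
      case True
      then have "\<bar>a n\<bar> * ?N powr g \<le> K" unfolding K_def using fin by (intro Max_ge) auto
      then show ?thesis using \<open>n \<noteq> 0\<close> by (simp add: powr_minus field_simps)
    next
      case False
      then have N2: "2 < ?N" "R \<le> ?N" using n by (auto simp: F_def)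
      have "g < - ln \<bar>a n\<bar> / ln ?N" using R[OF n N2(2)] .
      moreover have "0 < ln ?N" using N2 by (intro ln_gt_zero) simp
      ultimately have "ln \<bar>a n\<bar> < - g * ln ?N" by (simp only: pos_less_divide_eq)
      also have "\<dots> = ln (?N powr - g)" using N2 by (simp add: ln_powr)
      finally have "\<bar>a n\<bar> < ?N powr - g"
        using n N2 by (subst (asm) ln_less_cancel_iff) (auto simp: supp_def)
      also have "\<dots> \<le> K * ?N powr - g" using K1 mult_right_mono[of 1 K "?N powr - g"] by simp
      finally show ?thesis by simp
    qed
  qed
qed

text \<open>If all long vectors of the support had smaller coefficients, the lower limit would be at
  least \<open>c\<close>. A finite value of \<open>gamma a\<close> thus also makes the support
  unbounded, since over a finite support the lower limit is infinite.\<close>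

lemma gamma_lower:
  assumes \<gamma>: "gamma a = ereal \<gamma>" and c: "\<gamma> < c"
  shows "\<exists>n\<in>supp a. B \<le> vnorm n \<and> vnorm n powr - c \<le> \<bar>a n\<bar>"
proof (rule ccontr)
  assume no: "\<not> ?thesis"
  have "\<forall>\<^sub>F n in at_infinity_in (supp a). ereal c \<le> ereal (- ln \<bar>a n\<bar> / ln (vnorm n))"
    unfolding eventually_at_infinity_in
  proof (intro exI[of _ "max B 2"] ballI impI)
    fix n assume n: "n \<in> supp a" "max B 2 \<le> vnorm n"
    let ?N = "vnorm n"
    have "\<bar>a n\<bar> < ?N powr - c" using no n by (auto simp: not_le)
    then have "ln \<bar>a n\<bar> \<le> ln (?N powr - c)" using n by (subst ln_le_cancel_iff) (auto simp: supp_def)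
    also have "\<dots> = - c * ln ?N" using n by (simp add: ln_powr)
    finally have "ln \<bar>a n\<bar> \<le> - c * ln ?N" .
    moreover have "0 < ln ?N" using n by (intro ln_gt_zero) simp
    ultimately have "c \<le> - ln \<bar>a n\<bar> / ln ?N" by (simp only: pos_le_divide_eq)
    then show "ereal c \<le> ereal (- ln \<bar>a n\<bar> / ln ?N)" by simp
  qed
  then have "ereal c \<le> gamma a" unfolding gamma_def by (rule Liminf_bounded)
  then show False using \<gamma> c by simp
qed

text \<open>The logarithmic ratio is below \<open>1 + e\<close> for long \<open>q\<close>.
  Multiplying by the negative \<open>ln s\<close>, with \<open>s = sup_seq a q\<close>, reverses the
  inequality and bounds the jump from below by \<open>s powr (1 + e)\<close>, where \<open>s\<close>
  dominates every coefficient along \<open>q\<close>.\<close>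

lemma theta_lower:
  fixes a :: "int ^ 'n \<Rightarrow> real"
  assumes \<theta>: "theta a \<le> 1" and e: "0 < e" and g: "0 < g"
    and K: "0 < K" "\<And>n. n \<in> supp a \<Longrightarrow> \<bar>a n\<bar> \<le> K * vnorm n powr - g"
  obtains Q where "\<And>q l. Q \<le> vnorm q \<Longrightarrow> 1 \<le> l \<Longrightarrow> int l *s q \<in> supp a \<Longrightarrow>
    \<bar>a (int l *s q)\<bar> powr (1 + e) \<le> \<bar>jump_seq a q\<bar>"
proof -
  have "theta a < ereal (1 + e)"
    using \<theta> e by (metis ereal_less(3) le_less_trans less_add_same_cancel1 ereal_less_eq(3) one_ereal_def less_ereal.simps(1))
  then have "\<forall>\<^sub>F q in at_infinity_in (supp (sup_seq a)).
      elog \<bar>jump_seq a q\<bar> / elog \<bar>sup_seq a q\<bar> < ereal (1 + e)"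
    unfolding theta_def by (rule Limsup_lessD)
  then obtain R where R: "\<And>q. q \<in> supp (sup_seq a) \<Longrightarrow> R \<le> vnorm q \<Longrightarrow>
      elog \<bar>jump_seq a q\<bar> / elog \<bar>sup_seq a q\<bar> < ereal (1 + e)"
    unfolding eventually_at_infinity_in by blast
  \<comment> \<open>The last entry makes \<open>K * vnorm q powr - g\<close> at most 1/2, so all
    coefficients at multiples of \<open>q\<close>, and with them \<open>s\<close>, stay below one
    and \<open>ln s\<close> is negative.\<close>
  define Q where "Q = max (max R 1) ((2 * K) powr (1 / g))"
  show ?thesis
  proof (rule that[of Q])
    fix q :: "int ^ 'n" and l :: nat
    assume q: "Q \<le> vnorm q" and l: "1 \<le> l" and supp: "int l *s q \<in> supp a"
    let ?N = "vnorm q"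
    have N: "R \<le> ?N" "1 \<le> ?N" "(2 * K) powr (1 / g) \<le> ?N" using q by (auto simp: Q_def)
    have KN: "K * ?N powr - g \<le> 1 / 2"
    proof -
      have "?N powr - g \<le> ((2 * K) powr (1 / g)) powr - g" using N K g by (intro powr_mono2') auto
      also have "\<dots> = 1 / (2 * K)" using K g by (simp add: powr_powr powr_minus_divide)
      finally show ?thesis using K by (simp add: field_simps)
    qed
    have le: "\<bar>a (int k *s q)\<bar> \<le> 1 / 2" if "k \<in> {1..}" for k
    proof (cases "int k *s q \<in> supp a")
      case True
      have "vnorm (int k *s q) = real k * ?N" by (simp add: real_vec_scale)
      also have "\<dots> \<ge> 1 * ?N" using that by (intro mult_right_mono) auto
      finally have "?N \<le> vnorm (int k *s q)" by simp
      then have "vnorm (int k *s q) powr - g \<le> ?N powr - g" using N g by (intro powr_mono2') auto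
      then have "K * vnorm (int k *s q) powr - g \<le> K * ?N powr - g"
        using K by (intro mult_left_mono) auto
      then show ?thesis using K(2)[OF True] KN by linarith
    next
      case False
      then show ?thesis by (simp add: supp_def)
    qed
    define s where "s = sup_seq a q"
    have s1: "s \<le> 1 / 2" unfolding s_def sup_seq_def using le by (intro cSUP_least) auto
    have s2: "\<bar>a (int l *s q)\<bar> \<le> s" unfolding s_def sup_seq_def
      using le l by (intro cSUP_upper bdd_aboveI2[of _ _ "1 / 2"]) auto
    have s0: "0 < s" using s2 supp by (simp add: supp_def)
    then have qs: "q \<in> supp (sup_seq a)" by (simp add: supp_def s_def)
    have lns: "ln s < 0" using s0 s1 by simp
    have lt: "elog \<bar>jump_seq a q\<bar> / elog s < ereal (1 + e)"
      using R[OF qs N(1)] s0 by (simp add: s_def)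
    have el: "elog s = ereal (ln s)" using s0 by (simp add: elog_def)
    \<comment> \<open>The convention of \<open>elog\<close> at zero acts here: a vanishing jump
      would make the ratio \<open>+\<infinity>\<close>.\<close>
    have J0: "jump_seq a q \<noteq> 0"
    proof
      assume "jump_seq a q = 0"
      then have "elog \<bar>jump_seq a q\<bar> / elog s = \<infinity>"
        unfolding el using lns by (simp add: elog_def)
      then show False using lt by simp
    qed
    have "ln \<bar>jump_seq a q\<bar> / ln s < 1 + e" using lt J0 lns unfolding el by (simp add: elog_def)
    then have "(1 + e) * ln s < ln \<bar>jump_seq a q\<bar>" using lns by (simp add: neg_divide_less_eq)
    then have "ln (s powr (1 + e)) < ln \<bar>jump_seq a q\<bar>" using s0 by (simp add: ln_powr)
    then have "s powr (1 + e) < \<bar>jump_seq a q\<bar>" using s0 J0 by (subst (asm) ln_less_cancel_iff) auto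
    moreover have "\<bar>a (int l *s q)\<bar> powr (1 + e) \<le> s powr (1 + e)"
      using s2 e by (intro powr_mono2) auto
    ultimately show "\<bar>a (int l *s q)\<bar> powr (1 + e) \<le> \<bar>jump_seq a q\<bar>" by linarith
  qed
qed

text \<open>Dividing by the common gcd replaces \<open>n\<close> and \<open>p\<close> by reduced
  data for the same hyperplane. The jump across it is governed by \<open>q\<close>, while
  \<open>n\<close> is one of the multiples of \<open>q\<close> that contribute.\<close>

lemma ex_reduced:
  fixes n :: "int ^ 'n" and p :: int
  assumes "n \<noteq> 0"
  obtains l q p' where "1 \<le> l" "n = int l *s q" "p = int l * p'" "q \<noteq> 0"
    "Gcd (insert p' (range (($) q))) = 1"
proof -
  define e where "e = Gcd (insert p (range (($) n)))"
  obtain i where i: "n $ i \<noteq> 0" using assms by (auto simp: vec_eq_iff)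
  have dv: "e dvd p" "\<And>j. e dvd n $ j" unfolding e_def by (auto intro!: Gcd_dvd simp del: Gcd_insert)
  have e0: "e \<noteq> 0" using dv(2)[of i] i by auto
  then have e: "0 < e" unfolding e_def by (simp add: less_le del: Gcd_insert)
  define q where "q = (\<chi> j. n $ j div e)"
  define p' where "p' = p div e"
  have nq: "n = e *s q" and pp: "p = e * p'" using dv by (simp_all add: q_def p'_def vec_eq_iff)
  have "insert p (range (($) n)) = (*) e ` insert p' (range (($) q))"
  proof -
    have "range (($) n) = (*) e ` range (($) q)" by (subst nq) (simp add: image_image)
    then show ?thesis using pp by simp
  qed
  then have "e = normalize (e * Gcd (insert p' (range (($) q))))"
    unfolding e_def using Gcd_mult by metis
  then have "e * Gcd (insert p' (range (($) q))) = e * 1" using e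
    by (simp add: abs_mult del: Gcd_insert)
  then have "Gcd (insert p' (range (($) q))) = 1" using e0 by (simp del: Gcd_insert)
  moreover have "q \<noteq> 0" using nq assms by auto
  ultimately show ?thesis using that[of "nat e" q p'] nq pp e by simp
qed

text \<open>If regularity \<alpha> > h held, a layer of \<open>n\<close> close to \<open>x\<close>
  would give, with \<open>A = \<bar>a n\<bar>\<close> and \<open>D\<close> the distance to its
  hyperplane, \<open>A^(1 + e) \<le> \<bar>jump_seq a q\<bar> \<le> 2 C D^\<alpha> \<le> 2 C
  A^(\<alpha> / h)\<close>. This fails for small \<open>A\<close> as soon as
  \<open>1 + e < \<alpha> / h\<close>.\<close>

lemma holder_exponent_approx_set_le:
  fixes a :: "int ^ 'n \<Rightarrow> real"
  assumes odd: "odd_seq a" and sm: "(\<lambda>n. \<bar>a n\<bar>) summable_on UNIV" and \<theta>: "theta a \<le> 1"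
    and \<gamma>: "gamma a = ereal \<gamma>" "0 < \<gamma>" and h: "0 < h" and x: "x \<in> approx_set a h"
  shows "holder_exponent (davenport_series a) x \<le> ereal h"
  unfolding holder_exponent_def
proof (rule Sup_least)
  fix z assume "z \<in> {ereal \<alpha> | \<alpha>. 0 \<le> \<alpha> \<and> (\<exists>C>0. \<exists>P. poly_degree_less \<alpha> P \<and>
    (\<forall>\<^sub>F y in nhds x. \<bar>davenport_series a y - P y\<bar> \<le> C * rpow (norm (y - x)) \<alpha>))}"
  then obtain \<alpha> C P where z: "z = ereal \<alpha>" and C: "0 < C" and P: "poly_degree_less \<alpha> P"
    and ev: "\<forall>\<^sub>F y in nhds x. \<bar>davenport_series a y - P y\<bar> \<le> C * rpow (norm (y - x)) \<alpha>" by blast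
  show "z \<le> ereal h"
  proof (rule ccontr)
    assume "\<not> z \<le> ereal h"
    then have \<alpha>: "h < \<alpha>" using z by simp
    then have \<alpha>0: "0 < \<alpha>" using h by simp
    obtain r where r: "0 < r" and hol: "\<And>y. norm (y - x) < r \<Longrightarrow> \<bar>davenport_series a y - P y\<bar> \<le> C * norm (y - x) powr \<alpha>"
      using ev \<alpha>0 unfolding eventually_nhds_metric by (auto simp: rpow_def dist_norm)
    define e where "e = (\<alpha> / h - 1) / 2"
    have e: "0 < e" "0 < \<alpha> / h - (1 + e)" using \<alpha> h by (auto simp: e_def field_simps)
    obtain K where K: "0 < K" "\<And>n. n \<in> supp a \<Longrightarrow> \<bar>a n\<bar> \<le> K * vnorm n powr - (\<gamma> / 2)"
      using gamma_upper[OF \<gamma>(1) _ odd, of "\<gamma> / 2"] \<gamma>(2) by auto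
    obtain Q where Q: "\<And>q l. Q \<le> vnorm q \<Longrightarrow> 1 \<le> l \<Longrightarrow> int l *s q \<in> supp a \<Longrightarrow>
        \<bar>a (int l *s q)\<bar> powr (1 + e) \<le> \<bar>jump_seq a q\<bar>"
      using theta_lower[OF \<theta> e(1) _ K] \<gamma>(2) by auto
    have off: "real_vec q \<bullet> x \<notin> \<int>" if "q \<noteq> 0" for q
    proof
      assume "real_vec q \<bullet> x \<in> \<int>"
      then obtain p where "real_vec q \<bullet> x = of_int p" by (auto elim: Ints_cases)
      then have "x \<in> rational_hyperplanes" using that by (auto simp: rational_hyperplanes_def hyperplane_def)
      then show False using x by (simp add: approx_set_def)
    qed
    \<comment> \<open>The reduced vector \<open>q\<close> of a long \<open>n\<close> may be short,
      where \<open>theta_lower\<close> says nothing. The point \<open>x\<close> has positive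
      distance \<open>d\<close> from all hyperplanes with short normals, which will exclude
      this.\<close>
    have "finite ({q :: int ^ 'n. vnorm q \<le> Q} - {0})"
      using finite_norm_real_vec_le by (rule finite_Diff)
    then obtain d where "0 < d" "\<And>q p. q \<in> {q. vnorm q \<le> Q} - {0} \<Longrightarrow>
        vnorm q * d \<le> \<bar>real_vec q \<bullet> x - of_int p\<bar>"
      by (rule ex_uniform_gap) (use off in auto)
    then have d: "0 < d" "\<And>q p. q \<noteq> 0 \<Longrightarrow> vnorm q \<le> Q \<Longrightarrow>
        vnorm q * d \<le> \<bar>real_vec q \<bullet> x - of_int p\<bar>" by simp_all
    \<comment> \<open>Below \<open>w\<close>, the distance \<open>A powr (1 / h)\<close> is less
      than \<open>r\<close> and \<open>d\<close>, and the surplus power of \<open>A\<close> is less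
      than \<open>1 / (4 C)\<close>, which turns the final estimate into
      \<open>1 \<le> 1 / 2\<close>.\<close>
    define w where "w = min ((min r d) powr h) ((1 / (4 * C)) powr (1 / (\<alpha> / h - (1 + e))))"
    have w: "0 < w" using r d C by (simp add: w_def)
    obtain k :: nat where k: "max 1 ((2 * K / w) powr (2 / \<gamma>)) \<le> real k" using real_arch_simple by blast
    have "x \<in> tail_layers a h k" using x by (simp add: approx_set_def)
    then obtain n p where n: "n \<in> supp a" "real k \<le> vnorm n"
      and p: "\<bar>real_vec n \<bullet> x - of_int p\<bar> < vnorm n * \<bar>a n\<bar> powr (1 / h)"
      by (auto simp: tail_layers_def layers_def)
    define A where "A = \<bar>a n\<bar>"
    have A0: "0 < A" using n by (simp add: A_def supp_def)
    have N: "1 \<le> vnorm n" "(2 * K / w) powr (2 / \<gamma>) \<le> vnorm n" using n k by auto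
    have Aw: "A < w"
    proof -
      have "A \<le> K * vnorm n powr - (\<gamma> / 2)" using K(2)[OF n(1)] by (simp add: A_def)
      also have "\<dots> \<le> K * ((2 * K / w) powr (2 / \<gamma>)) powr - (\<gamma> / 2)"
        using K w \<gamma> N by (intro mult_left_mono powr_mono2') auto
      also have "\<dots> = w / 2" using K w \<gamma> by (simp add: powr_powr powr_minus)
      finally show ?thesis using w by simp
    qed
    have n0: "n \<noteq> 0" using N(1) by auto
    obtain l q p' where red: "1 \<le> l" "n = int l *s q" "p = int l * p'" "q \<noteq> 0"
      "Gcd (insert p' (range (($) q))) = 1" using ex_reduced[OF n0, of p] by blast
    define D where "D = \<bar>real_vec q \<bullet> x - of_int p'\<bar> / vnorm q"
    have D1: "D < A powr (1 / h)"
    proof -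
      have "real_vec n \<bullet> x - of_int p = real l * (real_vec q \<bullet> x - of_int p')" "vnorm n = real l * vnorm q"
        using red by (simp_all add: real_vec_scale algebra_simps)
      then have "real l * \<bar>real_vec q \<bullet> x - of_int p'\<bar> < real l * vnorm q * A powr (1 / h)"
        using p by (simp add: abs_mult A_def)
      then have "\<bar>real_vec q \<bullet> x - of_int p'\<bar> < vnorm q * A powr (1 / h)"
        using red(1) by (simp add: mult.assoc)
      then show ?thesis using red(4) by (simp add: D_def field_simps)
    qed
    have "A powr (1 / h) < min r d"
    proof -
      have "A powr (1 / h) < ((min r d) powr h) powr (1 / h)"
        using Aw A0 h by (intro powr_less_mono2) (auto simp: w_def)
      then show ?thesis using h r d by (simp add: powr_powr)
    qed
    then have D2: "D < r" "D < d" using D1 by auto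
    have "Q \<le> vnorm q"
    proof (rule ccontr)
      assume "\<not> Q \<le> vnorm q"
      then have "d \<le> D" using d(2)[OF red(4), of p'] red(4) by (simp add: D_def field_simps)
      then show False using D2(2) by simp
    qed
    then have "A powr (1 + e) \<le> \<bar>jump_seq a q\<bar>" using Q[of q l] red n by (simp add: A_def)
    also have "\<dots> \<le> 2 * C * D powr \<alpha>"
      by (rule jump_le_of_holder[OF odd sm red(4,5) isCont_poly_degree_less[OF P] \<alpha>0 C hol D_def D2(1)])
    also have "\<dots> \<le> 2 * C * (A powr (1 / h)) powr \<alpha>"
      using D1 C \<alpha>0 by (intro mult_left_mono powr_mono2) (auto simp: D_def)
    also have "(A powr (1 / h)) powr \<alpha> = A powr (1 + e) * A powr (\<alpha> / h - (1 + e))"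
      using A0 by (simp add: powr_powr flip: powr_add)
    finally have "A powr (1 + e) * 1 \<le> A powr (1 + e) * (2 * C * A powr (\<alpha> / h - (1 + e)))"
      by (simp add: mult_ac)
    then have "1 \<le> 2 * C * A powr (\<alpha> / h - (1 + e))" using A0 by simp
    moreover have "A powr (\<alpha> / h - (1 + e)) < 1 / (4 * C)"
    proof -
      have "A powr (\<alpha> / h - (1 + e)) < ((1 / (4 * C)) powr (1 / (\<alpha> / h - (1 + e)))) powr (\<alpha> / h - (1 + e))"
        using Aw A0 e(2) by (intro powr_less_mono2) (auto simp: w_def)
      then show ?thesis using C e(2) by (simp add: powr_powr)
    qed
    ultimately show False using C by (simp add: field_simps)
  qed
qed

section \<open>Content of similar copies of the limsup set\<close>

lemma hcontent_rational_hyperplanes_eq_0: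
  assumes "real CARD('n) - 1 < t"
  shows "hcontent t (rational_hyperplanes :: (real ^ 'n) set) = 0"
  unfolding rational_hyperplanes_def
proof (rule hcontent_UN_eq_0)
  fix i :: "int \<times> (int ^ 'n)" assume i: "i \<in> UNIV \<times> {q. q \<noteq> 0}"
  obtain p q where "i = (p, q)" "q \<noteq> 0" using i by auto
  then show "hcontent t (case i of (p, q) \<Rightarrow> hyperplane p q) = 0"
    using hcontent_hyperplane_eq_0[OF _ assms, of "real_vec q"] by (simp add: hyperplane_def)
qed auto

text \<open>Each similar copy of each tail is spreading with the same constant, so the countable
  intersection of all of them has positive content in every cube. The copies of the rational
  hyperplanes, still countably many, have content zero and can be removed afterwards.\<close>

lemma hcontent_INT_similar_approx_set:
  fixes a :: "int ^ 'n \<Rightarrow> real" and f :: "nat \<Rightarrow> real ^ 'n \<Rightarrow> real ^ 'n"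
  assumes \<gamma>: "gamma a = ereal \<gamma>" "0 < \<gamma>" and h: "0 < h" "h \<le> \<gamma>"
    and t: "real CARD('n) - 1 < t" "t < real CARD('n) - 1 + h / \<gamma>"
    and sim: "\<And>j. similarity (f j)" and l: "0 < l"
  shows "hcontent t (cube x l \<inter> (\<Inter>j. f j ` approx_set a h)) \<noteq> 0"
proof
  let ?d = "real CARD('n)"
  assume zero: "hcontent t (cube x l \<inter> (\<Inter>j. f j ` approx_set a h)) = 0"
  define b where "b = t - (?d - 1)"
  have b: "0 < b" "b < h / \<gamma>" using t by (auto simp: b_def)
  have "\<gamma> < h / b" using b \<gamma> by (simp add: field_simps)
  \<comment> \<open>\<open>c > \<gamma>\<close> provides arbitrarily long \<open>n\<close> with
    \<open>\<bar>a n\<bar> \<ge> vnorm n powr - c\<close>; \<open>c < h / b\<close> becomes the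
    condition \<open>(k1 + 1) * b < 1\<close>. Positivity of \<open>k1\<close> uses
    \<open>h \<le> \<gamma>\<close>.\<close>
  then obtain c where c: "\<gamma> < c" "c < h / b" using dense by blast
  define k1 where "k1 = c / h - 1"
  have k1: "0 < k1" "(k1 + 1) * b < 1" using c h b by (auto simp: k1_def field_simps)
  have "\<exists>r T b. 0 < r \<and> (\<forall>v. norm (T v) = norm v) \<and>
    (\<forall>v x. v \<bullet> x = ((1 / r) *\<^sub>R T v) \<bullet> f j x - ((1 / r) *\<^sub>R T v) \<bullet> b) \<and> bij (f j)" for j
    using similarity_affine[OF sim[of j]] by metis
  then obtain r T e where r: "\<And>j. 0 < r j" and T: "\<And>j v. norm (T j v) = norm v"
    and aff: "\<And>j v x. v \<bullet> x = ((1 / r j) *\<^sub>R T j v) \<bullet> f j x - ((1 / r j) *\<^sub>R T j v) \<bullet> e j"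
    and bij: "\<And>j. bij (f j)" by metis
  have spread: "spreading t (8 * 16 ^ (CARD('n) - 1)) (f j ` tail_layers a h k)" for j k
  proof (rule spreading_if_layers[OF t(1) _ k1(1)])
    have "h / \<gamma> \<le> 1" using h \<gamma> by simp
    then show "t \<le> ?d" using t by linarith
    show "(k1 + 1) * (t - (?d - 1)) < 1" using k1(2) by (simp add: b_def)
    \<comment> \<open>The power of \<open>r j\<close> compensates for
      \<open>norm u = N / r j\<close>; the factor 1/2 fits the closed layers of the spreading
      criterion into the open layers.\<close>
    show "0 < r j powr - k1 / 2" using r[of j] by simp
    fix B
    obtain n where n: "n \<in> supp a" "max (max 1 (real k)) (r j * B) \<le> vnorm n"
      "vnorm n powr - c \<le> \<bar>a n\<bar>" using gamma_lower[OF \<gamma>(1) c(1)] by blast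
    define N where "N = vnorm n"
    have N: "1 \<le> N" "real k \<le> N" "r j * B \<le> N" using n(2) by (auto simp: N_def)
    define u where "u = (1 / r j) *\<^sub>R T j (real_vec n)"
    have nu: "norm u = N / r j" using r[of j] T[of j] by (simp add: u_def N_def)
    have w: "r j powr - k1 / 2 * norm u powr - k1 < N * \<bar>a n\<bar> powr (1 / h)"
    proof -
      have "r j powr - k1 * norm u powr - k1 = N powr - k1"
        unfolding nu using r[of j] N by (simp add: powr_divide)
      also have "\<dots> = N * (N powr - c) powr (1 / h)"
        using N powr_add[of N 1 "- (c / h)"] by (simp add: powr_powr k1_def)
      also have "\<dots> \<le> N * \<bar>a n\<bar> powr (1 / h)"
        using n(3) N h by (intro mult_left_mono powr_mono2) (auto simp: N_def)
      finally have "r j powr - k1 * norm u powr - k1 \<le> N * \<bar>a n\<bar> powr (1 / h)" .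
      moreover have "0 < r j powr - k1 * norm u powr - k1" unfolding nu using r[of j] N by simp
      ultimately show ?thesis by linarith
    qed
    have "{y. \<exists>p::int. \<bar>u \<bullet> y - u \<bullet> e j - p\<bar> \<le> r j powr - k1 / 2 * norm u powr - k1} \<subseteq> f j ` tail_layers a h k"
    proof
      fix y assume "y \<in> {y. \<exists>p::int. \<bar>u \<bullet> y - u \<bullet> e j - p\<bar> \<le> r j powr - k1 / 2 * norm u powr - k1}"
      then obtain p :: int where p: "\<bar>u \<bullet> y - u \<bullet> e j - p\<bar> \<le> r j powr - k1 / 2 * norm u powr - k1" by blast
      obtain x where x: "y = f j x" using bij[of j] by (metis bij_pointE)
      have "real_vec n \<bullet> x = u \<bullet> y - u \<bullet> e j" unfolding u_def x by (rule aff)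
      then have "\<bar>real_vec n \<bullet> x - p\<bar> < N * \<bar>a n\<bar> powr (1 / h)" using p w by linarith
      then have "x \<in> layers a h n" by (auto simp: layers_def N_def)
      then have "x \<in> tail_layers a h k" using n(1) N(2) by (auto simp: tail_layers_def N_def)
      then show "y \<in> f j ` tail_layers a h k" using x by blast
    qed
    moreover have "B \<le> norm u" unfolding nu using N(3) r[of j] by (simp add: field_simps)
    ultimately show "\<exists>u c. B \<le> norm u \<and>
        {y. \<exists>p::int. \<bar>u \<bullet> y - c - p\<bar> \<le> r j powr - k1 / 2 * norm u powr - k1} \<subseteq> f j ` tail_layers a h k"
      by blast
  qed
  define S where "S i = (case prod_decode i of (j, k) \<Rightarrow> f j ` tail_layers a h k)" for i
  have S: "S (prod_encode (j, k)) = f j ` tail_layers a h k" for j k by (simp add: S_def)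
  have t0: "0 < t" using t(1) card_ge_1[where 'a='n] by linarith
  have C1: "1 \<le> (8 * 16 ^ (CARD('n) - 1) :: real)" using one_le_power[of "16::real" "CARD('n) - 1"] by linarith
  have "spreading t (8 * 16 ^ (CARD('n) - 1)) (S i)" for i
    using spread by (simp add: S_def split: prod.split)
  from hcontent_INT_spreading_ge[OF this C1 t0 l, of x]
  have ge: "ennreal (l powr t / (8 * 16 ^ (CARD('n) - 1))) \<le> hcontent t (cube x l \<inter> (\<Inter>i. S i))" .
  have "0 < ennreal (l powr t / (8 * 16 ^ (CARD('n) - 1)))" using l by simp
  then have pos: "0 < hcontent t (cube x l \<inter> (\<Inter>i. S i))" using ge by (rule less_le_trans)
  have hyp: "hcontent t (\<Union>j. f j ` rational_hyperplanes) = 0"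
  proof -
    have "hcontent t (f j ` hyperplane p q) = 0" if "q \<noteq> 0" for j p q
    proof -
      let ?u = "(1 / r j) *\<^sub>R T j (real_vec q)"
      have "f j ` hyperplane p q \<subseteq> {y. ?u \<bullet> y = of_int p + ?u \<bullet> e j}"
        using aff[of "real_vec q" _ j] by (auto simp: hyperplane_def)
      moreover have "?u \<noteq> 0"
        using T[of j "real_vec q"] r[of j] that
          by (metis norm_eq_zero real_vec_eq_0_iff scaleR_eq_0_iff divide_eq_0_iff less_irrefl zero_neq_one)
      then have "hcontent t {y. ?u \<bullet> y = of_int p + ?u \<bullet> e j} = 0"
        by (rule hcontent_hyperplane_eq_0[OF _ t(1)])
      ultimately show ?thesis using hcontent_mono by (metis le_zero_eq)
    qed
    moreover have "(\<Union>j. f j ` rational_hyperplanes) = (\<Union>(j, p, q) \<in> UNIV \<times> UNIV \<times> {q. q \<noteq> 0}. f j ` hyperplane p q)"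
      by (auto simp: rational_hyperplanes_def)
    moreover have "hcontent t (\<Union>(j, p, q) \<in> UNIV \<times> UNIV \<times> {q. q \<noteq> 0}. f j ` hyperplane p q) = 0"
      using calculation(1) by (intro hcontent_UN_eq_0) auto
    ultimately show ?thesis by simp
  qed
  have "cube x l \<inter> (\<Inter>i. S i) \<subseteq> (cube x l \<inter> (\<Inter>j. f j ` approx_set a h)) \<union> (\<Union>j. f j ` rational_hyperplanes)"
  proof
    fix y assume y: "y \<in> cube x l \<inter> (\<Inter>i. S i)"
    show "y \<in> (cube x l \<inter> (\<Inter>j. f j ` approx_set a h)) \<union> (\<Union>j. f j ` rational_hyperplanes)"
    proof (cases "y \<in> (\<Union>j. f j ` rational_hyperplanes)")
      case False
      have "y \<in> f j ` approx_set a h" for j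
      proof -
        obtain z where z: "y = f j z" using bij[of j] by (metis bij_pointE)
        have "z \<in> tail_layers a h k" for k
        proof -
          have "y \<in> f j ` tail_layers a h k" using y S[of j k] by blast
          then show ?thesis using z bij[of j] by (auto simp: bij_def dest: injD)
        qed
        moreover have "z \<notin> rational_hyperplanes" using False z by blast
        ultimately show ?thesis using z by (auto simp: approx_set_def)
      qed
      then show ?thesis using y by blast
    qed blast
  qed
  then have "hcontent t (cube x l \<inter> (\<Inter>i. S i)) \<le>
      hcontent t ((cube x l \<inter> (\<Inter>j. f j ` approx_set a h)) \<union> (\<Union>j. f j ` rational_hyperplanes))"
    by (rule hcontent_mono)
  also have "\<dots> \<le> 0 + 0" using hcontent_Un_le zero hyp by metis
  finally show False using pos by simp
qed

section \<open>Localisation and the covering bound\<close>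

lemma ex_cube_subset:
  fixes W :: "(real ^ 'n) set"
  assumes "open W" "W \<noteq> {}"
  obtains x l where "0 < l" "cube x l \<subseteq> W"
proof -
  obtain x where "x \<in> W" using assms by blast
  then obtain e where e: "0 < e" "ball x e \<subseteq> W" using assms(1) open_contains_ball by blast
  let ?d = "real CARD('n)"
  have d1: "?d \<ge> 1" by (rule card_ge_1)
  have "cube x (e / (2 * ?d)) \<subseteq> ball x e"
  proof
    fix z assume "z \<in> cube x (e / (2 * ?d))"
    then have "norm (z - x) \<le> ?d * (e / (2 * ?d))"
      by (intro norm_le_card_coord) (simp add: cube_def)
    then show "z \<in> ball x e" using e d1 by (simp add: dist_norm norm_minus_commute)
  qed
  then show ?thesis using that[of "e / (2 * ?d)" x] e d1 by (simp add: subset_trans)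
qed

text \<open>A point off the rational hyperplanes that is approximated at rate
  \<open>\<bar>a n\<bar> powr (1 / B)\<close> only finitely often has exponent at least \<alpha> >
  h. The set is thus covered by the hyperplanes and the limsup set for \<open>B\<close>, where
  \<open>B\<close> is so close to \<open>h\<close> that \<open>B / g\<close> is still below
  \<open>b\<close>.\<close>

lemma hcontent_iso_holder_le_eq_0:
  fixes a :: "int ^ 'n::{finite,linorder} \<Rightarrow> real"
  assumes odd: "odd_seq a" and sm: "(\<lambda>n. \<bar>a n\<bar>) summable_on UNIV" and sp: "sparse_int_set (supp a)"
    and \<gamma>: "gamma a = ereal \<gamma>" "0 < \<gamma>" and h: "0 < h" "h \<le> \<gamma>"
    and t: "real CARD('n) - 1 + h / \<gamma> < t"
  shows "hcontent t (iso_holder_le a h) = 0"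
proof (cases "h = \<gamma>")
  \<comment> \<open>At \<open>h = \<gamma>\<close> no \<open>g\<close> fits between \<open>h\<close>
    and \<gamma>, but then \<open>t\<close> exceeds the dimension \<open>d\<close>.\<close>
  case True
  then show ?thesis using t \<gamma> by (intro hcontent_eq_0_above_dim) simp
next
  case False
  let ?d = "real CARD('n)"
  define b where "b = t - (?d - 1)"
  have hb: "h / \<gamma> < b" using t by (simp add: b_def)
  then have b: "0 < b" using h \<gamma> by (smt (verit) divide_pos_pos)
  \<comment> \<open>\<open>g < \<gamma>\<close> provides the decay, \<open>g > h\<close> leaves room
    for \<alpha>, and \<open>g > h / b\<close> leaves room for \<open>B\<close> with
    \<open>h < B < g * b\<close>.\<close>
  have "max h (h / b) < \<gamma>" using hb b h \<gamma> False by (simp add: field_simps)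
  then obtain g where g: "h < g" "h / b < g" "g < \<gamma>" using dense[of "max h (h / b)" \<gamma>] by auto
  have "h < g * b" using g(2) b by (simp add: field_simps)
  then obtain B where B: "h < B" "B < g * b" using dense by blast
  obtain \<alpha> where \<alpha>: "h < \<alpha>" "\<alpha> < B" "\<alpha> < g"
    using dense[of h "min B g"] B g by auto
  have g0: "0 < g" "0 < B" using g h B by linarith+
  obtain K where K: "0 < K" "\<And>n. n \<in> supp a \<Longrightarrow> \<bar>a n\<bar> \<le> K * vnorm n powr - g"
    using gamma_upper[OF \<gamma>(1) g(3) odd] by blast
  define E where "E = {x. \<forall>R. \<exists>n\<in>supp a. R \<le> vnorm n \<and>
    (\<exists>p::int. \<bar>real_vec n \<bullet> x - p\<bar> \<le> vnorm n * \<bar>a n\<bar> powr (1 / B))}"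
  have "B / g < b" using B g0 by (simp add: field_simps)
  then have bt: "?d - 1 + B / g < t" by (simp add: b_def)
  have "hcontent t E = 0" unfolding E_def by (rule hcontent_well_approximable_eq_0[OF sp K g0 bt])
  moreover have "hcontent t (rational_hyperplanes :: (real, 'n) vec set) = 0"
    using b by (intro hcontent_rational_hyperplanes_eq_0) (simp add: b_def)
  moreover have "iso_holder_le a h \<subseteq> rational_hyperplanes \<union> E"
  proof (rule ccontr)
    assume "\<not> iso_holder_le a h \<subseteq> rational_hyperplanes \<union> E"
    then obtain x where x: "x \<in> iso_holder_le a h" "x \<notin> rational_hyperplanes" "x \<notin> E" by blast
    from x(3) obtain R where R: "\<And>n p. n \<in> supp a \<Longrightarrow> R \<le> vnorm n \<Longrightarrow>
       vnorm n * \<bar>a n\<bar> powr (1 / B) < \<bar>real_vec n \<bullet> x - of_int p\<bar>"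
      unfolding E_def by (simp add: not_le) (meson not_le)
    have off: "real_vec n \<bullet> x \<notin> \<int>" if "n \<noteq> 0" for n
      using x(2) that by (auto simp: rational_hyperplanes_def hyperplane_def elim!: Ints_cases)
    have "ereal \<alpha> \<le> holder_exponent (davenport_series a) x"
      by (rule holder_exponent_ge[OF sm sp K]) (use \<alpha> h off R in auto)
    also have "\<dots> \<le> ereal h" using x(1) by (simp add: iso_holder_le_def)
    finally show False using \<alpha> by simp
  qed
  ultimately show ?thesis
    using hcontent_mono[of "iso_holder_le a h" "rational_hyperplanes \<union> E" t]
      hcontent_Un_le[of t "rational_hyperplanes :: (real, 'n) vec set" E] by simp
qed

theorem theorem3:
  fixes a :: "int ^ 'n::{finite,linorder} \<Rightarrow> real" and h :: real
  assumes "odd_seq a"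
    and "(\<lambda>n. \<bar>a n\<bar>) summable_on UNIV"
    and "sparse_int_set (supp a)"
    and "theta a \<le> 1"
    and "0 < gamma a" and "gamma a < \<infinity>"
    and "0 < h" and "ereal h \<le> gamma a"
  shows "iso_holder_le a h \<in> falconer_class_ext (real CARD('n) - 1 + h / real_of_ereal (gamma a)) \<and>
    (\<forall>W. open W \<and> W \<noteq> {} \<longrightarrow>
      hausdorff_dim (iso_holder_le a h \<inter> W) = ereal (real CARD('n) - 1 + h / real_of_ereal (gamma a)) \<and>
      packing_dim (iso_holder_le a h \<inter> W) = ereal (real CARD('n)))"
proof -
  let ?d = "real CARD('n)"
  define \<gamma> where "\<gamma> = real_of_ereal (gamma a)"
  have \<gamma>: "gamma a = ereal \<gamma>" using assms(5,6) by (cases "gamma a") (auto simp: \<gamma>_def)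
  have \<gamma>0: "0 < \<gamma>" and h: "h \<le> \<gamma>" using assms(5,8) \<gamma> by auto
  define s where "s = ?d - 1 + h / \<gamma>"
  have sd: "?d - 1 < s" using assms(7) \<gamma>0 by (simp add: s_def)
  have s0: "0 \<le> s" using sd card_ge_1[where 'a='n] by linarith
  have sub: "approx_set a h \<subseteq> iso_holder_le a h"
  proof
    fix x assume x: "x \<in> approx_set a h"
    then have "x \<notin> discontinuity_set (jump_seq a)"
      using discontinuity_set_subset by (auto simp: approx_set_def)
    then show "x \<in> iso_holder_le a h"
      using holder_exponent_approx_set_le[OF assms(1,2,4) \<gamma> \<gamma>0 assms(7) x]
        by (simp add: iso_holder_le_def)
  qed
  \<comment> \<open>Arbitrary cubes and similarities serve two purposes: one fixed cube gives
    membership in Falconer's class, and a constant sequence of identities gives the dimension inside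
    \<open>W\<close>.\<close>
  have pos: "hcontent t (cube x l \<inter> (\<Inter>j. f j ` approx_set a h)) \<noteq> 0"
    if "?d - 1 < t" "t < s" "\<And>j. similarity (f j)" "0 < l" for t x l and f :: "nat \<Rightarrow> (real, 'n) vec \<Rightarrow> (real, 'n) vec"
    using hcontent_INT_similar_approx_set[OF \<gamma> \<gamma>0 assms(7) h] that by (simp add: s_def)
  have "approx_set a h \<in> falconer_class s" unfolding falconer_class_def
  proof (intro CollectI conjI gdelta_approx_set allI impI)
    fix f :: "nat \<Rightarrow> (real, 'n) vec \<Rightarrow> (real, 'n) vec" assume f: "\<forall>n. similarity (f n)"
    show "ereal s \<le> hausdorff_dim (\<Inter>n. f n ` approx_set a h)"
    proof (rule hausdorff_dim_ge[OF _ sd])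
      fix t assume "?d - 1 < t" "t < s"
      then have "hcontent t (cube 0 1 \<inter> (\<Inter>n. f n ` approx_set a h)) \<noteq> 0"
        using f by (intro pos) auto
      then show "hcontent t (\<Inter>n. f n ` approx_set a h) \<noteq> 0"
        using hcontent_mono[of "cube 0 1 \<inter> (\<Inter>n. f n ` approx_set a h)" "\<Inter>n. f n ` approx_set a h" t] by auto
    qed
  qed
  then have "iso_holder_le a h \<in> falconer_class_ext s" using sub by (auto simp: falconer_class_ext_def)
  moreover have "hausdorff_dim (iso_holder_le a h \<inter> W) = ereal s \<and>
      packing_dim (iso_holder_le a h \<inter> W) = ereal ?d" if W: "open W" "W \<noteq> {}" for W
  proof
    obtain x l where xl: "0 < l" "cube x l \<subseteq> W" using ex_cube_subset[OF W] by blast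
    show "hausdorff_dim (iso_holder_le a h \<inter> W) = ereal s"
    proof (rule antisym)
      show "hausdorff_dim (iso_holder_le a h \<inter> W) \<le> ereal s"
      proof (rule hausdorff_dim_le[OF _ s0])
        fix t assume "s < t"
        then have "hcontent t (iso_holder_le a h) = 0"
          using hcontent_iso_holder_le_eq_0[OF assms(1-3) \<gamma> \<gamma>0 assms(7) h] by (simp add: s_def)
        then show "hcontent t (iso_holder_le a h \<inter> W) = 0"
          using hcontent_mono[of "iso_holder_le a h \<inter> W" "iso_holder_le a h" t] by simp
      qed
      show "ereal s \<le> hausdorff_dim (iso_holder_le a h \<inter> W)"
      proof (rule hausdorff_dim_ge[OF _ sd])
        fix t assume t: "?d - 1 < t" "t < s"
        have "similarity (id :: (real, 'n) vec \<Rightarrow> (real, 'n) vec)"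
          unfolding similarity_def by (intro exI[of _ 1]) auto
        then have "hcontent t (cube x l \<inter> approx_set a h) \<noteq> 0"
          using pos[OF t, of "\<lambda>_. id" l x] xl by simp
        moreover have "cube x l \<inter> approx_set a h \<subseteq> iso_holder_le a h \<inter> W"
          using sub xl by blast
        ultimately show "hcontent t (iso_holder_le a h \<inter> W) \<noteq> 0"
          using hcontent_mono[of "cube x l \<inter> approx_set a h" "iso_holder_le a h \<inter> W" t] by auto
      qed
    qed
    \<comment> \<open>\<open>\<gamma> + 1\<close> is an arbitrary exponent above \<gamma>; only the
      length of \<open>n\<close> is kept.\<close>
    have unb: "\<exists>n\<in>supp a. B \<le> vnorm n" for B
      using gamma_lower[OF \<gamma>, of "\<gamma> + 1" B] by auto
    show "packing_dim (iso_holder_le a h \<inter> W) = ereal ?d"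
    proof (rule packing_dim_residual[OF countable_approx_family open_approx_family _ W])
      show "\<Inter>(approx_family a h) \<inter> W \<subseteq> iso_holder_le a h \<inter> W"
        using sub approx_set_eq by blast
    qed (use closure_approx_family[OF unb] in auto)
  qed
  ultimately show ?thesis by (simp add: s_def \<gamma>_def)
qed

end
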